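(* For each $n$ let $\mathbf d=\mathbf d^{(n)}=(d_1,\dots,d_n)$ be a vector of integers $d_i\ge 2$ (which may depend on $n$), and let $f$ be a random system in $\mathcal{H}_{\mathbf d}$ distributed according to the Shub–Smale model. Assume that the maximum degree $\mathbf{D}=\max_{1\le i\le n}d_i$ remains bounded as $n$ grows. Then, with $\mathcal{D}=\prod_{i=1}^n d_i$, $$\limsup_{n\to\infty}\frac{\mathbb{E}(\ln\kappa(f))}{\ln(\mathcal{D}^{1/2})}\le 1 .$$
   Context: For $d\in\mathbb{N}$, $\mathcal{H}_d$ is the space of real homogeneous polynomials of degree $d$ in $x_0,\dots,x_n$; for $\mathbf d=(d_1,\dots,d_n)$, $\mathcal{H}_{\mathbf d}:=\mathcal{H}_{d_1}\times\cdots\times\mathcal{H}_{d_n}$. For a multi-index $j=(j_0,\dots,j_n)$ with $|j|=j_0+\cdots+j_n=d$, $x^j=x_0^{j_0}\cdots x_n^{j_n}$ and $\binom{d}{j}=\frac{d!}{j_0!\cdots j_n!}$. The Weyl norm of $g=\sum_{|j|=d}a_jx^j\in\mathcal{H}_d$ is $\|g\|_W=\big(\sum_{|j|=d}a_j^2/\binom dj\big)^{1/2}$. For $f\in\mathcal{H}_{\mathbf d}$, $\|f\|:=\max_{1\le i\le n}\|f_i\|_W$. Condition number: let $S^n$ be the unit sphere in $\mathbb{R}^{n+1}$; for $x\in S^n$ let $D_x(f)=Df(x)|_{T_xS^n}:T_xS^n\to\mathbb{R}^n$ be the derivative of $f$ along the sphere at $x$, and let $M=\mathrm{diag}(\sqrt{d_1},\dots,\sqrt{d_n})$.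 Define $$\mu_{\rm norm}(f,x)=\sqrt n\,\|f\|\,\|D_x(f)^{-1}M\|$$ with $\|D_x(f)^{-1}M\|$ the spectral (Euclidean operator) norm (equal to $+\infty$ if $D_x(f)$ is not invertible), and $$\kappa(f)=\max_{x\in S^n}\min\Big\{\mu_{\rm norm}(f,x),\frac{\|f\|}{\|f(x)\|_\infty}\Big\},$$ where $\|f(x)\|_\infty=\max_i|f_i(x)|$ (the quotient is $+\infty$ if $f(x)=0$). Shub–Smale model: writing $f_i=\sum_{|j|=d_i}a_j^{(i)}x^j$, all coefficients $a^{(i)}_j$ ($1\le i\le n$, $|j|=d_i$) are independent centered Gaussian random variables with $\mathrm{Var}(a_j^{(i)})=\binom{d_i}{j}$. *)

theory Defs
  imports "HOL-Probability.Probability"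
begin

text \<open>
  The number of variables is a quantified natural number, so points are functions on \<open>nat\<close>:
  \<open>\<real>\<^sup>m\<close> is \<open>topspace (Euclidean_space m)\<close> (coordinates \<open>0, \<dots>, m - 1\<close>, zero elsewhere) and
  \<open>S\<^sup>n\<close> is \<open>topspace (nsphere n)\<close>. Equations and degrees are indexed by \<open>i < n\<close>.

  A form of degree \<open>d\<close> in \<open>x\<^sub>0, \<dots>, x\<^sub>n\<close> is given by its coefficients, a function on
  multi-indices of which only the values on \<open>multi_indices n d\<close> are used.
\<close>

type_synonym form = "(nat \<Rightarrow> nat) \<Rightarrow> real"
type_synonym system = "nat \<Rightarrow> form"

definition multi_indices :: "nat \<Rightarrow> nat \<Rightarrow> (nat \<Rightarrow> nat) set" where
  "multi_indices n d = {j. (\<forall>k>n. j k = 0) \<and> (\<Sum>k\<le>n. j k) = d}"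

definition multinomial :: "nat \<Rightarrow> nat \<Rightarrow> (nat \<Rightarrow> nat) \<Rightarrow> real" where
  "multinomial n d j = fact d / (\<Prod>k\<le>n. fact (j k))"

definition eval_form :: "nat \<Rightarrow> nat \<Rightarrow> form \<Rightarrow> (nat \<Rightarrow> real) \<Rightarrow> real" where
  "eval_form n d g x = (\<Sum>j\<in>multi_indices n d. g j * (\<Prod>k\<le>n. x k ^ j k))"

definition weyl_norm :: "nat \<Rightarrow> nat \<Rightarrow> form \<Rightarrow> real" where
  "weyl_norm n d g = sqrt (\<Sum>j\<in>multi_indices n d. (g j)\<^sup>2 / multinomial n d j)"

definition system_norm :: "nat \<Rightarrow> (nat \<Rightarrow> nat) \<Rightarrow> system \<Rightarrow> real" where
  "system_norm n d f = Max ((\<lambda>i. weyl_norm n (d i) (f i)) ` {..<n})"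

definition eval_sup_norm :: "nat \<Rightarrow> (nat \<Rightarrow> nat) \<Rightarrow> system \<Rightarrow> (nat \<Rightarrow> real) \<Rightarrow> real" where
  "eval_sup_norm n d f x = Max ((\<lambda>i. \<bar>eval_form n (d i) (f i) x\<bar>) ` {..<n})"

definition tangent_space :: "nat \<Rightarrow> (nat \<Rightarrow> real) \<Rightarrow> (nat \<Rightarrow> real) set" where
  "tangent_space n x = {v \<in> topspace (Euclidean_space (Suc n)). (\<Sum>k\<le>n. x k * v k) = 0}"

text \<open>\<open>Df(x)v\<close>, computed as the derivative of \<open>t \<mapsto> f(x + tv)\<close> at \<open>t = 0\<close>; the restriction
  \<open>D\<^sub>x(f)\<close> is obtained by only using it on \<open>tangent_space n x\<close>.\<close>

definition system_deriv ::
    "nat \<Rightarrow> (nat \<Rightarrow> nat) \<Rightarrow> system \<Rightarrow> (nat \<Rightarrow> real) \<Rightarrow> (nat \<Rightarrow> real) \<Rightarrow> (nat \<Rightarrow> real)" where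
  "system_deriv n d f x v =
     (\<lambda>i. if i < n then deriv (\<lambda>t. eval_form n (d i) (f i) (\<lambda>k. x k + t * v k)) 0 else 0)"

definition spectral_norm ::
    "nat \<Rightarrow> nat \<Rightarrow> ((nat \<Rightarrow> real) \<Rightarrow> (nat \<Rightarrow> real)) \<Rightarrow> ereal" where
  "spectral_norm m l A =
     (SUP w\<in>{w \<in> topspace (Euclidean_space m). L2_set w {..<m} \<le> 1}. ereal (L2_set (A w) {..<l}))"

text \<open>The value at a singular \<open>D\<^sub>x(f)\<close> is \<open>\<infinity>\<close>, for \<open>f = 0\<close> too (where \<open>0 \<cdot> \<infinity> = 0\<close> in \<open>ereal\<close>).\<close>

definition mu_norm :: "nat \<Rightarrow> (nat \<Rightarrow> nat) \<Rightarrow> system \<Rightarrow> (nat \<Rightarrow> real) \<Rightarrow> ereal" where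
  "mu_norm n d f x =
     (if bij_betw (system_deriv n d f x) (tangent_space n x) (topspace (Euclidean_space n))
      then ereal (sqrt (real n) * system_norm n d f) *
           spectral_norm n (Suc n)
             (\<lambda>w. inv_into (tangent_space n x) (system_deriv n d f x) (\<lambda>i. sqrt (real (d i)) * w i))
      else \<infinity>)"

text \<open>The supremum is attained, since the reciprocal of the minimum is continuous on the sphere.\<close>

definition kappa :: "nat \<Rightarrow> (nat \<Rightarrow> nat) \<Rightarrow> system \<Rightarrow> ereal" where
  "kappa n d f =
     (SUP x\<in>topspace (nsphere n).
        min (mu_norm n d f x)
            (if eval_sup_norm n d f x = 0 then \<infinity>
             else ereal (system_norm n d f / eval_sup_norm n d f x)))"

definition ln_ereal :: "ereal \<Rightarrow> ereal" where
  "ln_ereal x = (if x = \<infinity> then \<infinity> else if x \<le> 0 then -\<infinity> else ereal (ln (real_of_ereal x)))"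

text \<open>Extended expectation \<open>E(X\<^sup>+) - E(X\<^sup>-)\<close>: unlike the Bochner integral it is not \<open>0\<close> when \<open>X\<close>
  fails to be integrable. (\<open>e2ennreal\<close> sends negative values to \<open>0\<close>.)\<close>

definition ereal_expectation :: "'a measure \<Rightarrow> ('a \<Rightarrow> ereal) \<Rightarrow> ereal" where
  "ereal_expectation M X =
     enn2ereal (\<integral>\<^sup>+\<omega>. e2ennreal (X \<omega>) \<partial>M) - enn2ereal (\<integral>\<^sup>+\<omega>. e2ennreal (- X \<omega>) \<partial>M)"

definition shub_smale ::
    "'a measure \<Rightarrow> nat \<Rightarrow> (nat \<Rightarrow> nat) \<Rightarrow> (nat \<Rightarrow> (nat \<Rightarrow> nat) \<Rightarrow> 'a \<Rightarrow> real) \<Rightarrow> bool" where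
  "shub_smale M n d a \<longleftrightarrow>
     prob_space M \<and>
     prob_space.indep_vars M (\<lambda>_. borel) (\<lambda>(i, j). a i j) (SIGMA i:{..<n}. multi_indices n (d i)) \<and>
     (\<forall>i<n. \<forall>j\<in>multi_indices n (d i).
        distributed M lborel (a i j) (normal_density 0 (sqrt (multinomial n (d i) j))))"

end

theory Submission
  imports Defs "HOL-Real_Asymp.Real_Asymp"
begin

text \<open>
  Write \<open>b j = grad (f j) / sqrt (d j)\<close>. If \<open>\<kappa>(f)\<close> is larger than \<open>t\<close>, there is a point \<open>x\<^sub>0\<close> of the sphere where
  all \<open>f j\<close> are of order \<open>\<parallel>f\<parallel> / t\<close> and where the \<open>n\<close> rows \<open>b j\<close>, being nearly orthogonal to \<open>x\<^sub>0\<close> and to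
  a unit tangent vector, are nearly linearly dependent, so that some \<open>b i\<close> is close to a combination
  of the others with coefficients in \<open>[-1, 1]\<close>. Around \<open>x\<^sub>0\<close> one then integrates over a thin spherical
  shell a Gaussian cut-off of \<open>\<bar>f j\<bar>\<close> at scale \<open>r * sqrt (d j)\<close>, times a cut-off of the near dependence
  of \<open>b i\<close>, divided by the Gaussian volume of the ellipsoid where all \<open>\<bar>b j \<bullet> u\<bar>\<close>, \<open>j \<noteq> i\<close>, are at most
  \<open>r\<close> (regularised in the directions orthogonal to them). A linear change of variable near \<open>x\<^sub>0\<close> bounds
  this integral \<open>J\<^sub>i\<close> below by an absolute constant.

  At a fixed \<open>x\<close> the values \<open>f j x\<close> and the rows are uncorrelated up to lower order. Averaging the
  inverse volume is the average of the square root of a determinant, hence by Cauchy-Schwarz is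
  controlled by second moments of minors of Gaussian matrices, and gives
  \<open>E(J\<^sub>i) \<le> sqrt (\<Prod>j. d j) * poly n / t\<close>. Markov's inequality bounds \<open>P(\<kappa>(f) > t)\<close> in the same way, and
  \<open>E(ln \<kappa>(f)) \<le> K + \<Sum>k\<ge>K. P(\<kappa>(f) > exp k)\<close> with \<open>K = ln (sqrt (\<Prod>j. d j)) + sqrt n\<close> makes the sum
  bounded, while \<open>sqrt n\<close> is negligible against \<open>ln (sqrt (\<Prod>j. d j)) \<ge> (n / 2) * ln 2\<close>.
\<close>

subsection \<open>Gaussian integrals of quadratic forms\<close>

text \<open>The denominator is itself of order \<open>n\<close>, so the tail bound for \<kappa> may
  lose a factor \<open>exp (o(n))\<close> but no factor \<open>C ^ n\<close> with
  \<open>C > 1\<close>. This shapes every comparison below: each of the \<open>n\<close> equations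
  and each of the \<open>n + 1\<close> coordinates may lose at most a factor
  \<open>1 + O(1 / n)\<close>, which is why the scales are separated by powers of \<open>n\<close>
  and why factorials, Gaussian constants and ball volumes have to cancel exactly in their
  exponential parts.

  The integral is a smoothed Kac-Rice formula: the division by a volume gives the neighbourhood of
  an ill-conditioned point a mass of order one, however distorted it is, and under the expectation
  the inverse volume takes the role of the Jacobian. A shell replaces the sphere so that Lebesgue
  measure in product form is enough.

  The decay \<open>1 / t\<close> has this origin: \<open>n - 1\<close> rows leave two of the
  \<open>n + 1\<close> directions to the regularisation \<open>\<eta>\<close>, the distinguished row
  contributes a third \<open>\<eta>\<close>, the powers of the cut-off scale \<open>r\<close> leave
  \<open>1 / r\<close>, and the shell has width \<open>l\<close>. With the chosen scales
  \<open>\<eta> ^ 3 * l / r\<close> is a power of \<open>n\<close> times a quantity proportional to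
  \<open>1 / t\<close>.\<close>

abbreviation lam :: "'i set \<Rightarrow> ('i \<Rightarrow> real) measure" where
  "lam A \<equiv> Pi\<^sub>M A (\<lambda>_. lborel)"

interpretation lborel_prod: product_sigma_finite "\<lambda>_. lborel :: real measure"
  by standard

definition dotp :: "'i set \<Rightarrow> ('i \<Rightarrow> real) \<Rightarrow> ('i \<Rightarrow> real) \<Rightarrow> real" where
  "dotp A g u = (\<Sum>a\<in>A. g a * u a)"

definition bform :: "'i set \<Rightarrow> ('i \<Rightarrow> real) \<Rightarrow> 'j set \<Rightarrow> ('j \<Rightarrow> 'i \<Rightarrow> real) \<Rightarrow>
    ('i \<Rightarrow> real) \<Rightarrow> ('i \<Rightarrow> real) \<Rightarrow> real" where
  "bform A s L g u v = (\<Sum>a\<in>A. s a * u a * v a) + (\<Sum>j\<in>L. dotp A (g j) u * dotp A (g j) v)"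

definition gint :: "'i set \<Rightarrow> ('i \<Rightarrow> real) \<Rightarrow> 'j set \<Rightarrow> ('j \<Rightarrow> 'i \<Rightarrow> real) \<Rightarrow> ennreal" where
  "gint A s L g = (\<integral>\<^sup>+u. ennreal (exp (- bform A s L g u u / 2)) \<partial>lam A)"

lemma dotp_cong: "(\<And>a. a \<in> A \<Longrightarrow> u a = v a) \<Longrightarrow> dotp A g u = dotp A g v"
  unfolding dotp_def by (intro sum.cong) auto

lemma dotp_add: "dotp A g (\<lambda>a. u a + v a) = dotp A g u + dotp A g v"
  by (simp add: dotp_def algebra_simps sum.distrib)

lemma dotp_scale: "dotp A g (\<lambda>a. c * u a) = c * dotp A g u"
  by (simp add: dotp_def algebra_simps sum_distrib_left)

lemma dotp_commute: "dotp A u v = dotp A v u"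
  by (simp add: dotp_def mult.commute)

lemma bform_cong:
  "(\<And>a. a \<in> A \<Longrightarrow> u a = u' a) \<Longrightarrow> (\<And>a. a \<in> A \<Longrightarrow> v a = v' a) \<Longrightarrow>
   bform A s L g u v = bform A s L g u' v'"
  using dotp_cong[of A u u'] dotp_cong[of A v v']
  unfolding bform_def by (intro arg_cong2[where f="(+)"] sum.cong) auto

lemma bform_commute: "bform A s L g u v = bform A s L g v u"
  unfolding bform_def by (intro arg_cong2[where f="(+)"] sum.cong) auto

lemma bform_add: "bform A s L g (\<lambda>a. u a + v a) w = bform A s L g u w + bform A s L g v w"
  by (simp add: bform_def dotp_add algebra_simps sum.distrib)

lemma bform_scale: "bform A s L g (\<lambda>a. c * u a) w = c * bform A s L g u w"
  by (simp add: bform_def dotp_scale algebra_simps sum_distrib_left)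

lemma bform_quad:
  "bform A s L g (\<lambda>a. u a + t * w a) (\<lambda>a. u a + t * w a) =
   bform A s L g u u + 2 * t * bform A s L g w u + t\<^sup>2 * bform A s L g w w"
  by (simp add: bform_add bform_scale bform_commute[of A s L g _ "\<lambda>a. u a + t * w a"]
      bform_commute[of A s L g u w] power2_eq_square algebra_simps)

lemma bform_insert:
  "finite L \<Longrightarrow> j \<notin> L \<Longrightarrow>
   bform A s (insert j L) g u v = bform A s L g u v + dotp A (g j) u * dotp A (g j) v"
  by (simp add: bform_def)

lemma bform_nonneg: "(\<And>a. a \<in> A \<Longrightarrow> 0 \<le> s a) \<Longrightarrow> 0 \<le> bform A s L g u u"
  unfolding bform_def by (intro add_nonneg_nonneg sum_nonneg) (auto simp: mult.assoc)

lemma dotp_measurable [measurable]: "dotp A g \<in> borel_measurable (lam A)"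
proof -
  have "(\<lambda>u. dotp A g u) \<in> borel_measurable (lam A)"
    unfolding dotp_def by (intro borel_measurable_sum) measurable
  then show ?thesis by simp
qed

lemma bform_measurable [measurable]: "(\<lambda>u. bform A s L g u u) \<in> borel_measurable (lam A)"
  unfolding bform_def by (intro borel_measurable_add borel_measurable_sum) measurable

text \<open>Translations and dilations suffice as changes of variable, since determinants will come
  from completed squares. The one-dimensional rule is applied to one coordinate at a time.\<close>

lemma nn_integral_lam_affine:
  fixes t :: "'i \<Rightarrow> real"
  assumes "finite A" "c \<noteq> 0" "F \<in> borel_measurable (lam A)"
  shows "(\<integral>\<^sup>+u. F u \<partial>lam A) =
    ennreal (\<bar>c\<bar> ^ card A) * (\<integral>\<^sup>+u. F (\<lambda>a\<in>A. t a + c * u a) \<partial>lam A)"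
  using assms(1,3)
proof (induction A arbitrary: F rule: finite_induct)
  case empty
  then show ?case by (simp add: PiM_empty nn_integral_count_space_finite restrict_def)
next
  case (insert a A)
  note [measurable] = insert.prems
  have *: "(\<lambda>x. \<integral>\<^sup>+y. F (x(a := t a + c * y)) \<partial>lborel) \<in> borel_measurable (lam A)"
    by measurable
  have "(\<integral>\<^sup>+u. F u \<partial>lam (insert a A)) = (\<integral>\<^sup>+x. \<integral>\<^sup>+y. F (x(a := y)) \<partial>lborel \<partial>lam A)"
    by (intro lborel_prod.product_nn_integral_insert insert.hyps insert.prems)
  also have "\<dots> = (\<integral>\<^sup>+x. ennreal \<bar>c\<bar> * (\<integral>\<^sup>+y. F (x(a := t a + c * y)) \<partial>lborel) \<partial>lam A)"
    by (intro nn_integral_cong nn_integral_real_affine) (use assms(2) in measurable)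
  also have "\<dots> = ennreal \<bar>c\<bar> * (\<integral>\<^sup>+x. \<integral>\<^sup>+y. F (x(a := t a + c * y)) \<partial>lborel \<partial>lam A)"
    by (intro nn_integral_cmult *)
  also have "(\<integral>\<^sup>+x. \<integral>\<^sup>+y. F (x(a := t a + c * y)) \<partial>lborel \<partial>lam A) =
     ennreal (\<bar>c\<bar> ^ card A) *
     (\<integral>\<^sup>+x. \<integral>\<^sup>+y. F ((\<lambda>b\<in>A. t b + c * x b)(a := t a + c * y)) \<partial>lborel \<partial>lam A)"
    by (subst insert.IH[OF *]) simp
  also have "(\<integral>\<^sup>+x. \<integral>\<^sup>+y. F ((\<lambda>b\<in>A. t b + c * x b)(a := t a + c * y)) \<partial>lborel \<partial>lam A) =
     (\<integral>\<^sup>+x. \<integral>\<^sup>+y. F (\<lambda>b\<in>insert a A. t b + c * (x(a := y)) b) \<partial>lborel \<partial>lam A)"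
    using insert.hyps by (intro nn_integral_cong arg_cong[where f=F]) (auto simp: fun_eq_iff)
  also have "\<dots> = (\<integral>\<^sup>+u. F (\<lambda>b\<in>insert a A. t b + c * u b) \<partial>lam (insert a A))"
    by (intro lborel_prod.product_nn_integral_insert[symmetric] insert.hyps) measurable
  moreover have "ennreal (\<bar>c\<bar> ^ card (insert a A)) = ennreal \<bar>c\<bar> * ennreal (\<bar>c\<bar> ^ card A)"
    using insert.hyps by (simp add: ennreal_mult[symmetric])
  ultimately show ?case
    by (simp only: mult.assoc)
qed

lemma nn_integral_gauss:
  assumes "0 < s"
  shows "(\<integral>\<^sup>+t. ennreal (exp (- (s * (t + c)\<^sup>2) / 2)) \<partial>lborel) = ennreal (sqrt (2 * pi / s))"
proof -
  have p: "prob_space (density lborel (normal_density (-c) (1 / sqrt s)))"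
    using assms by (intro prob_space_normal_density) simp
  have "(\<integral>\<^sup>+t. ennreal (normal_density (-c) (1 / sqrt s) t) \<partial>lborel) = 1"
    using prob_space.emeasure_space_1[OF p] by (simp add: emeasure_density)
  moreover have "exp (- (s * (t + c)\<^sup>2) / 2) =
      sqrt (2 * pi / s) * normal_density (-c) (1 / sqrt s) t" for t
    using assms by (simp add: normal_density_def power_divide real_sqrt_divide real_sqrt_mult)
  ultimately show ?thesis
    using assms by (simp add: ennreal_mult nn_integral_cmult)
qed

lemma gint_base:
  assumes "finite A" "\<And>a. a \<in> A \<Longrightarrow> 0 < s a"
  shows "gint A s {} g = ennreal (\<Prod>a\<in>A. sqrt (2 * pi / s a))"
proof -
  have "gint A s {} g = (\<integral>\<^sup>+u. (\<Prod>a\<in>A. ennreal (exp (- (s a * (u a + 0)\<^sup>2) / 2))) \<partial>lam A)"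
    unfolding gint_def
    by (intro nn_integral_cong)
       (simp add: bform_def prod_ennreal exp_sum[OF assms(1), symmetric] sum_divide_distrib
         sum_negf power2_eq_square mult.assoc)
  also have "\<dots> = (\<Prod>a\<in>A. \<integral>\<^sup>+t. ennreal (exp (- (s a * (t + 0)\<^sup>2) / 2)) \<partial>lborel)"
    by (intro lborel_prod.product_nn_integral_prod assms) measurable
  also have "\<dots> = (\<Prod>a\<in>A. ennreal (sqrt (2 * pi / s a)))"
    by (intro prod.cong nn_integral_gauss assms refl)
  finally show ?thesis using assms by (subst (asm) prod_ennreal) (auto intro: less_imp_le)
qed

text \<open>Integrating the translates of the larger form along \<open>w\<close> against \<open>exp (- (1 + V) t\<^sup>2 / 2)\<close>
  completes the square in \<open>t\<close> and removes the new row.\<close>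

lemma gint_insert_mult:
  fixes g :: "'j \<Rightarrow> 'i \<Rightarrow> real"
  assumes A: "finite A" "\<And>a. a \<in> A \<Longrightarrow> 0 < s a" and L: "finite L" "j \<notin> L"
    and w: "\<And>u. bform A s L g w u = dotp A (g j) u"
  defines "V \<equiv> dotp A (g j) w"
  shows "gint A s L g = ennreal (sqrt (1 + V)) * gint A s (insert j L) g"
proof -
  have V: "V = bform A s L g w w" by (simp add: w V_def)
  have V0: "0 \<le> V" unfolding V using A by (intro bform_nonneg) (auto intro: less_imp_le)
  let ?Q = "\<lambda>u. bform A s L g u u" and ?Q' = "\<lambda>u. bform A s (insert j L) g u u"
  let ?e = "\<lambda>x. ennreal (exp (- x / 2))"
  let ?y = "\<lambda>u. dotp A (g j) u"
  have tr: "gint A s (insert j L) g = (\<integral>\<^sup>+u. ?e (?Q' (\<lambda>a. u a + t * w a)) \<partial>lam A)" for t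
  proof -
    have "gint A s (insert j L) g =
        (\<integral>\<^sup>+u. ?e (?Q' (\<lambda>a\<in>A. t * w a + 1 * u a)) \<partial>lam A)"
      unfolding gint_def
      by (subst nn_integral_lam_affine[where c=1 and t="\<lambda>a. t * w a"]) (use A in auto)
    also have "\<dots> = (\<integral>\<^sup>+u. ?e (?Q' (\<lambda>a. u a + t * w a)) \<partial>lam A)"
      by (intro nn_integral_cong arg_cong[where f="?e"] bform_cong) auto
    finally show ?thesis .
  qed
  have sq: "(1 + V) * t\<^sup>2 + ?Q' (\<lambda>a. u a + t * w a) = ?Q u + ((1 + V) * t + ?y u)\<^sup>2" for t u
    unfolding bform_insert[OF L] bform_quad w V_def[symmetric]
    by (simp add: dotp_add dotp_scale V_def[symmetric] power2_eq_square algebra_simps)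
  interpret AF: finite_product_sigma_finite "\<lambda>_. lborel :: real measure" A by standard (fact A)
  interpret P: pair_sigma_finite "lborel :: real measure" "lam A"
    by standard
  have [measurable]: "(\<lambda>(t, u). ?Q' (\<lambda>a. u a + t * w a)) \<in> borel_measurable (lborel \<Otimes>\<^sub>M lam A)"
    unfolding bform_insert[OF L] bform_quad w dotp_add dotp_scale by measurable
  have "ennreal (sqrt (2 * pi / (1 + V))) * gint A s (insert j L) g
     = (\<integral>\<^sup>+t. ?e ((1 + V) * (t + 0)\<^sup>2) \<partial>lborel) * gint A s (insert j L) g"
    using V0 by (subst nn_integral_gauss) auto
  also have "\<dots> = (\<integral>\<^sup>+t. ?e ((1 + V) * t\<^sup>2) * gint A s (insert j L) g \<partial>lborel)"
    by (simp add: nn_integral_multc)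
  also have "\<dots> = (\<integral>\<^sup>+t. \<integral>\<^sup>+u. ?e ((1 + V) * t\<^sup>2) * ?e (?Q' (\<lambda>a. u a + t * w a)) \<partial>lam A \<partial>lborel)"
  proof (intro nn_integral_cong)
    fix t
    have "(\<lambda>u. ?e (?Q' (\<lambda>a. u a + t * w a))) \<in> borel_measurable (lam A)"
      unfolding bform_insert[OF L] bform_quad w dotp_add dotp_scale by measurable
    then show "?e ((1 + V) * t\<^sup>2) * gint A s (insert j L) g =
       (\<integral>\<^sup>+u. ?e ((1 + V) * t\<^sup>2) * ?e (?Q' (\<lambda>a. u a + t * w a)) \<partial>lam A)"
      by (simp add: tr[of t] nn_integral_cmult)
  qed
  also have "\<dots> = (\<integral>\<^sup>+u. \<integral>\<^sup>+t. ?e ((1 + V) * t\<^sup>2) * ?e (?Q' (\<lambda>a. u a + t * w a)) \<partial>lborel \<partial>lam A)"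
    by (intro P.Fubini'[symmetric]) measurable
  also have "\<dots> = (\<integral>\<^sup>+u. ?e (?Q u) * ennreal (sqrt (2 * pi / (1 + V)\<^sup>2)) \<partial>lam A)"
  proof (intro nn_integral_cong)
    fix u
    have "?e ((1 + V) * t\<^sup>2) * ?e (?Q' (\<lambda>a. u a + t * w a))
        = ?e (?Q u) * ?e ((1 + V)\<^sup>2 * (t + ?y u / (1 + V))\<^sup>2)" for t
    proof -
      have "(1 + V) * t + ?y u = (1 + V) * (t + ?y u / (1 + V))"
        using V0 by (simp add: field_simps)
      then have "(1 + V) * t\<^sup>2 + ?Q' (\<lambda>a. u a + t * w a) = ?Q u + (1 + V)\<^sup>2 * (t + ?y u / (1 + V))\<^sup>2"
        using sq[of t u] by (simp add: power_mult_distrib)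
      then show ?thesis
        by (simp add: ennreal_mult[symmetric] exp_add[symmetric] field_simps)
    qed
    then have "(\<integral>\<^sup>+t. ?e ((1 + V) * t\<^sup>2) * ?e (?Q' (\<lambda>a. u a + t * w a)) \<partial>lborel) =
      ?e (?Q u) * (\<integral>\<^sup>+t. ?e ((1 + V)\<^sup>2 * (t + ?y u / (1 + V))\<^sup>2) \<partial>lborel)"
      by (simp add: nn_integral_cmult)
    then show "(\<integral>\<^sup>+t. ?e ((1 + V) * t\<^sup>2) * ?e (?Q' (\<lambda>a. u a + t * w a)) \<partial>lborel) =
      ?e (?Q u) * ennreal (sqrt (2 * pi / (1 + V)\<^sup>2))"
      using V0 by (subst (asm) nn_integral_gauss) auto
  qed
  also have "\<dots> = gint A s L g * ennreal (sqrt (2 * pi / (1 + V)\<^sup>2))"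
    by (simp add: gint_def nn_integral_multc)
  finally have *: "ennreal (sqrt (2 * pi / (1 + V))) * gint A s (insert j L) g =
      gint A s L g * ennreal (sqrt (2 * pi / (1 + V)\<^sup>2))" .
  have "gint A s L g = gint A s L g * ennreal (sqrt (2 * pi / (1 + V)\<^sup>2)) * ennreal ((1 + V) / sqrt (2 * pi))"
    using V0 by (simp add: mult.assoc ennreal_mult[symmetric] real_sqrt_divide)
  also have "\<dots> = ennreal (sqrt (2 * pi / (1 + V)) * ((1 + V) / sqrt (2 * pi))) * gint A s (insert j L) g"
    unfolding *[symmetric] using V0 by (subst ennreal_mult) (simp_all add: mult_ac)
  also have "sqrt (2 * pi / (1 + V)) * ((1 + V) / sqrt (2 * pi)) = sqrt (1 + V)"
    using V0 by (simp add: real_sqrt_divide real_div_sqrt)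
  finally show ?thesis .
qed


section \<open>Integrating out one coordinate, and solving linear equations for the form\<close>

lemma bform_remove_coordinate:
  assumes "finite A" "a \<notin> A" "v a = 0"
  shows "bform (insert a A) s L g v v = bform A s L g v v"
  using assms by (simp add: bform_def dotp_def)

text \<open>Here \<open>w\<close> is a column of the inverse matrix and \<open>w a\<close> its
  diagonal entry. For fixed \<open>u a = t\<close>, translating the other coordinates by
  \<open>t / w a * w\<close> removes the cross terms and leaves
  \<open>exp (- t\<^sup>2 / (2 * w a))\<close>, which is the Schur complement in Gaussian
  form.\<close>

lemma gint_insert_coordinate:
  fixes g :: "'j \<Rightarrow> 'i \<Rightarrow> real"
  assumes A: "finite A" "a \<notin> A" and s: "\<And>b. b \<in> insert a A \<Longrightarrow> 0 < s b"
    and w: "\<And>u. bform (insert a A) s L g w u = u a"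
  shows "0 < w a" and "gint (insert a A) s L g = ennreal (sqrt (2 * pi * w a)) * gint A s L g"
proof -
  let ?B = "bform (insert a A) s L g"
  have V: "?B w w = w a" by (simp add: w)
  have "0 \<le> ?B w w" using s by (intro bform_nonneg) (auto intro: less_imp_le)
  moreover have "w a \<noteq> 0"
  proof
    have sn: "\<And>b. b \<in> insert a A \<Longrightarrow> 0 \<le> s b" using s by (blast intro: less_imp_le)
    assume "w a = 0"
    have "0 = (\<Sum>b\<in>insert a A. s b * w b * w b) +
        (\<Sum>j\<in>L. dotp (insert a A) (g j) w * dotp (insert a A) (g j) w)"
      using \<open>w a = 0\<close> V by (simp add: bform_def)
    moreover have "0 \<le> (\<Sum>b\<in>insert a A. s b * w b * w b)"
      using sn by (intro sum_nonneg) (auto simp: mult.assoc)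
    moreover have "0 \<le> (\<Sum>j\<in>L. dotp (insert a A) (g j) w * dotp (insert a A) (g j) w)"
      by (intro sum_nonneg) auto
    ultimately have z: "(\<Sum>b\<in>insert a A. s b * w b * w b) = 0"
      "(\<Sum>j\<in>L. dotp (insert a A) (g j) w * dotp (insert a A) (g j) w) = 0" by linarith+
    have "\<forall>b\<in>insert a A. s b * w b * w b = 0"
      using z(1) A sn by (subst (asm) sum_nonneg_eq_0_iff) (auto simp: mult.assoc)
    then have wz: "b \<in> insert a A \<Longrightarrow> w b = 0" for b using s[of b] by fastforce
    have "?B w (\<lambda>b. 1) = 0"
      unfolding bform_def using wz by (simp add: dotp_def)
    then show False by (simp add: w)
  qed
  ultimately show wa: "0 < w a" using V by simp
  let ?e = "\<lambda>x. ennreal (exp (- x / 2))"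
  have inner: "(\<integral>\<^sup>+u. ?e (?B (u(a := t)) (u(a := t))) \<partial>lam A) =
      ?e (1 / w a * (t + 0)\<^sup>2) * gint A s L g" for t
  proof -
    have eqm: "?B (u(a := t)) (u(a := t)) = bform A s L g u u + 2 * (\<Sum>j\<in>L. g j a * t * dotp A (g j) u)
        + (s a * t\<^sup>2 + (\<Sum>j\<in>L. (g j a * t)\<^sup>2))" for u
    proof -
      have "dotp (insert a A) h (u(a := t)) = h a * t + dotp A h u" for h
        using A by (simp add: dotp_def) (intro sum.cong; auto)
      moreover have "(\<Sum>b\<in>A. s b * (if b = a then t else u b) * (if b = a then t else u b))
          = (\<Sum>b\<in>A. s b * u b * u b)" using A by (intro sum.cong) auto
      ultimately show ?thesis using A
        by (simp add: bform_def power2_eq_square algebra_simps sum.distrib sum_distrib_left)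
    qed
    have m: "(\<lambda>u. ?e (?B (u(a := t)) (u(a := t)))) \<in> borel_measurable (lam A)"
      unfolding eqm by measurable
    have sh: "?B ((\<lambda>b\<in>A. t / w a * w b + 1 * u b)(a := t)) ((\<lambda>b\<in>A. t / w a * w b + 1 * u b)(a := t))
      = bform A s L g u u + t\<^sup>2 / w a" for u
    proof -
      let ?v = "\<lambda>b. (u(a := 0)) b + t / w a * w b"
      have "?B ((\<lambda>b\<in>A. t / w a * w b + 1 * u b)(a := t)) ((\<lambda>b\<in>A. t / w a * w b + 1 * u b)(a := t))
        = ?B ?v ?v"
        using wa A by (intro bform_cong) auto
      also have "\<dots> = ?B (u(a := 0)) (u(a := 0)) + t\<^sup>2 / w a"
        unfolding bform_quad w using wa by (simp add: power2_eq_square fun_upd_def)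
      also have "?B (u(a := 0)) (u(a := 0)) = bform A s L g (u(a := 0)) (u(a := 0))"
        using A by (intro bform_remove_coordinate) auto
      also have "\<dots> = bform A s L g u u"
        using A by (intro bform_cong) auto
      finally show ?thesis .
    qed
    have "(\<integral>\<^sup>+u. ?e (?B (u(a := t)) (u(a := t))) \<partial>lam A) =
       (\<integral>\<^sup>+u. ?e (bform A s L g u u + t\<^sup>2 / w a) \<partial>lam A)"
      by (subst nn_integral_lam_affine[OF A(1) _ m, where c=1 and t="\<lambda>b. t / w a * w b"])
         (simp_all only: sh, simp_all)
    also have "\<dots> = (\<integral>\<^sup>+u. ?e (t\<^sup>2 / w a) * ?e (bform A s L g u u) \<partial>lam A)"
      by (intro nn_integral_cong)
         (simp add: ennreal_mult[symmetric] exp_add[symmetric] field_simps)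
    also have "\<dots> = ?e (t\<^sup>2 / w a) * gint A s L g"
      unfolding gint_def by (intro nn_integral_cmult) measurable
    finally show ?thesis by simp
  qed
  have "gint (insert a A) s L g = (\<integral>\<^sup>+t. \<integral>\<^sup>+u. ?e (?B (u(a := t)) (u(a := t))) \<partial>lam A \<partial>lborel)"
    unfolding gint_def by (intro lborel_prod.product_nn_integral_insert_rev A) measurable
  also have "\<dots> = (\<integral>\<^sup>+t. ?e (1 / w a * (t + 0)\<^sup>2) \<partial>lborel) * gint A s L g"
    unfolding inner by (intro nn_integral_multc) measurable
  also have "\<dots> = ennreal (sqrt (2 * pi * w a)) * gint A s L g"
    using wa by (subst nn_integral_gauss) auto
  finally show "gint (insert a A) s L g = ennreal (sqrt (2 * pi * w a)) * gint A s L g" .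
qed

text \<open>Invertibility of a positive definite form by rank-one updates (Sherman-Morrison): a new
  row corrects the old solution by a multiple of the solution for that row, with denominator
  \<open>1 + V\<close>.\<close>

lemma bform_solve:
  assumes "finite A" "\<And>a. a \<in> A \<Longrightarrow> 0 < s a" "finite L"
  shows "\<exists>w. \<forall>u. bform A s L g w u = dotp A h u"
  using assms(3)
proof (induction L arbitrary: h rule: finite_induct)
  case empty
  show ?case
  proof (intro exI allI)
    fix u
    have "\<And>a. a \<in> A \<Longrightarrow> s a \<noteq> 0" using assms(2) by fastforce
    then show "bform A s {} g (\<lambda>a. h a / s a) u = dotp A h u"
      by (simp add: bform_def dotp_def)
  qed
next
  case (insert j L)
  obtain w where w: "\<And>u. bform A s L g w u = dotp A h u" using insert.IH by metis
  obtain z where z: "\<And>u. bform A s L g z u = dotp A (g j) u" using insert.IH by metis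
  define V where "V = dotp A (g j) z"
  have "V = bform A s L g z z" by (simp add: V_def z)
  moreover have "0 \<le> bform A s L g z z"
    using assms by (intro bform_nonneg) (auto intro: less_imp_le)
  ultimately have V: "0 \<le> V" by simp
  define c where "c = dotp A (g j) w / (1 + V)"
  show ?case
  proof (intro exI allI)
    fix u
    have c: "dotp A (g j) w - c * V = c"
      using V by (simp add: c_def field_simps)
    have "bform A s (insert j L) g (\<lambda>a. w a + (- c) * z a) u =
      dotp A h u - c * dotp A (g j) u + (dotp A (g j) w - c * V) * dotp A (g j) u"
      unfolding bform_insert[OF insert.hyps] bform_add bform_scale w z dotp_add dotp_scale
      by (simp add: V_def algebra_simps)
    then show "bform A s (insert j L) g (\<lambda>a. w a + (- c) * z a) u = dotp A h u"
      unfolding c by simp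
  qed
qed

lemma bform_Cauchy_Schwarz:
  assumes "\<And>a. a \<in> A \<Longrightarrow> 0 \<le> s a"
  shows "(bform A s L g w u)\<^sup>2 \<le> bform A s L g w w * bform A s L g u u"
proof -
  have "0 \<le> bform A s L g u u + 2 * t * bform A s L g w u + t\<^sup>2 * bform A s L g w w" for t
    unfolding bform_quad[symmetric] using assms by (rule bform_nonneg)
  then have *: "0 \<le> bform A s L g w w * t\<^sup>2 + (2 * bform A s L g w u) * t + bform A s L g u u" for t
    by (simp add: algebra_simps)
  have "(2 * bform A s L g w u)\<^sup>2 \<le> 4 * bform A s L g w w * bform A s L g u u"
  proof (cases "bform A s L g w w = 0")
    case True
    have "bform A s L g w u = 0"
    proof (rule ccontr)
      assume "bform A s L g w u \<noteq> 0"
      then show False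
        using *[of "- (bform A s L g u u + 1) / (2 * bform A s L g w u)"] True by simp
    qed
    then show ?thesis using True by simp
  next
    case False
    then have "0 < bform A s L g w w"
      using bform_nonneg[of A s L g w] assms by simp
    then show ?thesis
      using *[of "- bform A s L g w u / bform A s L g w w"]
      by (simp add: field_simps power2_eq_square)
  qed
  then show ?thesis by (simp add: power_mult_distrib)
qed

lemma gint_finite_pos:
  fixes g :: "'j \<Rightarrow> 'i \<Rightarrow> real"
  assumes A: "finite A" "\<And>a. a \<in> A \<Longrightarrow> 0 < s a" and "finite L"
  shows "\<exists>r>0. gint A s L g = ennreal r"
  using assms(3)
proof (induction L rule: finite_induct)
  case empty
  show ?case using assms gint_base[OF A, where g=g]
    by (intro exI[of _ "\<Prod>a\<in>A. sqrt (2 * pi / s a)"]) (auto intro!: prod_pos)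
next
  case (insert j L)
  obtain r where r: "r > 0" "gint A s L g = ennreal r" using insert.IH by auto
  obtain w where w: "\<And>u. bform A s L g w u = dotp A (g j) u"
    using bform_solve[of A s L g "g j"] A insert.hyps by metis
  define V where "V = dotp A (g j) w"
  have "0 \<le> bform A s L g w w" using A by (intro bform_nonneg) (auto intro: less_imp_le)
  then have V: "0 \<le> V" by (simp add: V_def w)
  have e: "ennreal r = ennreal (sqrt (1 + V)) * gint A s (insert j L) g"
    using gint_insert_mult[OF A insert.hyps w] r by (simp add: V_def)
  have "gint A s (insert j L) g = ennreal (1 / sqrt (1 + V)) * (ennreal (sqrt (1 + V)) * gint A s (insert j L) g)"
    using V by (simp add: mult.assoc[symmetric] ennreal_mult[symmetric])
  also have "\<dots> = ennreal (1 / sqrt (1 + V) * r)"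
    using V r by (simp add: e[symmetric] ennreal_mult[symmetric])
  finally show ?case using V r by (intro exI[of _ "1 / sqrt (1 + V) * r"]) auto
qed

definition gI :: "'i set \<Rightarrow> ('i \<Rightarrow> real) \<Rightarrow> 'j set \<Rightarrow> ('j \<Rightarrow> 'i \<Rightarrow> real) \<Rightarrow> real" where
  "gI A s L g = enn2real (gint A s L g)"

text \<open>The determinant of the form, read off from its Gaussian integral.\<close>

definition psi :: "'i set \<Rightarrow> ('i \<Rightarrow> real) \<Rightarrow> 'j set \<Rightarrow> ('j \<Rightarrow> 'i \<Rightarrow> real) \<Rightarrow> real" where
  "psi A s L g = (2 * pi) ^ card A / (gI A s L g)\<^sup>2"

context
  fixes A :: "'i set" and s :: "'i \<Rightarrow> real" and L :: "'j set"
  assumes A: "finite A" "\<And>a. a \<in> A \<Longrightarrow> 0 < s a" and L: "finite L"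
begin

lemma gI_pos: "0 < gI A s L g" and gint_eq_gI: "gint A s L g = ennreal (gI A s L g)"
  using gint_finite_pos[of A s L g] A L by (auto simp: gI_def)

lemma psi_pos: "0 < psi A s L g"
  unfolding psi_def using gI_pos[of g] by simp

lemma gI_insert:
  assumes "j \<notin> L" and w: "\<And>u. bform A s L g w u = dotp A (g j) u"
  shows "0 \<le> dotp A (g j) w" and "gI A s L g = sqrt (1 + dotp A (g j) w) * gI A s (insert j L) g"
proof -
  have "0 \<le> bform A s L g w w" using A by (intro bform_nonneg) (auto intro: less_imp_le)
  then show V: "0 \<le> dotp A (g j) w" by (simp add: w)
  show "gI A s L g = sqrt (1 + dotp A (g j) w) * gI A s (insert j L) g"
    using gint_insert_mult[OF A L assms(1) w] V by (simp add: gI_def enn2real_mult)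
qed

text \<open>The matrix determinant lemma: \<open>w\<close> is the inverse matrix applied to the new
  row.\<close>

lemma psi_insert:
  assumes "j \<notin> L" and w: "\<And>u. bform A s L g w u = dotp A (g j) u"
  shows "psi A s (insert j L) g = psi A s L g * (1 + dotp A (g j) w)"
proof -
  have "0 \<le> dotp A (g j) w" using gI_insert(1)[of j g w] assms by blast
  moreover have "gI A s L g = sqrt (1 + dotp A (g j) w) * gI A s (insert j L) g"
    using gI_insert(2)[of j g w] assms by blast
  ultimately show ?thesis
    by (simp add: psi_def power_mult_distrib)
qed

lemma gint_scale:
  assumes "0 < c"
  shows "(\<integral>\<^sup>+u. ennreal (exp (- (c * bform A s L g u u) / 2)) \<partial>lam A) =
    ennreal ((1 / sqrt c) ^ card A * gI A s L g)"
proof -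
  let ?e = "\<lambda>x. ennreal (exp (- x / 2))"
  have "(\<integral>\<^sup>+u. ?e (c * bform A s L g u u) \<partial>lam A) =
    ennreal (\<bar>1 / sqrt c\<bar> ^ card A) *
    (\<integral>\<^sup>+u. ?e (c * bform A s L g (\<lambda>a\<in>A. 0 + 1 / sqrt c * u a) (\<lambda>a\<in>A. 0 + 1 / sqrt c * u a)) \<partial>lam A)"
    by (rule nn_integral_lam_affine) (use A assms in simp_all)
  also have "(\<integral>\<^sup>+u. ?e (c * bform A s L g (\<lambda>a\<in>A. 0 + 1 / sqrt c * u a) (\<lambda>a\<in>A. 0 + 1 / sqrt c * u a)) \<partial>lam A)
      = gint A s L g"
    unfolding gint_def
  proof (intro nn_integral_cong arg_cong[where f="?e"])
    fix u
    have "bform A s L g (\<lambda>a\<in>A. 0 + 1 / sqrt c * u a) (\<lambda>a\<in>A. 0 + 1 / sqrt c * u a)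
      = bform A s L g (\<lambda>a. 1 / sqrt c * u a) (\<lambda>a. 1 / sqrt c * u a)"
      by (intro bform_cong) auto
    also have "\<dots> = (1 / sqrt c)\<^sup>2 * bform A s L g u u"
      using bform_quad[of A s L g "\<lambda>_. 0" "1 / sqrt c" u]
      by (simp add: bform_def dotp_def)
    finally show "c * bform A s L g (\<lambda>a\<in>A. 0 + 1 / sqrt c * u a) (\<lambda>a\<in>A. 0 + 1 / sqrt c * u a)
      = bform A s L g u u" using assms by (simp add: power_divide)
  qed
  finally show ?thesis using assms gI_pos[of g] by (simp add: gint_eq_gI ennreal_mult)
qed

end

lemma psi_base:
  assumes "finite A" "\<And>a. a \<in> A \<Longrightarrow> 0 < s a"
  shows "psi A s {} g = (\<Prod>a\<in>A. s a)"
proof -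
  have "(\<Prod>a\<in>A. sqrt (2 * pi / s a))\<^sup>2 = (\<Prod>a\<in>A. 2 * pi / s a)"
    unfolding prod_power_distrib using assms
    by (intro prod.cong) (auto intro: less_imp_le)
  moreover have "0 \<le> (\<Prod>a\<in>A. sqrt (2 * pi / s a))"
    using assms by (intro prod_nonneg) (auto intro: less_imp_le)
  ultimately show ?thesis
    by (simp add: psi_def gI_def gint_base[OF assms] prod_dividef)
qed

text \<open>Cramer's rule for a diagonal entry: \<open>w a\<close> is the entry of the inverse
  matrix at \<open>a\<close>, and multiplied by the determinant it gives the complementary principal
  minor.\<close>

lemma psi_remove_coordinate:
  fixes g :: "'j \<Rightarrow> 'i \<Rightarrow> real"
  assumes A: "finite A" "\<And>b. b \<in> A \<Longrightarrow> 0 < s b" and L: "finite L" and a: "a \<in> A"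
    and w: "\<And>u. bform A s L g w u = u a"
  shows "psi A s L g * w a = psi (A - {a}) s L g"
proof -
  have eq: "insert a (A - {a}) = A" using a by auto
  have wa: "0 < w a"
    using gint_insert_coordinate(1)[of "A - {a}" a s L g w] A w unfolding eq by auto
  have "gint A s L g = ennreal (sqrt (2 * pi * w a)) * gint (A - {a}) s L g"
    using gint_insert_coordinate(2)[of "A - {a}" a s L g w] A w unfolding eq by auto
  then have "gI A s L g = sqrt (2 * pi * w a) * gI (A - {a}) s L g"
    using wa by (simp add: gI_def enn2real_mult)
  moreover have "0 < gI (A - {a}) s L g"
    using A L by (intro gI_pos) auto
  moreover have "card A = Suc (card (A - {a}))" using A a by (metis card.remove)
  ultimately show ?thesis using wa
    by (simp add: psi_def power_mult_distrib)
qed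

lemma bform_row_cong:
  "(\<And>k. k \<in> L \<Longrightarrow> g k = g' k) \<Longrightarrow> bform A s L g u v = bform A s L g' u v"
  by (simp add: bform_def)

lemma gint_row_cong: "(\<And>k. k \<in> L \<Longrightarrow> g k = g' k) \<Longrightarrow> gint A s L g = gint A s L g'"
  unfolding gint_def
  by (intro nn_integral_cong) (simp add: bform_row_cong[of L g g'])

lemma psi_row_cong: "(\<And>k. k \<in> L \<Longrightarrow> g k = g' k) \<Longrightarrow> psi A s L g = psi A s L g'"
  unfolding psi_def gI_def using gint_row_cong[of L g g' A s] by simp

lemma dotp_unit: "finite A \<Longrightarrow> a \<in> A \<Longrightarrow> dotp A (\<lambda>c. if c = a then 1 else 0) u = u a"
  by (simp add: dotp_def if_distrib[where f="\<lambda>x. x * _"] cong: if_cong)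

text \<open>The variance of the new row is a sum of squares of linear functionals of it, so only its
  second moments matter; the trace that appears is a sum of principal minors.\<close>

lemma nn_integral_psi_insert_le:
  fixes g :: "'j \<Rightarrow> 'i \<Rightarrow> real" and b :: "'w \<Rightarrow> 'i \<Rightarrow> real" and Phi :: "'w \<Rightarrow> real"
  assumes A: "finite A" "\<And>a. a \<in> A \<Longrightarrow> 0 < s a" and L: "finite L" "j \<notin> L"
    and b[measurable]: "\<And>u. (\<lambda>\<omega>. dotp A u (b \<omega>)) \<in> borel_measurable N"
    and Phi[measurable]: "Phi \<in> borel_measurable N" and Phi0: "\<And>\<omega>. 0 \<le> Phi \<omega>"
    and nn: "0 \<le> \<phi>" "0 \<le> \<theta>"
    and m0: "(\<integral>\<^sup>+\<omega>. ennreal (Phi \<omega>) \<partial>N) \<le> ennreal \<phi>"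
    and m2: "\<And>u. (\<integral>\<^sup>+\<omega>. ennreal (Phi \<omega> * (dotp A u (b \<omega>))\<^sup>2) \<partial>N) \<le> ennreal (\<phi> * \<theta> * (\<Sum>a\<in>A. (u a)\<^sup>2))"
  shows "(\<integral>\<^sup>+\<omega>. ennreal (Phi \<omega> * psi A s (insert j L) (g(j := b \<omega>))) \<partial>N)
     \<le> ennreal (\<phi> * (psi A s L g + \<theta> * (\<Sum>a\<in>A. psi (A - {a}) s L g)))"
proof -
  let ?B = "bform A s L g"
  let ?P = "psi A s L g"
  have P: "0 < ?P" using psi_pos[of A s L g] A L by blast
  have "\<forall>h. \<exists>w. \<forall>u. ?B w u = dotp A h u" using bform_solve[of A s L g] A L(1) by blast
  then obtain W where W: "\<And>h u. ?B (W h) u = dotp A h u" by metis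
  define e :: "'i \<Rightarrow> 'i \<Rightarrow> real" where "e = (\<lambda>a c. if c = a then 1 else 0)"
  have e: "a \<in> A \<Longrightarrow> dotp A (e a) u = u a" for a u
    unfolding e_def using dotp_unit[OF A(1)] by simp
  have We: "a \<in> A \<Longrightarrow> W h a = dotp A (W (e a)) h" for a h
    using W[of "e a" "W h"] W[of h "W (e a)"] e[of a "W h"] bform_commute[of A s L g "W h" "W (e a)"]
    by (simp add: dotp_commute)
  have Wg: "dotp A (g k) (W h) = dotp A (W (g k)) h" for k h
    using W[of "g k" "W h"] W[of h "W (g k)"] bform_commute[of A s L g "W h" "W (g k)"]
    by (simp add: dotp_commute)
  have V: "dotp A h (W h) = (\<Sum>a\<in>A. s a * (dotp A (W (e a)) h)\<^sup>2) + (\<Sum>k\<in>L. (dotp A (W (g k)) h)\<^sup>2)" for h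
  proof -
    have "dotp A h (W h) = ?B (W h) (W h)" by (simp add: W)
    also have "\<dots> = (\<Sum>a\<in>A. s a * (dotp A (W (e a)) h)\<^sup>2) + (\<Sum>k\<in>L. (dotp A (W (g k)) h)\<^sup>2)"
      unfolding bform_def
      by (intro arg_cong2[where f="(+)"] sum.cong refl) (simp_all add: We Wg power2_eq_square mult.assoc)
    finally show ?thesis .
  qed
  define sq where "sq = (\<lambda>h. \<Sum>a\<in>A. (h a)\<^sup>2 :: real)"
  \<comment> \<open>With \<open>B\<close> the matrix of the form, the left-hand side is the trace of
    \<open>inv B * B * inv B\<close>, where the middle factor is expanded into its diagonal and its
    rows.\<close>
  have tr: "(\<Sum>a\<in>A. s a * sq (W (e a))) + (\<Sum>k\<in>L. sq (W (g k))) = (\<Sum>c\<in>A. W (e c) c)"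
  proof -
    have sym: "a \<in> A \<Longrightarrow> c \<in> A \<Longrightarrow> W (e a) c = W (e c) a" for a c
      using We[of c "e a"] e[of a "W (e c)"] by (simp add: dotp_commute)
    have gk: "c \<in> A \<Longrightarrow> W (g k) c = dotp A (g k) (W (e c))" for c k
      using We[of c "g k"] by (simp add: dotp_commute)
    have "(\<Sum>c\<in>A. W (e c) c) = (\<Sum>c\<in>A. dotp A (e c) (W (e c)))"
      by (intro sum.cong) (simp_all add: e)
    also have "\<dots> = (\<Sum>c\<in>A. ?B (W (e c)) (W (e c)))" by (simp add: W)
    also have "\<dots> = (\<Sum>c\<in>A. \<Sum>a\<in>A. s a * (W (e a) c)\<^sup>2) + (\<Sum>c\<in>A. \<Sum>k\<in>L. (W (g k) c)\<^sup>2)"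
      unfolding sum.distrib[symmetric] bform_def
      by (intro sum.cong arg_cong2[where f="(+)"] refl)
         (simp_all add: gk sym power2_eq_square mult.assoc)
    also have "\<dots> = (\<Sum>a\<in>A. s a * sq (W (e a))) + (\<Sum>k\<in>L. sq (W (g k)))"
      unfolding sq_def sum_distrib_left
      by (intro arg_cong2[where f="(+)"]; rule sum.swap)
    finally show ?thesis by simp
  qed
  have s0: "a \<in> A \<Longrightarrow> 0 \<le> s a" for a using A(2) by (intro less_imp_le) auto
  have ps: "psi A s (insert j L) (g(j := h)) = ?P * (1 + dotp A h (W h))" for h
  proof -
    have "psi A s (insert j L) (g(j := h)) = psi A s L (g(j := h)) * (1 + dotp A ((g(j := h)) j) (W h))"
    proof (rule psi_insert)
      show "bform A s L (g(j := h)) (W h) u = dotp A ((g(j := h)) j) u" for u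
        using bform_row_cong[of L "g(j := h)" g A s "W h" u] L(2) W[of h u] by fastforce
    qed (use A L in auto)
    also have "psi A s L (g(j := h)) = ?P"
      using L by (intro psi_row_cong) auto
    finally show ?thesis by (simp only: fun_upd_same)
  qed
  have split: "ennreal (Phi \<omega> * psi A s (insert j L) (g(j := b \<omega>))) =
     ennreal ?P * (ennreal (Phi \<omega>) + ((\<Sum>a\<in>A. ennreal (s a) * ennreal (Phi \<omega> * (dotp A (W (e a)) (b \<omega>))\<^sup>2))
       + (\<Sum>k\<in>L. ennreal (Phi \<omega> * (dotp A (W (g k)) (b \<omega>))\<^sup>2))))" for \<omega>
  proof -
    have "(\<Sum>a\<in>A. ennreal (s a) * ennreal (Phi \<omega> * (dotp A (W (e a)) (b \<omega>))\<^sup>2)) =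
       ennreal (\<Sum>a\<in>A. s a * (Phi \<omega> * (dotp A (W (e a)) (b \<omega>))\<^sup>2))"
      by (subst sum_ennreal[symmetric]) (auto intro!: sum.cong simp: ennreal_mult Phi0 s0)
    moreover have "(\<Sum>k\<in>L. ennreal (Phi \<omega> * (dotp A (W (g k)) (b \<omega>))\<^sup>2)) =
       ennreal (\<Sum>k\<in>L. Phi \<omega> * (dotp A (W (g k)) (b \<omega>))\<^sup>2)"
      by (subst sum_ennreal[symmetric]) (auto simp: Phi0)
    moreover have "0 \<le> (\<Sum>a\<in>A. s a * (Phi \<omega> * (dotp A (W (e a)) (b \<omega>))\<^sup>2))"
      "0 \<le> (\<Sum>k\<in>L. Phi \<omega> * (dotp A (W (g k)) (b \<omega>))\<^sup>2)"
      using Phi0 s0 by (auto intro!: sum_nonneg mult_nonneg_nonneg)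
    ultimately have "ennreal ?P * (ennreal (Phi \<omega>) + ((\<Sum>a\<in>A. ennreal (s a) * ennreal (Phi \<omega> * (dotp A (W (e a)) (b \<omega>))\<^sup>2))
       + (\<Sum>k\<in>L. ennreal (Phi \<omega> * (dotp A (W (g k)) (b \<omega>))\<^sup>2)))) =
      ennreal (?P * (Phi \<omega> + ((\<Sum>a\<in>A. s a * (Phi \<omega> * (dotp A (W (e a)) (b \<omega>))\<^sup>2)) +
        (\<Sum>k\<in>L. Phi \<omega> * (dotp A (W (g k)) (b \<omega>))\<^sup>2))))"
      using P Phi0 by (simp add: ennreal_mult[symmetric] ennreal_plus[symmetric] del: ennreal_plus)
    also have "?P * (Phi \<omega> + ((\<Sum>a\<in>A. s a * (Phi \<omega> * (dotp A (W (e a)) (b \<omega>))\<^sup>2)) +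
        (\<Sum>k\<in>L. Phi \<omega> * (dotp A (W (g k)) (b \<omega>))\<^sup>2))) = Phi \<omega> * psi A s (insert j L) (g(j := b \<omega>))"
      unfolding ps V by (simp add: algebra_simps sum_distrib_left)
    finally show ?thesis by simp
  qed
  have sqn: "0 \<le> sq h" for h by (auto simp: sq_def intro!: sum_nonneg)
  have "(\<integral>\<^sup>+\<omega>. ennreal (Phi \<omega> * psi A s (insert j L) (g(j := b \<omega>))) \<partial>N) =
     ennreal ?P * ((\<integral>\<^sup>+\<omega>. ennreal (Phi \<omega>) \<partial>N) +
       ((\<Sum>a\<in>A. ennreal (s a) * (\<integral>\<^sup>+\<omega>. ennreal (Phi \<omega> * (dotp A (W (e a)) (b \<omega>))\<^sup>2) \<partial>N)) +
        (\<Sum>k\<in>L. (\<integral>\<^sup>+\<omega>. ennreal (Phi \<omega> * (dotp A (W (g k)) (b \<omega>))\<^sup>2) \<partial>N))))"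
    unfolding split
    by (simp add: nn_integral_cmult nn_integral_add nn_integral_sum)
  also have "\<dots> \<le> ennreal ?P * (ennreal \<phi> +
       ((\<Sum>a\<in>A. ennreal (s a) * ennreal (\<phi> * \<theta> * sq (W (e a)))) +
        (\<Sum>k\<in>L. ennreal (\<phi> * \<theta> * sq (W (g k))))))"
    unfolding sq_def by (intro mult_left_mono add_mono sum_mono m0 m2) auto
  also have "\<dots> = ennreal (?P * (\<phi> + ((\<Sum>a\<in>A. s a * (\<phi> * \<theta> * sq (W (e a)))) + (\<Sum>k\<in>L. \<phi> * \<theta> * sq (W (g k))))))"
  proof -
    have 1: "(\<Sum>a\<in>A. ennreal (s a) * ennreal (\<phi> * \<theta> * sq (W (e a)))) = ennreal (\<Sum>a\<in>A. s a * (\<phi> * \<theta> * sq (W (e a))))"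
      using nn sqn s0 by (subst sum_ennreal[symmetric]) (auto intro!: sum.cong simp: ennreal_mult)
    have 2: "(\<Sum>k\<in>L. ennreal (\<phi> * \<theta> * sq (W (g k)))) = ennreal (\<Sum>k\<in>L. \<phi> * \<theta> * sq (W (g k)))"
      using nn sqn by (subst sum_ennreal[symmetric]) auto
    have 3: "0 \<le> (\<Sum>a\<in>A. s a * (\<phi> * \<theta> * sq (W (e a))))" "0 \<le> (\<Sum>k\<in>L. \<phi> * \<theta> * sq (W (g k)))"
      using nn sqn s0 by (auto intro!: sum_nonneg mult_nonneg_nonneg)
    show ?thesis unfolding 1 2 using 3 nn P
      by (simp add: ennreal_mult[symmetric] ennreal_plus[symmetric] del: ennreal_plus)
  qed
  also have "?P * (\<phi> + ((\<Sum>a\<in>A. s a * (\<phi> * \<theta> * sq (W (e a)))) + (\<Sum>k\<in>L. \<phi> * \<theta> * sq (W (g k))))) =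
     \<phi> * (?P + \<theta> * (?P * ((\<Sum>a\<in>A. s a * sq (W (e a))) + (\<Sum>k\<in>L. sq (W (g k))))))"
    by (simp add: algebra_simps sum_distrib_left)
  also have "\<dots> = \<phi> * (?P + \<theta> * (\<Sum>a\<in>A. ?P * W (e a) a))"
    unfolding tr by (simp add: sum_distrib_left)
  also have "(\<Sum>a\<in>A. ?P * W (e a) a) = (\<Sum>a\<in>A. psi (A - {a}) s L g)"
    by (intro sum.cong refl psi_remove_coordinate[OF A L(1)]) (auto simp: W e)
  finally show ?thesis .
qed

subsection \<open>Linear functionals of independent Gaussian variables\<close>

abbreviation gauss :: "real \<Rightarrow> real measure" where
  "gauss v \<equiv> density lborel (\<lambda>x. ennreal (normal_density 0 (sqrt v) x))"

abbreviation gm :: "'i set \<Rightarrow> ('i \<Rightarrow> real) \<Rightarrow> ('i \<Rightarrow> real) measure" where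
  "gm A v \<equiv> Pi\<^sub>M A (\<lambda>a. gauss (v a))"

lemma sets_gm: "sets (gm A v) = sets (lam A)"
  by (intro sets_PiM_cong) auto

lemma product_prob_space_gm:
  assumes "\<And>a. 0 < v a"
  shows "product_prob_space (\<lambda>a. gauss (v a))"
  using assms by (intro product_prob_spaceI prob_space_normal_density) simp

lemma gm_eq_density:
  assumes A: "finite A" and v: "\<And>a. 0 < v a"
  shows "gm A v = density (lam A) (\<lambda>u. \<Prod>a\<in>A. ennreal (normal_density 0 (sqrt (v a)) (u a)))"
proof -
  interpret G: product_prob_space "\<lambda>a. gauss (v a)" A
    by (rule product_prob_space_gm[OF v])
  interpret G: finite_product_prob_space "\<lambda>a. gauss (v a)" A
    by standard (fact A)
  show ?thesis
  proof (rule G.PiM_eqI[OF A, symmetric])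
    show "sets (density (lam A) (\<lambda>u. \<Prod>a\<in>A. ennreal (normal_density 0 (sqrt (v a)) (u a)))) = sets (gm A v)"
      by (simp add: sets_gm)
    fix E assume E: "\<And>i. i \<in> A \<Longrightarrow> E i \<in> sets (gauss (v i))"
    then have E': "\<And>i. i \<in> A \<Longrightarrow> E i \<in> sets lborel" by simp
    have "emeasure (density (lam A) (\<lambda>u. \<Prod>a\<in>A. ennreal (normal_density 0 (sqrt (v a)) (u a)))) (Pi\<^sub>E A E) =
      (\<integral>\<^sup>+u. (\<Prod>a\<in>A. ennreal (normal_density 0 (sqrt (v a)) (u a))) * indicator (Pi\<^sub>E A E) u \<partial>lam A)"
      using E' A by (intro emeasure_density sets_PiM_I_finite borel_measurable_prod) (auto, measurable)
    also have "\<dots> = (\<integral>\<^sup>+u. (\<Prod>a\<in>A. ennreal (normal_density 0 (sqrt (v a)) (u a)) * indicator (E a) (u a)) \<partial>lam A)"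
      by (intro nn_integral_cong) (auto simp: prod.distrib indicator_def PiE_iff space_PiM prod_zero_iff A)
    also have "\<dots> = (\<Prod>a\<in>A. \<integral>\<^sup>+x. ennreal (normal_density 0 (sqrt (v a)) x) * indicator (E a) x \<partial>lborel)"
      using E' by (intro lborel_prod.product_nn_integral_prod A) (auto intro!: borel_measurable_times_ennreal)
    also have "\<dots> = (\<Prod>i\<in>A. emeasure (gauss (v i)) (E i))"
      using E' by (intro prod.cong refl) (simp add: emeasure_density)
    finally show "emeasure (density (lam A) (\<lambda>u. \<Prod>a\<in>A. ennreal (normal_density 0 (sqrt (v a)) (u a)))) (Pi\<^sub>E A E) = \<dots>" .
  qed
qed

text \<open>The bridge between Gaussian expectations and \<open>gint\<close>: independent centred
  variables with variances \<open>v\<close> correspond to the form with diagonal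
  \<open>1 / v\<close> and no rows, normalised by its own integral.\<close>

lemma nn_integral_gm:
  fixes g :: "'j \<Rightarrow> 'i \<Rightarrow> real"
  assumes A: "finite A" and v: "\<And>a. 0 < v a" and F[measurable]: "F \<in> borel_measurable (lam A)"
  shows "(\<integral>\<^sup>+u. F u * ennreal (exp (- bform A (\<lambda>a. 1 / v a) {} g u u / 2)) \<partial>lam A) =
    ennreal (gI A (\<lambda>a. 1 / v a) {} g) * (\<integral>\<^sup>+u. F u \<partial>gm A v)"
proof -
  let ?c = "\<Prod>a\<in>A. sqrt (2 * pi * v a)"
  have c: "0 < ?c" using v by (intro prod_pos) simp
  have gI: "gI A (\<lambda>a. 1 / v a) {} g = ?c"
    using gint_base[OF A, of "\<lambda>a. 1 / v a" g] v c by (simp add: gI_def)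
  have "ennreal ?c * (\<integral>\<^sup>+u. F u \<partial>gm A v) =
    ennreal ?c * (\<integral>\<^sup>+u. (\<Prod>a\<in>A. ennreal (normal_density 0 (sqrt (v a)) (u a))) * F u \<partial>lam A)"
    unfolding gm_eq_density[OF A v] by (subst nn_integral_density) measurable
  also have "\<dots> = (\<integral>\<^sup>+u. ennreal ?c * ((\<Prod>a\<in>A. ennreal (normal_density 0 (sqrt (v a)) (u a))) * F u) \<partial>lam A)"
    by (intro nn_integral_cmult[symmetric]) measurable
  also have "\<dots> = (\<integral>\<^sup>+u. F u * ennreal (exp (- bform A (\<lambda>a. 1 / v a) {} g u u / 2)) \<partial>lam A)"
  proof (intro nn_integral_cong)
    fix u
    have "?c * (\<Prod>a\<in>A. normal_density 0 (sqrt (v a)) (u a)) = (\<Prod>a\<in>A. exp (- (u a)\<^sup>2 / (2 * v a)))"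
      unfolding prod.distrib[symmetric] using v
      by (intro prod.cong refl) (simp add: normal_density_def less_imp_le less_imp_neq[OF v, symmetric])
    also have "\<dots> = exp (- bform A (\<lambda>a. 1 / v a) {} g u u / 2)"
      by (simp add: exp_sum[OF A, symmetric] bform_def sum_divide_distrib sum_negf power2_eq_square field_simps)
    finally have "ennreal ?c * (\<Prod>a\<in>A. ennreal (normal_density 0 (sqrt (v a)) (u a))) =
        ennreal (exp (- bform A (\<lambda>a. 1 / v a) {} g u u / 2))"
      using c by (simp add: prod_ennreal ennreal_mult[symmetric] prod_nonneg)
    then show "ennreal ?c * ((\<Prod>a\<in>A. ennreal (normal_density 0 (sqrt (v a)) (u a))) * F u) =
       F u * ennreal (exp (- bform A (\<lambda>a. 1 / v a) {} g u u / 2))"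
      by (metis mult.assoc mult.commute)
  qed
  finally show ?thesis unfolding gI by simp
qed

text \<open>For the Gaussian pair of linear functionals given by \<open>l\<close> and
  \<open>l'\<close>, with variances \<open>V\<close>, \<open>V'\<close> and covariance
  \<open>G\<close>, the number \<open>X\<close> is the variance of the second one after reweighting
  by the exponential in the first. The two exponents act as rows \<open>sqrt c * l\<close> and
  \<open>sqrt c' * l'\<close>, so two rank-one updates of the determinant give the value.\<close>

lemma nn_integral_gm_exp2:
  fixes l l' :: "'i \<Rightarrow> real"
  assumes A: "finite A" and v: "\<And>a. 0 < v a" and c: "0 \<le> c" "0 \<le> c'"
  defines "V \<equiv> \<Sum>a\<in>A. v a * (l a)\<^sup>2" and "V' \<equiv> \<Sum>a\<in>A. v a * (l' a)\<^sup>2" and "G \<equiv> \<Sum>a\<in>A. v a * l a * l' a"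
  defines "X \<equiv> V' - c * G\<^sup>2 / (1 + c * V)"
  shows "0 \<le> X" and "(\<integral>\<^sup>+u. ennreal (exp (- (c * (dotp A l u)\<^sup>2) / 2 - c' * (dotp A l' u)\<^sup>2 / 2)) \<partial>gm A v)
    = ennreal (1 / (sqrt (1 + c * V) * sqrt (1 + c' * X)))"
proof -
  let ?s = "\<lambda>a. 1 / v a"
  have s: "\<And>a. a \<in> A \<Longrightarrow> 0 < ?s a" using v by simp
  \<comment> \<open>Stated for every coefficient \<open>c''\<close>, because the sign of
    \<open>X\<close> is read off at \<open>c'' = 1\<close>; at \<open>c' = 0\<close> it would be
    invisible.\<close>
  have key: "0 \<le> c'' * X \<and> (\<integral>\<^sup>+u. ennreal (exp (- (c * (dotp A l u)\<^sup>2) / 2 - c'' * (dotp A l' u)\<^sup>2 / 2)) \<partial>gm A v)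
    = ennreal (1 / (sqrt (1 + c * V) * sqrt (1 + c'' * X)))" if c'': "0 \<le> c''" for c''
  proof -
    define g :: "nat \<Rightarrow> 'i \<Rightarrow> real" where
      "g = (\<lambda>j. if j = 0 then (\<lambda>a. sqrt c * l a) else (\<lambda>a. sqrt c'' * l' a))"
    define w0 where "w0 = (\<lambda>a. v a * (sqrt c * l a))"
    have w0: "bform A ?s {} g w0 u = dotp A (g 0) u" for u
      using less_imp_neq[OF v, symmetric] by (simp add: bform_def dotp_def w0_def g_def mult_ac)
    have V0: "dotp A (g 0) w0 = c * V"
      using c by (simp add: dotp_def g_def w0_def V_def sum_distrib_left power2_eq_square mult_ac)
        (simp add: mult.assoc[symmetric])
    have Vn: "0 \<le> V" unfolding V_def by (intro sum_nonneg mult_nonneg_nonneg less_imp_le[OF v]) auto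
    have D: "1 + c * V \<noteq> 0" using Vn c by (metis add_pos_nonneg mult_nonneg_nonneg less_numeral_extra(1,3))
    define k where "k = dotp A (g 0) (\<lambda>a. v a * (sqrt c'' * l' a)) / (1 + c * V)"
    have k: "k = sqrt c * sqrt c'' * G / (1 + c * V)"
      by (simp add: k_def G_def dotp_def g_def sum_distrib_left mult_ac)
    define w1 where "w1 = (\<lambda>a. v a * (sqrt c'' * l' a) + (- k) * w0 a)"
    have w1: "bform A ?s {0} g w1 u = dotp A (g (1::nat)) u" for u
    proof -
      have i: "bform A ?s {0} g z u = bform A ?s {} g z u + dotp A (g 0) z * dotp A (g 0) u" for z
        by (simp add: bform_def)
      have "bform A ?s {} g (\<lambda>a. v a * (sqrt c'' * l' a)) u = dotp A (g 1) u"
        using less_imp_neq[OF v, symmetric] by (simp add: bform_def dotp_def g_def mult_ac)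
      moreover have "dotp A (g 0) (\<lambda>a. v a * (sqrt c'' * l' a)) = k * (1 + c * V)"
        using D by (simp add: k_def)
      ultimately show ?thesis
        unfolding i w1_def bform_add bform_scale dotp_add dotp_scale w0 V0 by (simp add: algebra_simps)
    qed
    have V1: "dotp A (g 1) w1 = c'' * X"
    proof -
      have "dotp A (g 1) (\<lambda>a. v a * (sqrt c'' * l' a)) = c'' * V'"
        using c'' by (simp add: dotp_def g_def V'_def sum_distrib_left power2_eq_square mult_ac)
          (simp add: mult.assoc[symmetric])
      moreover have "dotp A (g 1) w0 = sqrt c * sqrt c'' * G"
        by (simp add: dotp_def g_def G_def w0_def sum_distrib_left mult_ac)
      ultimately show ?thesis
        unfolding w1_def dotp_add dotp_scale k X_def using c c'' D
        by (simp add: field_simps power2_eq_square)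
    qed
    have 1: "gI A ?s {} g = sqrt (1 + c * V) * gI A ?s {0} g"
      using gI_insert(2)[of A ?s "{}" 0 g w0] A s w0 by (simp add: V0)
    have 2: "0 \<le> c'' * X" "gI A ?s {0} g = sqrt (1 + c'' * X) * gI A ?s {0, 1} g"
      using gI_insert[of A ?s "{0}" 1 g w1] A s w1 by (simp_all add: V1[unfolded One_nat_def] insert_commute)
    have p: "0 < gI A ?s {} g" "0 < gI A ?s {0,1} g"
      using A s by (auto intro!: gI_pos)
    have "ennreal (gI A ?s {0, 1} g) = gint A ?s {0, 1} g"
      using gint_eq_gI[of A ?s "{0,1}" g] A s by simp
    also have "\<dots> = (\<integral>\<^sup>+u. ennreal (exp (- (c * (dotp A l u)\<^sup>2) / 2 - c'' * (dotp A l' u)\<^sup>2 / 2)) *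
        ennreal (exp (- bform A ?s {} g u u / 2)) \<partial>lam A)"
      unfolding gint_def
    proof (intro nn_integral_cong)
      fix u
      have "bform A ?s {0, 1} g u u = bform A ?s {} g u u + dotp A (g 0) u * dotp A (g 0) u + dotp A (g 1) u * dotp A (g 1) u"
        by (simp add: bform_def)
      moreover have "dotp A (g 0) u = sqrt c * dotp A l u" "dotp A (g 1) u = sqrt c'' * dotp A l' u"
        by (simp_all add: dotp_def g_def sum_distrib_left mult_ac)
      ultimately have "bform A ?s {0, 1} g u u = bform A ?s {} g u u + c * (dotp A l u)\<^sup>2 + c'' * (dotp A l' u)\<^sup>2"
        using c c'' by (simp add: power2_eq_square mult_ac) (simp add: mult.assoc[symmetric])
      then show "ennreal (exp (- bform A ?s {0, 1} g u u / 2)) =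
        ennreal (exp (- (c * (dotp A l u)\<^sup>2) / 2 - c'' * (dotp A l' u)\<^sup>2 / 2)) *
        ennreal (exp (- bform A ?s {} g u u / 2))"
        by (simp add: ennreal_mult[symmetric] exp_add[symmetric] field_simps)
    qed
    also have "\<dots> = ennreal (gI A ?s {} g) *
       (\<integral>\<^sup>+u. ennreal (exp (- (c * (dotp A l u)\<^sup>2) / 2 - c'' * (dotp A l' u)\<^sup>2 / 2)) \<partial>gm A v)" (is "_ = _ * ?I")
      by (intro nn_integral_gm A v) measurable
    finally have e: "ennreal (gI A ?s {0, 1} g) = ennreal (gI A ?s {} g) * ?I" .
    have "?I = ennreal (1 / gI A ?s {} g) * (ennreal (gI A ?s {} g) * ?I)"
      using p by (simp add: mult.assoc[symmetric] ennreal_mult[symmetric])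
    also have "\<dots> = ennreal (1 / gI A ?s {} g * gI A ?s {0, 1} g)"
      unfolding e[symmetric] using p by (simp add: ennreal_mult[symmetric])
    also have "1 / gI A ?s {} g * gI A ?s {0, 1} g = 1 / (sqrt (1 + c * V) * sqrt (1 + c'' * X))"
      using p 2 by (simp add: 1)
    finally show ?thesis using 2 by simp
  qed
  show "0 \<le> X" using key[of 1] by simp
  show "(\<integral>\<^sup>+u. ennreal (exp (- (c * (dotp A l u)\<^sup>2) / 2 - c' * (dotp A l' u)\<^sup>2 / 2)) \<partial>gm A v)
    = ennreal (1 / (sqrt (1 + c * V) * sqrt (1 + c' * X)))"
    using key[OF c(2)] by simp
qed

lemma one_minus_inverse_sqrt_le: "0 \<le> z \<Longrightarrow> 1 - 1 / sqrt (1 + z) \<le> z / 2"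
proof -
  assume z: "0 \<le> z"
  have "sqrt (1 + z) \<le> 1 + z / 2" using z by (intro real_le_lsqrt) (auto simp: power2_eq_square field_simps)
  then have "1 / (1 + z / 2) \<le> 1 / sqrt (1 + z)" using z by (intro divide_left_mono) auto
  moreover have "1 - z / 2 \<le> 1 / (1 + z / 2)" using z by (simp add: field_simps)
  ultimately show ?thesis by linarith
qed

text \<open>The second moment comes out of the Laplace transform:
  \<open>2 / t * (1 - exp (- t * y\<^sup>2 / 2))\<close> tends to \<open>y\<^sup>2\<close> as
  \<open>t\<close> decreases to 0, while its weighted integral stays below a bound free of
  \<open>t\<close>. Fatou's lemma concludes.\<close>

lemma nn_integral_gm_exp_square_le:
  fixes l l' :: "'i \<Rightarrow> real"
  assumes A: "finite A" and v: "\<And>a. 0 < v a" and c: "0 \<le> c"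
  defines "V \<equiv> \<Sum>a\<in>A. v a * (l a)\<^sup>2" and "V' \<equiv> \<Sum>a\<in>A. v a * (l' a)\<^sup>2" and "G \<equiv> \<Sum>a\<in>A. v a * l a * l' a"
  shows "(\<integral>\<^sup>+u. ennreal (exp (- (c * (dotp A l u)\<^sup>2) / 2) * (dotp A l' u)\<^sup>2) \<partial>gm A v)
    \<le> ennreal (1 / sqrt (1 + c * V) * (V' - c * G\<^sup>2 / (1 + c * V)))"
proof -
  define X where "X = V' - c * G\<^sup>2 / (1 + c * V)"
  have X: "0 \<le> X"
    using nn_integral_gm_exp2(1)[OF A v c c, where l=l and l'=l'] by (simp add: X_def V_def V'_def G_def)
  have V: "0 \<le> V" unfolding V_def by (intro sum_nonneg mult_nonneg_nonneg less_imp_le[OF v]) auto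
  let ?E = "\<lambda>u. exp (- (c * (dotp A l u)\<^sup>2) / 2)" and ?y = "\<lambda>u. dotp A l' u"
  have I: "(\<integral>\<^sup>+u. ennreal (?E u * exp (- t * (?y u)\<^sup>2 / 2)) \<partial>gm A v) =
      ennreal (1 / (sqrt (1 + c * V) * sqrt (1 + t * X)))" if "0 \<le> t" for t
    using nn_integral_gm_exp2(2)[OF A v c that, where l=l and l'=l']
    by (simp add: X_def V_def V'_def G_def exp_add[symmetric])
  have [measurable]: "dotp A h \<in> borel_measurable (gm A v)" for h
    by (subst measurable_cong_sets[OF sets_gm refl]) measurable
  have bd: "(\<integral>\<^sup>+u. ennreal (?E u * (2 / t * (1 - exp (- t * (?y u)\<^sup>2 / 2)))) \<partial>gm A v)
     \<le> ennreal (1 / sqrt (1 + c * V) * X)" if t: "0 < t" for t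
  proof -
    have "(\<integral>\<^sup>+u. ennreal (?E u * (2 / t * (1 - exp (- t * (?y u)\<^sup>2 / 2)))) \<partial>gm A v) =
      (\<integral>\<^sup>+u. ennreal (2 / t) * (ennreal (?E u * exp (- 0 * (?y u)\<^sup>2 / 2)) - ennreal (?E u * exp (- t * (?y u)\<^sup>2 / 2))) \<partial>gm A v)"
    proof (intro nn_integral_cong)
      fix u
      show "ennreal (?E u * (2 / t * (1 - exp (- t * (?y u)\<^sup>2 / 2)))) =
        ennreal (2 / t) * (ennreal (?E u * exp (- 0 * (?y u)\<^sup>2 / 2)) - ennreal (?E u * exp (- t * (?y u)\<^sup>2 / 2)))"
        using t by (subst ennreal_minus, simp, subst ennreal_mult'[symmetric], simp) (simp add: algebra_simps)
    qed
    also have "\<dots> = ennreal (2 / t) * ((\<integral>\<^sup>+u. ennreal (?E u * exp (- 0 * (?y u)\<^sup>2 / 2)) \<partial>gm A v)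
        - (\<integral>\<^sup>+u. ennreal (?E u * exp (- t * (?y u)\<^sup>2 / 2)) \<partial>gm A v))"
      using t I[of t] by (subst nn_integral_cmult, measurable, subst nn_integral_diff)
        (auto intro!: AE_I2 ennreal_leI)
    also have "\<dots> = ennreal (2 / t * (1 / sqrt (1 + c * V) - 1 / (sqrt (1 + c * V) * sqrt (1 + t * X))))"
    proof -
      have "(\<integral>\<^sup>+u. ennreal (?E u * exp (- 0 * (?y u)\<^sup>2 / 2)) \<partial>gm A v)
        - (\<integral>\<^sup>+u. ennreal (?E u * exp (- t * (?y u)\<^sup>2 / 2)) \<partial>gm A v) =
        ennreal (1 / sqrt (1 + c * V) - 1 / (sqrt (1 + c * V) * sqrt (1 + t * X)))"
        using t X V c by (subst I, simp, subst I) (simp_all add: ennreal_minus)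
      then show ?thesis using t by (simp only:, intro ennreal_mult'[symmetric]) simp
    qed
    also have "\<dots> \<le> ennreal (1 / sqrt (1 + c * V) * X)"
    proof (rule ennreal_leI)
      have "2 / t * (1 / sqrt (1 + c * V) - 1 / (sqrt (1 + c * V) * sqrt (1 + t * X))) =
         1 / sqrt (1 + c * V) * (2 / t * (1 - 1 / sqrt (1 + t * X)))"
        by (simp add: algebra_simps)
      also have "\<dots> \<le> 1 / sqrt (1 + c * V) * (2 / t * (t * X / 2))"
        using t X V c one_minus_inverse_sqrt_le[of "t * X"]
        by (intro mult_left_mono) auto
      finally show "2 / t * (1 / sqrt (1 + c * V) - 1 / (sqrt (1 + c * V) * sqrt (1 + t * X))) \<le> 1 / sqrt (1 + c * V) * X"
        using t by simp
    qed
    finally show ?thesis .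
  qed
  have lim: "(\<lambda>n. ennreal (?E u * (2 / (1 / real (Suc n)) * (1 - exp (- (1 / real (Suc n)) * (?y u)\<^sup>2 / 2)))))
     \<longlonglongrightarrow> ennreal (?E u * (?y u)\<^sup>2)" for u
  proof -
    have "((\<lambda>t. 2 / t * (1 - exp (- t * Y / 2))) \<longlongrightarrow> Y) (at_right 0)" for Y :: real
      by real_asymp
    moreover have "filterlim (\<lambda>n. 1 / real (Suc n)) (at_right 0) sequentially"
      by real_asymp
    ultimately have "(\<lambda>n. 2 / (1 / real (Suc n)) * (1 - exp (- (1 / real (Suc n)) * (?y u)\<^sup>2 / 2))) \<longlonglongrightarrow> (?y u)\<^sup>2"
      by (rule filterlim_compose)
    then show ?thesis by (intro tendsto_ennrealI tendsto_mult tendsto_const)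
  qed
  have "(\<integral>\<^sup>+u. ennreal (?E u * (?y u)\<^sup>2) \<partial>gm A v) =
    (\<integral>\<^sup>+u. liminf (\<lambda>n. ennreal (?E u * (2 / (1 / real (Suc n)) * (1 - exp (- (1 / real (Suc n)) * (?y u)\<^sup>2 / 2))))) \<partial>gm A v)"
    by (intro nn_integral_cong lim_imp_Liminf[symmetric] lim) simp
  also have "\<dots> \<le> liminf (\<lambda>n. \<integral>\<^sup>+u. ennreal (?E u * (2 / (1 / real (Suc n)) * (1 - exp (- (1 / real (Suc n)) * (?y u)\<^sup>2 / 2)))) \<partial>gm A v)"
    by (intro nn_integral_liminf) measurable
  also have "\<dots> \<le> liminf (\<lambda>n::nat. ennreal (1 / sqrt (1 + c * V) * X))"
    by (intro Liminf_mono always_eventually allI bd) simp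
  finally show ?thesis by (simp add: X_def Liminf_const)
qed

subsection \<open>Forms and the reproducing kernel\<close>

definition mon_eval :: "nat \<Rightarrow> (nat \<Rightarrow> nat) \<Rightarrow> (nat \<Rightarrow> real) \<Rightarrow> real" where
  "mon_eval n j x = (\<Prod>k\<le>n. x k ^ j k)"

text \<open>For \<open>j k = 0\<close> the truncated exponent \<open>j k - 1\<close> does no harm,
  since the factor in front vanishes.\<close>

definition mon_grad :: "nat \<Rightarrow> (nat \<Rightarrow> nat) \<Rightarrow> (nat \<Rightarrow> real) \<Rightarrow> nat \<Rightarrow> real" where
  "mon_grad n j x k = real (j k) * mon_eval n (j(k := j k - 1)) x"

definition grad :: "nat \<Rightarrow> nat \<Rightarrow> form \<Rightarrow> (nat \<Rightarrow> real) \<Rightarrow> nat \<Rightarrow> real" where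
  "grad n d g x k = (\<Sum>j\<in>multi_indices n d. g j * mon_grad n j x k)"

lemma finite_multi_indices [simp]: "finite (multi_indices n d)"
proof (rule finite_subset)
  show "multi_indices n d \<subseteq> {f. \<forall>x. (x \<in> {..n} \<longrightarrow> f x \<in> {..d}) \<and> (x \<notin> {..n} \<longrightarrow> f x = 0)}"
    by (auto simp: multi_indices_def intro: member_le_sum)
qed (intro finite_set_of_finite_funs, auto)

lemma multinomial_pos: "0 < multinomial n d j"
  by (simp add: multinomial_def prod_pos)

text \<open>The binomial theorem splits off the last variable; \<open>e\<close> is the degree of the
  remaining part of the multi-index.\<close>

lemma multinomial_theorem:
  "(\<Sum>k\<le>n. x k) ^ d = (\<Sum>j\<in>multi_indices n d. multinomial n d j * mon_eval n j x)"
proof (induction n arbitrary: d)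
  case 0
  have "multi_indices 0 d = {\<lambda>k. if k = 0 then d else 0}"
    by (auto simp: multi_indices_def fun_eq_iff)
  then show ?case by (simp add: multinomial_def mon_eval_def)
next
  case (Suc n)
  let ?T = "SIGMA e:{..d}. multi_indices n e"
  have "(\<Sum>k\<le>Suc n. x k) ^ d = (\<Sum>e\<le>d. of_nat (d choose e) * (\<Sum>k\<le>n. x k) ^ e * x (Suc n) ^ (d - e))"
    by (simp add: binomial_ring)
  also have "\<dots> = (\<Sum>e\<le>d. \<Sum>j\<in>multi_indices n e. of_nat (d choose e) * (multinomial n e j * mon_eval n j x) * x (Suc n) ^ (d - e))"
    by (simp add: Suc.IH sum_distrib_left sum_distrib_right)
  also have "\<dots> = (\<Sum>(e, j)\<in>?T. of_nat (d choose e) * (multinomial n e j * mon_eval n j x) * x (Suc n) ^ (d - e))"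
    by (rule sum.Sigma) auto
  also have "\<dots> = (\<Sum>j\<in>multi_indices (Suc n) d. multinomial (Suc n) d j * mon_eval (Suc n) j x)"
  proof (rule sum.reindex_bij_witness[where i="\<lambda>j. (d - j (Suc n), j(Suc n := 0))"
        and j="\<lambda>(e, j). j(Suc n := d - e)"], goal_cases)
    case (1 p)
    then show ?case by (auto simp: multi_indices_def fun_eq_iff)
  next
    case (2 p)
    then show ?case by (auto simp: multi_indices_def)
  next
    case (3 j)
    then show ?case by (auto simp: multi_indices_def)
  next
    case (4 j)
    have "(\<Sum>k\<le>n. (j(Suc n := 0)) k) = (\<Sum>k\<le>n. j k)" by (intro sum.cong) auto
    then show ?case using 4 by (auto simp: multi_indices_def)
  next
    case (5 p)
    obtain e j where p: "p = (e, j)" by (cases p)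
    with 5 have e: "e \<le> d" by auto
    have "(\<Prod>k\<le>n. fact ((j(Suc n := d - e)) k)) = (\<Prod>k\<le>n. fact (j k) :: real)"
      "mon_eval n (j(Suc n := d - e)) x = mon_eval n j x"
      by (auto intro!: prod.cong simp: mon_eval_def)
    then show ?case using e
      by (simp add: p mon_eval_def multinomial_def binomial_fact divide_simps)
  qed
  finally show ?case .
qed

text \<open>With \<open>multinomial\<close> as variances, this is the covariance of the values of a
  random form at \<open>x\<close> and \<open>y\<close>. It depends on the inner product alone, which
  is the rotation invariance of the model, and the covariances involving gradients follow by
  differentiation.\<close>

lemma kernel_eval:
  "(\<Sum>j\<in>multi_indices n d. multinomial n d j * mon_eval n j x * mon_eval n j y) = dotp {..n} x y ^ d"
  using multinomial_theorem[of "\<lambda>k. x k * y k" n d]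
  by (simp add: dotp_def mon_eval_def power_mult_distrib prod.distrib mult.assoc)

lemma mon_eval_has_derivative_line:
  "((\<lambda>t. mon_eval n j (\<lambda>k. x k + t * u k)) has_real_derivative
    dotp {..n} (mon_grad n j (\<lambda>k. x k + t * u k)) u) (at t)"
proof -
  let ?y = "\<lambda>k. x k + t * u k"
  have "((\<lambda>t. \<Prod>k\<in>{..n}. (x k + t * u k) ^ j k) has_real_derivative
     (\<Sum>k\<in>{..n}. (real (j k) * ?y k ^ (j k - 1) * u k) * (\<Prod>l\<in>{..n} - {k}. ?y l ^ j l))) (at t)"
    by (rule has_field_derivative_prod) (auto intro!: derivative_eq_intros)
  moreover have "(\<Sum>k\<in>{..n}. (real (j k) * ?y k ^ (j k - 1) * u k) * (\<Prod>l\<in>{..n} - {k}. ?y l ^ j l))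
     = dotp {..n} (mon_grad n j ?y) u"
    unfolding dotp_def
  proof (intro sum.cong refl)
    fix k assume k: "k \<in> {..n}"
    have "mon_eval n (j(k := j k - 1)) ?y = ?y k ^ (j k - 1) * (\<Prod>l\<in>{..n} - {k}. ?y l ^ j l)"
      unfolding mon_eval_def by (subst prod.remove[OF _ k]) (auto intro!: prod.cong)
    then show "(real (j k) * ?y k ^ (j k - 1) * u k) * (\<Prod>l\<in>{..n} - {k}. ?y l ^ j l) = mon_grad n j ?y k * u k"
      by (simp add: mon_grad_def)
  qed
  ultimately show ?thesis by (simp add: mon_eval_def)
qed

lemma kernel_eval_grad:
  "(\<Sum>j\<in>multi_indices n d. multinomial n d j * mon_eval n j y * dotp {..n} (mon_grad n j x) u) =
   real d * dotp {..n} y x ^ (d - 1) * dotp {..n} y u"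
proof -
  have "((\<lambda>t. \<Sum>j\<in>multi_indices n d. multinomial n d j * mon_eval n j y * mon_eval n j (\<lambda>k. x k + t * u k))
     has_real_derivative
     (\<Sum>j\<in>multi_indices n d. multinomial n d j * mon_eval n j y * dotp {..n} (mon_grad n j (\<lambda>k. x k + 0 * u k)) u)) (at 0)"
    by (intro DERIV_sum DERIV_cmult mon_eval_has_derivative_line)
  then have "((\<lambda>t. (dotp {..n} y x + t * dotp {..n} y u) ^ d)
     has_real_derivative
     (\<Sum>j\<in>multi_indices n d. multinomial n d j * mon_eval n j y * dotp {..n} (mon_grad n j x) u)) (at 0)"
    by (simp add: kernel_eval dotp_add dotp_scale)
  moreover have "((\<lambda>t. (dotp {..n} y x + t * dotp {..n} y u) ^ d)
     has_real_derivative (real d * dotp {..n} y x ^ (d - 1) * dotp {..n} y u)) (at 0)"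
    by (auto intro!: derivative_eq_intros)
  ultimately show ?thesis by (rule DERIV_unique)
qed

text \<open>A second differentiation of the kernel gives the variance of a directional derivative.
  The summand with the factor \<open>d - 1\<close> is an excess variance in the direction of
  \<open>x\<close>, which the cut-off of the value has to compensate in
  \<open>row_moments\<close>.\<close>

lemma kernel_grad_grad:
  "(\<Sum>j\<in>multi_indices n d. multinomial n d j * dotp {..n} (mon_grad n j x) u * dotp {..n} (mon_grad n j x) u) =
   real d * (real (d - 1) * dotp {..n} x x ^ (d - 2) * (dotp {..n} x u)\<^sup>2 +
     dotp {..n} x x ^ (d - 1) * dotp {..n} u u)"
proof -
  let ?D = "dotp {..n}"
  have "((\<lambda>t. \<Sum>j\<in>multi_indices n d. multinomial n d j * ?D (mon_grad n j x) u * mon_eval n j (\<lambda>k. x k + t * u k))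
     has_real_derivative
     (\<Sum>j\<in>multi_indices n d. multinomial n d j * ?D (mon_grad n j x) u * ?D (mon_grad n j (\<lambda>k. x k + 0 * u k)) u)) (at 0)"
    by (intro DERIV_sum DERIV_cmult mon_eval_has_derivative_line)
  moreover have "(\<Sum>j\<in>multi_indices n d. multinomial n d j * ?D (mon_grad n j x) u * mon_eval n j y) =
      real d * ?D x y ^ (d - 1) * ?D u y" for y
    using kernel_eval_grad[of n d y x u] by (simp add: mult_ac dotp_commute[of _ y])
  ultimately have "((\<lambda>t. real d * (?D x x + t * ?D x u) ^ (d - 1) * (?D u x + t * ?D u u))
     has_real_derivative
     (\<Sum>j\<in>multi_indices n d. multinomial n d j * ?D (mon_grad n j x) u * ?D (mon_grad n j x) u)) (at 0)"
    by (simp add: dotp_add dotp_scale)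
  moreover have "((\<lambda>t. real d * (?D x x + t * ?D x u) ^ (d - 1) * (?D u x + t * ?D u u))
     has_real_derivative (real d * (real (d - 1) * ?D x x ^ (d - 2) * (?D x u)\<^sup>2 +
     ?D x x ^ (d - 1) * ?D u u))) (at 0)"
    by (auto intro!: derivative_eq_intros simp: dotp_commute[of _ u x] power2_eq_square algebra_simps
        numeral_2_eq_2)
  ultimately show ?thesis by (rule DERIV_unique)
qed

lemma eval_form_eq_dotp: "eval_form n d g x = dotp (multi_indices n d) (\<lambda>j. mon_eval n j x) g"
  by (simp add: eval_form_def dotp_def mon_eval_def mult.commute)

lemma dotp_grad: "dotp {..n} (grad n d g x) u = dotp (multi_indices n d) (\<lambda>j. dotp {..n} (mon_grad n j x) u) g"
  unfolding dotp_def grad_def sum_distrib_right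
  by (subst sum.swap) (simp add: sum_distrib_left sum_distrib_right mult_ac)

lemma eval_form_has_derivative_line:
  "((\<lambda>t. eval_form n d g (\<lambda>k. x k + t * u k)) has_real_derivative
    dotp {..n} (grad n d g (\<lambda>k. x k + t * u k)) u) (at t)"
proof -
  have "((\<lambda>t. \<Sum>j\<in>multi_indices n d. g j * mon_eval n j (\<lambda>k. x k + t * u k)) has_real_derivative
    (\<Sum>j\<in>multi_indices n d. g j * dotp {..n} (mon_grad n j (\<lambda>k. x k + t * u k)) u)) (at t)"
    by (intro DERIV_sum DERIV_cmult mon_eval_has_derivative_line)
  then show ?thesis unfolding dotp_grad by (simp add: eval_form_def mon_eval_def dotp_def mult.commute)
qed

lemma system_deriv_eq:
  "i < n \<Longrightarrow> system_deriv n d f x v i = dotp {..n} (grad n (d i) (f i) x) v"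
  using DERIV_imp_deriv[OF eval_form_has_derivative_line[of n "d i" "f i" x v 0]]
  by (simp add: system_deriv_def)

lemma Euler_form: "dotp {..n} (grad n d g x) x = real d * eval_form n d g x"
proof -
  have "dotp {..n} (mon_grad n j x) x = real d * mon_eval n j x" if j: "j \<in> multi_indices n d" for j
  proof -
    have "mon_grad n j x k * x k = real (j k) * mon_eval n j x" if k: "k \<in> {..n}" for k
    proof (cases "j k")
      case (Suc m)
      have "mon_eval n (j(k := j k - 1)) x * x k = mon_eval n j x"
        unfolding mon_eval_def using k Suc
        by (subst (1 2) prod.remove[OF _ k]) (auto intro!: prod.cong)
      then show ?thesis by (simp add: mon_grad_def mult.assoc)
    qed (simp add: mon_grad_def)
    then have "dotp {..n} (mon_grad n j x) x = (\<Sum>k\<le>n. real (j k)) * mon_eval n j x"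
      by (simp add: dotp_def sum_distrib_right)
    also have "(\<Sum>k\<le>n. real (j k)) = real d"
      using j by (simp add: multi_indices_def of_nat_sum[symmetric] del: of_nat_sum)
    finally show ?thesis .
  qed
  then show ?thesis
    unfolding dotp_grad by (simp add: dotp_def eval_form_def mon_eval_def sum_distrib_left mult_ac)
qed

subsection \<open>Lipschitz bounds in terms of the Weyl norm\<close>

text \<open>Halved coordinates have absolute value at most 1, and for such factors the difference of
  two products is at most the sum of the differences. The bound 2 leaves room for points near the
  unit sphere.\<close>

lemma mon_eval_lipschitz:
  assumes "\<And>k. k \<le> n \<Longrightarrow> \<bar>x k\<bar> \<le> 2" "\<And>k. k \<le> n \<Longrightarrow> \<bar>y k\<bar> \<le> 2" and j: "(\<Sum>k\<le>n. j k) \<le> d"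
  shows "\<bar>mon_eval n j x - mon_eval n j y\<bar> \<le> 2 ^ d * real d * (\<Sum>k\<le>n. \<bar>x k - y k\<bar>)"
proof -
  define e where "e = (\<Sum>k\<le>n. j k)"
  have sc: "mon_eval n j z = 2 ^ e * (\<Prod>k\<le>n. (z k / 2) ^ j k)" for z
    by (simp add: mon_eval_def e_def power_sum prod.distrib[symmetric] power_divide)
  have "\<bar>(\<Prod>k\<le>n. (x k / 2) ^ j k) - (\<Prod>k\<le>n. (y k / 2) ^ j k)\<bar> \<le> (\<Sum>k\<le>n. \<bar>(x k / 2) ^ j k - (y k / 2) ^ j k\<bar>)"
    using norm_prod_diff[of "{..n}" "\<lambda>k. (x k / 2) ^ j k" "\<lambda>k. (y k / 2) ^ j k"] assms
    by (auto simp: power_abs abs_divide power_le_one)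
  also have "\<dots> \<le> (\<Sum>k\<le>n. real d * \<bar>x k - y k\<bar>)"
  proof (intro sum_mono)
    fix k assume k: "k \<in> {..n}"
    have "j k \<le> d" using member_le_sum[of k "{..n}" j] k j by auto
    have "\<bar>(x k / 2) ^ j k - (y k / 2) ^ j k\<bar> \<le> real (j k) * \<bar>x k / 2 - y k / 2\<bar>"
      using norm_power_diff[of "x k / 2" "y k / 2" "j k"] assms(1,2)[of k] k by auto
    also have "\<dots> \<le> real d * \<bar>x k - y k\<bar>"
      using \<open>j k \<le> d\<close> by (intro mult_mono) auto
    finally show "\<bar>(x k / 2) ^ j k - (y k / 2) ^ j k\<bar> \<le> real d * \<bar>x k - y k\<bar>" .
  qed
  finally have "\<bar>mon_eval n j x - mon_eval n j y\<bar> \<le> 2 ^ e * (\<Sum>k\<le>n. real d * \<bar>x k - y k\<bar>)"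
    unfolding sc by (simp add: right_diff_distrib[symmetric] abs_mult)
  also have "\<dots> \<le> 2 ^ d * (\<Sum>k\<le>n. real d * \<bar>x k - y k\<bar>)"
    using j by (intro mult_right_mono power_increasing sum_nonneg) (auto simp: e_def)
  finally show ?thesis by (simp add: sum_distrib_left mult_ac)
qed

lemma mon_grad_lipschitz:
  assumes "\<And>k. k \<le> n \<Longrightarrow> \<bar>x k\<bar> \<le> 2" "\<And>k. k \<le> n \<Longrightarrow> \<bar>y k\<bar> \<le> 2" and j: "j \<in> multi_indices n d"
    and k: "k \<le> n"
  shows "\<bar>mon_grad n j x k - mon_grad n j y k\<bar> \<le> 2 ^ d * (real d)\<^sup>2 * (\<Sum>k\<le>n. \<bar>x k - y k\<bar>)"
proof -
  have s: "(\<Sum>l\<le>n. (j(k := j k - 1)) l) \<le> d"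
    using j sum_mono[of "{..n}" "j(k := j k - 1)" j] by (auto simp: multi_indices_def)
  have "j k \<le> d" using member_le_sum[of k "{..n}" j] k j by (auto simp: multi_indices_def)
  have "\<bar>mon_grad n j x k - mon_grad n j y k\<bar> = real (j k) * \<bar>mon_eval n (j(k := j k - 1)) x - mon_eval n (j(k := j k - 1)) y\<bar>"
    by (simp add: mon_grad_def right_diff_distrib[symmetric] abs_mult)
  also have "\<dots> \<le> real d * (2 ^ d * real d * (\<Sum>k\<le>n. \<bar>x k - y k\<bar>))"
  proof (intro mult_mono)
    show "\<bar>mon_eval n (j(k := j k - 1)) x - mon_eval n (j(k := j k - 1)) y\<bar> \<le> 2 ^ d * real d * (\<Sum>k\<le>n. \<bar>x k - y k\<bar>)"
      by (rule mon_eval_lipschitz[OF assms(1,2) s])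
  qed (use \<open>j k \<le> d\<close> in auto)
  finally show ?thesis by (simp add: power2_eq_square mult_ac)
qed

text \<open>Cauchy-Schwarz with the weights of the Weyl norm; the multinomial coefficients add up to
  \<open>(n + 1) ^ d\<close>.\<close>

lemma sum_abs_le_weyl_norm:
  "(\<Sum>j\<in>multi_indices n d. \<bar>g j\<bar>) \<le> weyl_norm n d g * sqrt (real (Suc n) ^ d)"
proof -
  have "(\<Sum>j\<in>multi_indices n d. \<bar>g j\<bar>) =
     (\<Sum>j\<in>multi_indices n d. (\<bar>g j\<bar> / sqrt (multinomial n d j)) * sqrt (multinomial n d j))"
    using less_imp_neq[OF multinomial_pos, symmetric] by simp
  also have "\<dots> \<le> sqrt ((\<Sum>j\<in>multi_indices n d. (\<bar>g j\<bar> / sqrt (multinomial n d j))\<^sup>2) *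
      (\<Sum>j\<in>multi_indices n d. (sqrt (multinomial n d j))\<^sup>2))"
    by (intro real_le_rsqrt Cauchy_Schwarz_ineq_sum)
  also have "\<dots> = weyl_norm n d g * sqrt (\<Sum>j\<in>multi_indices n d. multinomial n d j)"
    using less_imp_le[OF multinomial_pos]
    by (simp add: weyl_norm_def real_sqrt_mult power_divide)
  also have "(\<Sum>j\<in>multi_indices n d. multinomial n d j) = real (Suc n) ^ d"
    using multinomial_theorem[of "\<lambda>_. 1" n d] by (simp add: mon_eval_def)
  finally show ?thesis .
qed

lemma sum_abs_le_L2_set: "finite A \<Longrightarrow> (\<Sum>a\<in>A. \<bar>u a\<bar>) \<le> sqrt (real (card A)) * L2_set u A"
proof -
  assume "finite A"
  have "(\<Sum>a\<in>A. \<bar>u a\<bar>) = (\<Sum>a\<in>A. 1 * \<bar>u a\<bar>)" by simp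
  also have "\<dots> \<le> sqrt ((\<Sum>a\<in>A. 1\<^sup>2) * (\<Sum>a\<in>A. \<bar>u a\<bar>\<^sup>2))"
    by (intro real_le_rsqrt Cauchy_Schwarz_ineq_sum)
  finally show ?thesis by (simp add: L2_set_def real_sqrt_mult)
qed

text \<open>A deliberately crude Lipschitz constant. For bounded \<open>D\<close> it is polynomial
  in \<open>n\<close>, so its logarithm is negligible against \<open>n\<close>.\<close>

definition lipc :: "nat \<Rightarrow> nat \<Rightarrow> real" where
  "lipc n D = 2 ^ D * (real D)\<^sup>2 * real (Suc n) ^ Suc D"

lemma grad_lipschitz:
  assumes "\<And>k. k \<le> n \<Longrightarrow> \<bar>x k\<bar> \<le> 2" "\<And>k. k \<le> n \<Longrightarrow> \<bar>y k\<bar> \<le> 2" and d: "d \<le> D"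
  shows "\<bar>dotp {..n} (grad n d g x) u - dotp {..n} (grad n d g y) u\<bar> \<le>
     lipc n D * weyl_norm n d g * L2_set (\<lambda>k. x k - y k) {..n} * L2_set u {..n}"
proof -
  let ?S = "\<Sum>k\<le>n. \<bar>x k - y k\<bar>" and ?U = "\<Sum>k\<le>n. \<bar>u k\<bar>"
  let ?H = "2 ^ d * (real d)\<^sup>2 * ?S"
  have W: "0 \<le> weyl_norm n d g" by (simp add: weyl_norm_def sum_nonneg less_imp_le[OF multinomial_pos])
  have g: "\<bar>grad n d g x k - grad n d g y k\<bar> \<le> weyl_norm n d g * sqrt (real (Suc n) ^ d) * ?H" if "k \<le> n" for k
  proof -
    have "\<bar>grad n d g x k - grad n d g y k\<bar> = \<bar>\<Sum>j\<in>multi_indices n d. g j * (mon_grad n j x k - mon_grad n j y k)\<bar>"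
      by (simp add: grad_def sum_subtractf right_diff_distrib)
    also have "\<dots> \<le> (\<Sum>j\<in>multi_indices n d. \<bar>g j\<bar> * ?H)"
      using mon_grad_lipschitz[OF assms(1,2) _ that]
      by (intro order.trans[OF sum_abs] sum_mono) (auto simp: abs_mult intro!: mult_left_mono)
    also have "\<dots> = (\<Sum>j\<in>multi_indices n d. \<bar>g j\<bar>) * ?H" by (simp add: sum_distrib_right)
    also have "\<dots> \<le> weyl_norm n d g * sqrt (real (Suc n) ^ d) * ?H"
      by (intro mult_right_mono sum_abs_le_weyl_norm mult_nonneg_nonneg sum_nonneg) auto
    finally show ?thesis .
  qed
  have L: "?S \<le> sqrt (real (Suc n)) * L2_set (\<lambda>k. x k - y k) {..n}"
    "?U \<le> sqrt (real (Suc n)) * L2_set u {..n}"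
    using sum_abs_le_L2_set[of "{..n}" "\<lambda>k. x k - y k"] sum_abs_le_L2_set[of "{..n}" u] by auto
  have "\<bar>dotp {..n} (grad n d g x) u - dotp {..n} (grad n d g y) u\<bar> =
      \<bar>\<Sum>k\<le>n. (grad n d g x k - grad n d g y k) * u k\<bar>"
    by (simp add: dotp_def sum_subtractf left_diff_distrib)
  also have "\<dots> \<le> (\<Sum>k\<le>n. (weyl_norm n d g * sqrt (real (Suc n) ^ d) * ?H) * \<bar>u k\<bar>)"
    using g by (intro order.trans[OF sum_abs] sum_mono) (auto simp: abs_mult intro!: mult_right_mono)
  also have "\<dots> = (weyl_norm n d g * sqrt (real (Suc n) ^ d) * (2 ^ d * (real d)\<^sup>2)) * (?S * ?U)"
    unfolding sum_distrib_left[symmetric] by (simp only: mult_ac)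
  also have "\<dots> \<le> (weyl_norm n d g * real (Suc n) ^ D * (2 ^ D * (real D)\<^sup>2)) *
     ((sqrt (real (Suc n)) * L2_set (\<lambda>k. x k - y k) {..n}) * (sqrt (real (Suc n)) * L2_set u {..n}))"
  proof (intro mult_mono L W)
    have "sqrt (real (Suc n) ^ d) \<le> real (Suc n) ^ d"
      by (intro real_le_lsqrt) (auto simp: power2_eq_square intro!: mult_le_cancel_left1[THEN iffD2])
    also have "\<dots> \<le> real (Suc n) ^ D" using d by (intro power_increasing) auto
    finally show "sqrt (real (Suc n) ^ d) \<le> real (Suc n) ^ D" .
    show "(2 :: real) ^ d \<le> 2 ^ D" using d by (intro power_increasing) auto
    show "(real d)\<^sup>2 \<le> (real D)\<^sup>2" using d by (intro power_mono) auto
  qed (auto intro!: mult_nonneg_nonneg sum_nonneg W L2_set_nonneg)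
  also have "\<dots> = (weyl_norm n d g * real (Suc n) ^ D * (2 ^ D * (real D)\<^sup>2)) * (sqrt (real (Suc n)) * sqrt (real (Suc n))) *
     (L2_set (\<lambda>k. x k - y k) {..n} * L2_set u {..n})"
    by (simp only: mult_ac)
  also have "\<dots> = lipc n D * weyl_norm n d g * L2_set (\<lambda>k. x k - y k) {..n} * L2_set u {..n}"
    by (simp add: lipc_def del: of_nat_Suc)
  finally show ?thesis .
qed

lemma eval_form_taylor:
  assumes "\<And>k. k \<le> n \<Longrightarrow> \<bar>x k\<bar> \<le> 1" "\<And>k. k \<le> n \<Longrightarrow> \<bar>u k\<bar> \<le> 1" and d: "d \<le> D"
  shows "\<bar>eval_form n d g (\<lambda>k. x k + u k) - eval_form n d g x - dotp {..n} (grad n d g x) u\<bar> \<le>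
     lipc n D * weyl_norm n d g * (L2_set u {..n})\<^sup>2"
proof -
  let ?p = "\<lambda>t. eval_form n d g (\<lambda>k. x k + t * u k)"
  obtain z where z: "0 < z" "z < 1" and e: "?p 1 - ?p 0 = (1 - 0) * dotp {..n} (grad n d g (\<lambda>k. x k + z * u k)) u"
    using MVT2[of 0 1 ?p "\<lambda>t. dotp {..n} (grad n d g (\<lambda>k. x k + t * u k)) u"]
      eval_form_has_derivative_line[of n d g x u] by auto
  have "\<bar>dotp {..n} (grad n d g (\<lambda>k. x k + z * u k)) u - dotp {..n} (grad n d g x) u\<bar> \<le>
    lipc n D * weyl_norm n d g * L2_set (\<lambda>k. (x k + z * u k) - x k) {..n} * L2_set u {..n}"
  proof (rule grad_lipschitz[OF _ _ d])
    fix k assume k: "k \<le> n"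
    have "\<bar>z * u k\<bar> \<le> 1 * 1" unfolding abs_mult using z assms(2)[OF k] by (intro mult_mono) auto
    then show "\<bar>x k + z * u k\<bar> \<le> 2" using assms(1)[OF k] by linarith
    show "\<bar>x k\<bar> \<le> 2" using assms(1)[OF k] by linarith
  qed
  also have "L2_set (\<lambda>k. (x k + z * u k) - x k) {..n} = z * L2_set u {..n}"
    using z by (simp add: L2_set_def power_mult_distrib sum_distrib_left[symmetric] real_sqrt_mult)
  also have "lipc n D * weyl_norm n d g * (z * L2_set u {..n}) * L2_set u {..n} \<le>
     lipc n D * weyl_norm n d g * (1 * L2_set u {..n}) * L2_set u {..n}"
    using z by (intro mult_left_mono mult_right_mono mult_nonneg_nonneg)
      (auto simp: lipc_def weyl_norm_def sum_nonneg less_imp_le[OF multinomial_pos] L2_set_nonneg)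
  finally show ?thesis using e by (simp add: power2_eq_square mult_ac)
qed

subsection \<open>Homogeneous linear systems\<close>

lemma dotp_scale_left: "dotp A (\<lambda>a. c * g a) u = c * dotp A g u"
  by (simp add: dotp_def sum_distrib_left mult_ac)

lemma dotp_add_left: "dotp A (\<lambda>a. g a + h a) u = dotp A g u + dotp A h u"
  by (simp add: dotp_def algebra_simps sum.distrib)

text \<open>Gaussian elimination: an equation with a nonzero coefficient at \<open>b\<close> removes
  the unknown \<open>b\<close> from the others, and the value at \<open>b\<close> is recovered from
  that equation afterwards.\<close>

lemma homogeneous_system_solution:
  fixes c :: "'e \<Rightarrow> 'u \<Rightarrow> real"
  assumes "finite E" "finite U" "card E < card U"
  shows "\<exists>w. (\<exists>a\<in>U. w a \<noteq> 0) \<and> (\<forall>e\<in>E. dotp U (c e) w = 0)"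
  using assms
proof (induction E arbitrary: U c rule: finite_induct)
  case empty
  then obtain a where "a \<in> U" by fastforce
  then show ?case by (intro exI[of _ "\<lambda>_. 1"]) auto
next
  case (insert e E)
  show ?case
  proof (cases "\<forall>a\<in>U. c e a = 0")
    case True
    then have "dotp U (c e) w = 0" for w by (simp add: dotp_def)
    moreover have "\<exists>w. (\<exists>a\<in>U. w a \<noteq> 0) \<and> (\<forall>e\<in>E. dotp U (c e) w = 0)"
      using insert by (intro insert.IH) auto
    ultimately show ?thesis by auto
  next
    case False
    then obtain b where b: "b \<in> U" "c e b \<noteq> 0" by auto
    let ?U = "U - {b}"
    define c' where "c' = (\<lambda>f a. c f a + (- c f b / c e b) * c e a)"
    have "card U = Suc (card ?U)" using b insert.prems by (metis card.remove)
    then have "card E < card ?U" using insert by simp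
    then obtain w where w: "\<exists>a\<in>?U. w a \<noteq> 0" "\<And>f. f \<in> E \<Longrightarrow> dotp ?U (c' f) w = 0"
      using insert.IH[of ?U c'] insert.prems by auto
    define w' where "w' = w(b := - dotp ?U (c e) w / c e b)"
    have w'b: "w' b = - dotp ?U (c e) w / c e b" by (simp add: w'_def)
    have s: "dotp U h w' = dotp ?U h w - h b * dotp ?U (c e) w / c e b" for h
    proof -
      have "dotp U h w' = h b * w' b + dotp ?U h w'"
        unfolding dotp_def using insert.prems b by (subst sum.remove[of _ b]) auto
      also have "dotp ?U h w' = dotp ?U h w" by (intro dotp_cong) (auto simp: w'_def)
      finally show ?thesis unfolding w'b by simp
    qed
    have c': "dotp ?U (c' f) w = dotp ?U (c f) w - c f b * dotp ?U (c e) w / c e b" for f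
      unfolding c'_def dotp_add_left dotp_scale_left by simp
    have "\<exists>a\<in>U. w' a \<noteq> 0" using w(1) by (auto simp: w'_def)
    moreover have "dotp U (c e) w' = 0" using b by (simp add: s)
    moreover have "dotp U (c f) w' = 0" if "f \<in> E" for f using w(2)[OF that] by (simp add: s c')
    ultimately show ?thesis by auto
  qed
qed

lemma dotp_self: "dotp A u u = (L2_set u A)\<^sup>2"
  by (simp add: dotp_def L2_set_def sum_nonneg power2_eq_square)

lemma abs_dotp_le: "\<bar>dotp A u v\<bar> \<le> L2_set u A * L2_set v A"
proof -
  have "\<bar>dotp A u v\<bar> \<le> (\<Sum>a\<in>A. \<bar>u a\<bar> * \<bar>v a\<bar>)"
    unfolding dotp_def by (rule order.trans[OF sum_abs]) (simp add: abs_mult)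
  also have "\<dots> \<le> L2_set u A * L2_set v A" by (rule L2_set_mult_ineq)
  finally show ?thesis .
qed

text \<open>\<open>n\<close> rows that are nearly orthogonal to two orthonormal vectors of an \<open>(n + 1)\<close>-dimensional
  space project to an \<open>(n - 1)\<close>-dimensional one, hence are nearly dependent.\<close>

lemma nearly_dependent_row:
  fixes b :: "nat \<Rightarrow> nat \<Rightarrow> real"
  assumes x: "L2_set x {..n} = 1" and v: "L2_set v {..n} = 1" and xv: "dotp {..n} x v = 0"
  shows "\<exists>i<n. \<exists>c. (\<forall>j<n. \<bar>c j\<bar> \<le> 1) \<and>
    (\<forall>u. \<bar>dotp {..n} (b i) u - (\<Sum>j\<in>{..<n} - {i}. c j * dotp {..n} (b j) u)\<bar> \<le>
      (\<Sum>j<n. \<bar>dotp {..n} (b j) x\<bar> + \<bar>dotp {..n} (b j) v\<bar>) * L2_set u {..n})"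
proof -
  let ?D = "dotp {..n}"
  define b' where "b' = (\<lambda>j a. b j a + (- ?D (b j) x) * x a + (- ?D (b j) v) * v a)"
  \<comment> \<open>The unknowns are the coefficients of a linear relation between
    \<open>n + 2\<close> vectors in \<open>n + 1\<close> dimensions: the projected rows, then
    \<open>x\<close> at index \<open>n\<close> and \<open>v\<close> at index \<open>n + 1\<close>.
    The last two coefficients vanish, because the projected rows are orthogonal to both
    vectors.\<close>
  define M where "M = (\<lambda>a j. if j < n then b' j a else if j = n then x a else v a)"
  obtain y where y: "\<exists>j\<in>{..<Suc (Suc n)}. y j \<noteq> 0" "\<And>a. a \<in> {..n} \<Longrightarrow> dotp {..<Suc (Suc n)} (M a) y = 0"
    using homogeneous_system_solution[of "{..n}" "{..<Suc (Suc n)}" M] by auto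
  have exp: "(\<Sum>j<n. b' j a * y j) + x a * y n + v a * y (Suc n) = 0" if "a \<le> n" for a
    using y(2)[of a] that by (simp add: dotp_def M_def)
  have comb: "(\<Sum>j<n. y j * ?D (b' j) u) + y n * ?D x u + y (Suc n) * ?D v u = 0" for u
  proof -
    have "(\<Sum>j<n. y j * ?D (b' j) u) = (\<Sum>a\<le>n. (\<Sum>j<n. b' j a * y j) * u a)"
      unfolding dotp_def sum_distrib_left sum_distrib_right
      by (subst sum.swap) (simp add: mult_ac)
    then have "(\<Sum>j<n. y j * ?D (b' j) u) + y n * ?D x u + y (Suc n) * ?D v u =
      (\<Sum>a\<le>n. ((\<Sum>j<n. b' j a * y j) + x a * y n + v a * y (Suc n)) * u a)"
      by (simp add: dotp_def sum_distrib_left sum.distrib algebra_simps)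
    also have "\<dots> = 0" using exp by (intro sum.neutral) auto
    finally show ?thesis .
  qed
  have xx: "?D x x = 1" "?D v v = 1" "?D v x = 0"
    using x v xv by (simp_all add: dotp_self dotp_commute[of _ v])
  have b': "?D (b' j) u = ?D (b j) u - ?D (b j) x * ?D x u - ?D (b j) v * ?D v u" for j u
    unfolding b'_def dotp_add_left dotp_scale_left by simp
  have "y n = 0" using comb[of x] by (simp add: b' xx)
  moreover have "y (Suc n) = 0" using comb[of v] by (simp add: b' xx xv)
  ultimately have "\<exists>j<n. y j \<noteq> 0" and comb': "\<And>u. (\<Sum>j<n. y j * ?D (b' j) u) = 0"
    using y(1) comb by (auto simp: less_Suc_eq)
  then have ne: "{..<n} \<noteq> {}" by auto
  \<comment> \<open>Dividing the relation by its largest coefficient is what keeps all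
    \<open>c j\<close> in \<open>[-1, 1]\<close>.\<close>
  have "Max ((\<lambda>j. \<bar>y j\<bar>) ` {..<n}) \<in> (\<lambda>j. \<bar>y j\<bar>) ` {..<n}"
    using ne by (intro Max_in) auto
  then obtain i where i: "i < n" "\<bar>y i\<bar> = Max ((\<lambda>j. \<bar>y j\<bar>) ` {..<n})" by auto
  have mx: "\<bar>y j\<bar> \<le> \<bar>y i\<bar>" if "j < n" for j unfolding i(2) using that by (intro Max_ge) auto
  obtain j0 where j0: "j0 < n" "y j0 \<noteq> 0" using \<open>\<exists>j<n. y j \<noteq> 0\<close> by auto
  have yi: "y i \<noteq> 0" using mx[OF j0(1)] j0(2) by auto
  define c where "c = (\<lambda>j. - y j / y i)"
  have c1: "\<bar>c j\<bar> \<le> 1" if "j < n" for j using mx[OF that] yi by (simp add: c_def abs_divide)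
  have "\<bar>?D (b i) u - (\<Sum>j\<in>{..<n} - {i}. c j * ?D (b j) u)\<bar> \<le>
      (\<Sum>j<n. \<bar>?D (b j) x\<bar> + \<bar>?D (b j) v\<bar>) * L2_set u {..n}" for u
  proof -
    have "(\<Sum>j<n. - c j * ?D (b' j) u) = 0"
    proof -
      have "(\<Sum>j<n. - c j * ?D (b' j) u) = (\<Sum>j<n. y j * ?D (b' j) u) / y i"
        by (simp add: c_def sum_divide_distrib)
      then show ?thesis using comb'[of u] by simp
    qed
    then have "(\<Sum>j<n. - c j * ?D (b j) u) = (\<Sum>j<n. - c j * (?D (b j) x * ?D x u + ?D (b j) v * ?D v u))"
      by (simp add: b' algebra_simps sum_subtractf sum.distrib sum_negf)
    moreover have "(\<Sum>j<n. - c j * ?D (b j) u) = ?D (b i) u - (\<Sum>j\<in>{..<n} - {i}. c j * ?D (b j) u)"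
      using i(1) yi by (subst sum.remove[of _ i]) (auto simp: sum_negf c_def)
    ultimately have eq: "?D (b i) u - (\<Sum>j\<in>{..<n} - {i}. c j * ?D (b j) u) =
        (\<Sum>j<n. - c j * (?D (b j) x * ?D x u + ?D (b j) v * ?D v u))"
      by linarith
    have "\<bar>?D (b i) u - (\<Sum>j\<in>{..<n} - {i}. c j * ?D (b j) u)\<bar>
      \<le> (\<Sum>j<n. \<bar>- c j * (?D (b j) x * ?D x u + ?D (b j) v * ?D v u)\<bar>)"
      unfolding eq by (rule sum_abs)
    also have "\<dots> \<le> (\<Sum>j<n. (\<bar>?D (b j) x\<bar> + \<bar>?D (b j) v\<bar>) * L2_set u {..n})"
    proof (intro sum_mono)
      fix j assume j: "j \<in> {..<n}"
      have "\<bar>?D x u\<bar> \<le> L2_set u {..n}" "\<bar>?D v u\<bar> \<le> L2_set u {..n}"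
        using abs_dotp_le[of "{..n}" x u] abs_dotp_le[of "{..n}" v u] x v by auto
      then have "\<bar>?D (b j) x * ?D x u + ?D (b j) v * ?D v u\<bar> \<le>
        \<bar>?D (b j) x\<bar> * L2_set u {..n} + \<bar>?D (b j) v\<bar> * L2_set u {..n}"
        by (intro order.trans[OF abs_triangle_ineq] add_mono) (auto simp: abs_mult intro!: mult_left_mono)
      moreover have "\<bar>- c j * (?D (b j) x * ?D x u + ?D (b j) v * ?D v u)\<bar> \<le>
         1 * \<bar>?D (b j) x * ?D x u + ?D (b j) v * ?D v u\<bar>"
        unfolding abs_mult using c1[of j] j by (intro mult_right_mono) auto
      ultimately show "\<bar>- c j * (?D (b j) x * ?D x u + ?D (b j) v * ?D v u)\<bar>
         \<le> (\<bar>?D (b j) x\<bar> + \<bar>?D (b j) v\<bar>) * L2_set u {..n}"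
        by (simp add: algebra_simps)
    qed
    finally show ?thesis by (simp add: sum_distrib_right)
  qed
  then show ?thesis using i(1) c1 by blast
qed

subsection \<open>Points with large condition number\<close>

text \<open>Division by \<open>sqrt (d j)\<close> is the scaling by the diagonal matrix in the
  condition number. For \<open>x\<close> on the sphere it makes the variance of the component along
  a tangent vector \<open>u\<close> equal to the squared length of \<open>u\<close>, whatever the
  degree.\<close>

definition rowv :: "nat \<Rightarrow> (nat \<Rightarrow> nat) \<Rightarrow> system \<Rightarrow> (nat \<Rightarrow> real) \<Rightarrow> nat \<Rightarrow> nat \<Rightarrow> real" where
  "rowv n d f x j k = grad n (d j) (f j) x k / sqrt (real (d j))"

lemma dotp_rowv: "dotp {..n} (rowv n d f x j) u = dotp {..n} (grad n (d j) (f j) x) u / sqrt (real (d j))"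
  by (simp add: dotp_def rowv_def sum_divide_distrib)

text \<open>Without a kernel vector the map would be injective between spaces of equal dimension,
  hence bijective. Surjectivity is a system of \<open>n + 1\<close> equations in
  \<open>n + 2\<close> unknowns, the last unknown being a multiple of the target \<open>c\<close>;
  injectivity prevents that multiple from being 0.\<close>

lemma tangent_kernel_if_not_bij:
  assumes nb: "\<not> bij_betw (system_deriv n d f x) (tangent_space n x) (topspace (Euclidean_space n))"
  shows "\<exists>v\<in>tangent_space n x. v \<noteq> (\<lambda>_. 0) \<and> (\<forall>i<n. dotp {..n} (grad n (d i) (f i) x) v = 0)"
proof (rule ccontr)
  let ?G = "\<lambda>i. dotp {..n} (grad n (d i) (f i) x)"
  let ?T = "tangent_space n x" and ?S = "system_deriv n d f x"
  assume "\<not> ?thesis"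
  then have inj0: "\<And>v. v \<in> ?T \<Longrightarrow> (\<And>i. i < n \<Longrightarrow> ?G i v = 0) \<Longrightarrow> v = (\<lambda>_. 0)" by blast
  have T: "v \<in> ?T \<longleftrightarrow> (\<forall>i>n. v i = 0) \<and> dotp {..n} x v = 0" for v
    by (auto simp: tangent_space_def topspace_Euclidean_space dotp_def Suc_le_eq)
  have S: "?S v = (\<lambda>i. if i < n then ?G i v else 0)" for v
  proof
    fix i show "?S v i = (if i < n then ?G i v else 0)"
      by (cases "i < n") (simp_all add: system_deriv_eq, simp add: system_deriv_def)
  qed
  have "bij_betw ?S ?T (topspace (Euclidean_space n))"
    unfolding bij_betw_def
  proof
    show "inj_on ?S ?T"
    proof (rule inj_onI)
      fix v w assume vw: "v \<in> ?T" "w \<in> ?T" "?S v = ?S w"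
      have *: "?G i v = ?G i w" if "i < n" for i
        using fun_cong[OF vw(3), of i] that by (simp add: S)
      have "(\<lambda>k. v k + (- 1) * w k) = (\<lambda>_. 0)"
      proof (rule inj0)
        show "(\<lambda>k. v k + (- 1) * w k) \<in> ?T" using vw(1,2) unfolding T dotp_add dotp_scale by simp
        show "?G i (\<lambda>k. v k + (- 1) * w k) = 0" if "i < n" for i
          unfolding dotp_add dotp_scale using *[OF that] by simp
      qed
      then show "v = w" by (auto simp: fun_eq_iff)
    qed
    show "?S ` ?T = topspace (Euclidean_space n)"
    proof (intro equalityI subsetI)
      fix c assume c: "c \<in> topspace (Euclidean_space n)"
      define M where "M = (\<lambda>e a. if e < n then (if a \<le> n then grad n (d e) (f e) x a else - c e)
         else (if a \<le> n then x a else (0::real)))"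
      obtain w where w: "\<exists>a\<in>{..Suc n}. w a \<noteq> 0" "\<And>e. e \<le> n \<Longrightarrow> dotp {..Suc n} (M e) w = 0"
        using homogeneous_system_solution[of "{..n}" "{..Suc n}" M] by auto
      define v where "v = (\<lambda>k. if k \<le> n then w k else 0)"
      have dv: "dotp {..n} h v = dotp {..n} h w" for h by (intro dotp_cong) (simp add: v_def)
      have x0: "dotp {..n} x v = 0" using w(2)[of n] unfolding dv by (simp add: dotp_def M_def)
      have Gv: "?G e v = w (Suc n) * c e" if "e < n" for e
        using w(2)[of e] that unfolding dv by (simp add: dotp_def M_def)
      have vT: "v \<in> ?T" using x0 by (auto simp: T v_def)
      have "w (Suc n) \<noteq> 0"
      proof
        assume 0: "w (Suc n) = 0"
        then have "v = (\<lambda>_. 0)" using Gv by (intro inj0[OF vT]) auto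
        then have "w k = 0" if "k \<le> n" for k using that by (auto simp: v_def fun_eq_iff split: if_splits)
        then show False using w(1) 0 by (auto simp: le_Suc_eq)
      qed
      moreover have "(\<lambda>k. (1 / w (Suc n)) * v k) \<in> ?T"
        using vT unfolding T dotp_scale by simp
      moreover have "?S (\<lambda>k. (1 / w (Suc n)) * v k) = c"
      proof
        fix i show "?S (\<lambda>k. (1 / w (Suc n)) * v k) i = c i"
          using \<open>w (Suc n) \<noteq> 0\<close> c Gv[of i] unfolding S dotp_scale by (simp add: topspace_Euclidean_space)
      qed
      ultimately show "c \<in> ?S ` ?T" by (metis imageI)
    qed (auto simp: S topspace_Euclidean_space)
  qed
  with nb show False by simp
qed

text \<open>If the inverse has large norm, some \<open>w\<close> of length at most 1 has a long
  preimage. Normalising it to a unit vector \<open>v\<close> makes the derivative along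
  \<open>v\<close> small, and the factors \<open>sqrt (d i)\<close> cancel against those in
  \<open>rowv\<close>. A singular derivative supplies a kernel vector instead.\<close>

lemma kappa_greater:
  assumes n: "1 \<le> n" and d: "\<And>i. i < n \<Longrightarrow> 1 \<le> d i" and t: "0 < t" and k: "ereal t < kappa n d f"
  defines "\<epsilon> \<equiv> sqrt (real n) * system_norm n d f / t"
  shows "\<exists>x v. L2_set x {..n} = 1 \<and> L2_set v {..n} = 1 \<and> dotp {..n} x v = 0 \<and>
    (\<forall>i<n. \<bar>eval_form n (d i) (f i) x\<bar> \<le> \<epsilon>) \<and> (\<forall>i<n. \<bar>dotp {..n} (rowv n d f x i) v\<bar> \<le> \<epsilon>)"
proof -
  let ?F = "system_norm n d f"
  obtain x where x: "x \<in> topspace (nsphere n)"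
    and mu: "ereal t < mu_norm n d f x"
    and ev: "ereal t < (if eval_sup_norm n d f x = 0 then \<infinity> else ereal (?F / eval_sup_norm n d f x))"
    using k unfolding kappa_def less_SUP_iff by auto
  have n0: "(0::nat) \<in> {..<n}" using n by simp
  have F0: "0 \<le> ?F"
  proof -
    have "0 \<le> weyl_norm n (d 0) (f 0)" by (simp add: weyl_norm_def sum_nonneg less_imp_le[OF multinomial_pos])
    also have "\<dots> \<le> ?F" unfolding system_norm_def using n0 by (intro Max_ge) auto
    finally show ?thesis .
  qed
  have sn: "1 \<le> sqrt (real n)" using n by simp
  have x1: "L2_set x {..n} = 1" using x by (auto simp: nsphere_def L2_set_def)
  have Feps: "?F / t \<le> \<epsilon>" using F0 t sn by (simp add: \<epsilon>_def divide_right_mono mult_le_cancel_right1)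
  have evb: "\<bar>eval_form n (d i) (f i) x\<bar> \<le> \<epsilon>" if i: "i < n" for i
  proof -
    let ?S = "eval_sup_norm n d f x"
    have S: "\<bar>eval_form n (d i) (f i) x\<bar> \<le> ?S"
      unfolding eval_sup_norm_def using i by (intro Max_ge) auto
    have "?S \<le> ?F / t"
    proof (cases "?S = 0")
      case False
      with S have "0 < ?S" by linarith
      moreover have "t < ?F / ?S" using ev False by simp
      ultimately show ?thesis using t by (simp add: field_simps)
    qed (use F0 t in simp)
    with S Feps show ?thesis by linarith
  qed
  have "\<exists>v. L2_set v {..n} = 1 \<and> dotp {..n} x v = 0 \<and> (\<forall>i<n. \<bar>dotp {..n} (rowv n d f x i) v\<bar> \<le> \<epsilon>)"
  proof (cases "bij_betw (system_deriv n d f x) (tangent_space n x) (topspace (Euclidean_space n))")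
    case False
    then obtain v where v: "v \<in> tangent_space n x" "v \<noteq> (\<lambda>_. 0)"
      "\<And>i. i < n \<Longrightarrow> dotp {..n} (grad n (d i) (f i) x) v = 0"
      using tangent_kernel_if_not_bij by blast
    have "L2_set v {..n} \<noteq> 0"
    proof
      assume "L2_set v {..n} = 0"
      then have "v k = 0" if "k \<le> n" for k using that by (simp add: L2_set_eq_0_iff)
      moreover have "v k = 0" if "k > n" for k
        using v(1) that by (auto simp: tangent_space_def topspace_Euclidean_space)
      ultimately show False using v(2) by (metis not_le)
    qed
    then have pos: "0 < L2_set v {..n}" by (metis L2_set_nonneg order_le_imp_less_or_eq)
    have xv: "dotp {..n} x v = 0" using v(1) by (simp add: tangent_space_def dotp_def)
    let ?v = "\<lambda>k. (1 / L2_set v {..n}) * v k"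
    have "L2_set ?v {..n} = 1"
      using pos by (subst L2_set_right_distrib[symmetric]) auto
    moreover have "dotp {..n} x ?v = 0" unfolding dotp_scale by (simp add: xv)
    moreover have "\<bar>dotp {..n} (rowv n d f x i) ?v\<bar> \<le> \<epsilon>" if "i < n" for i
      unfolding dotp_scale dotp_rowv using v(3)[OF that] F0 t Feps
      by (simp add: order.trans[OF divide_nonneg_pos])
    ultimately show ?thesis by blast
  next
    case True
    let ?T = "tangent_space n x" and ?S = "system_deriv n d f x"
    let ?g = "\<lambda>w. inv_into ?T ?S (\<lambda>i. sqrt (real (d i)) * w i)"
    define cc where "cc = sqrt (real n) * ?F"
    have m: "ereal t < ereal cc * spectral_norm n (Suc n) ?g" using mu True by (simp add: mu_norm_def cc_def)
    \<comment> \<open>For \<open>cc = 0\<close> the product is 0 even if the spectral norm is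
      infinite, contradicting \<open>0 < t\<close>.\<close>
    have c: "0 < cc"
    proof (rule ccontr)
      assume "\<not> 0 < cc"
      then have "cc = 0" using F0 by (simp add: cc_def zero_less_mult_iff)
      then show False using m t by (metis ereal_less(2) ereal_zero_mult less_asym zero_ereal_def)
    qed
    have "ereal (t / cc) < spectral_norm n (Suc n) ?g"
    proof (rule ccontr)
      assume "\<not> ?thesis"
      then have "ereal cc * spectral_norm n (Suc n) ?g \<le> ereal cc * ereal (t / cc)"
        using c by (intro ereal_mult_left_mono) auto
      also have "\<dots> = ereal (cc * (t / cc))" by (rule times_ereal.simps(1))
      also have "cc * (t / cc) = t" using c by simp
      finally show False using m by simp
    qed
    then obtain w where w: "w \<in> topspace (Euclidean_space n)" "L2_set w {..<n} \<le> 1"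
      and gw: "t / cc < L2_set (?g w) {..<Suc n}"
      unfolding spectral_norm_def less_SUP_iff by auto
    define v where "v = ?g w"
    have Mw: "(\<lambda>i. sqrt (real (d i)) * w i) \<in> ?S ` ?T"
      using w(1) True by (auto simp: bij_betw_def topspace_Euclidean_space)
    have vT: "v \<in> ?T" unfolding v_def by (rule inv_into_into[OF Mw])
    have Sv: "?S v = (\<lambda>i. sqrt (real (d i)) * w i)" unfolding v_def by (rule f_inv_into_f[OF Mw])
    have gv: "t / cc < L2_set v {..n}" using gw by (simp add: v_def lessThan_Suc_atMost)
    then have pos: "0 < L2_set v {..n}" using t c by (meson divide_pos_pos less_trans)
    have xv: "dotp {..n} x v = 0" using vT by (simp add: tangent_space_def dotp_def)
    let ?v = "\<lambda>k. (1 / L2_set v {..n}) * v k"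
    have "L2_set ?v {..n} = 1"
      using pos by (subst L2_set_right_distrib[symmetric]) auto
    moreover have "dotp {..n} x ?v = 0" unfolding dotp_scale by (simp add: xv)
    moreover have "\<bar>dotp {..n} (rowv n d f x i) ?v\<bar> \<le> \<epsilon>" if i: "i < n" for i
    proof -
      have "dotp {..n} (grad n (d i) (f i) x) v = sqrt (real (d i)) * w i"
        using fun_cong[OF Sv, of i] system_deriv_eq[OF i] by metis
      then have "dotp {..n} (rowv n d f x i) ?v = w i / L2_set v {..n}"
        unfolding dotp_scale dotp_rowv using d[OF i] by simp
      moreover have "\<bar>w i\<bar> \<le> L2_set w {..<n}"
        using member_le_L2_set[of "{..<n}" i "\<lambda>i. \<bar>w i\<bar>"] i by (simp add: L2_set_def)
      then have "\<bar>w i\<bar> \<le> 1" using w(2) by linarith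
      then have "\<bar>w i\<bar> / L2_set v {..n} \<le> 1 / L2_set v {..n}" using pos by (simp add: divide_right_mono)
      moreover have "1 / L2_set v {..n} \<le> 1 / (t / cc)"
        using gv t c pos by (intro divide_left_mono mult_pos_pos divide_pos_pos) auto
      ultimately show ?thesis using pos by (simp add: \<epsilon>_def cc_def abs_divide)
    qed
    ultimately show ?thesis by blast
  qed
  then show ?thesis using x1 evb by blast
qed

text \<open>By Euler's identity the component of row \<open>j\<close> along \<open>x\<close> is
  \<open>sqrt (d j)\<close> times the value, hence at most \<open>D * \<epsilon>\<close>. Together
  with the component along \<open>v\<close> this gives \<open>2 * D * \<epsilon>\<close> for each of
  the \<open>n\<close> rows.\<close>

lemma kappa_greater_nearly_dependent:
  assumes n: "1 \<le> n" and d: "\<And>i. i < n \<Longrightarrow> 1 \<le> d i \<and> d i \<le> D" and t: "0 < t" and k: "ereal t < kappa n d f"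
    and \<epsilon>: "sqrt (real n) * system_norm n d f / t \<le> \<epsilon>"
  shows "\<exists>x i c. L2_set x {..n} = 1 \<and> i < n \<and> (\<forall>j<n. \<bar>eval_form n (d j) (f j) x\<bar> \<le> \<epsilon>) \<and>
    (\<forall>j<n. \<bar>c j\<bar> \<le> 1) \<and>
    (\<forall>u. \<bar>dotp {..n} (rowv n d f x i) u - (\<Sum>j\<in>{..<n} - {i}. c j * dotp {..n} (rowv n d f x j) u)\<bar>
       \<le> 2 * real n * real D * \<epsilon> * L2_set u {..n})"
proof -
  have d1: "\<And>i. i < n \<Longrightarrow> 1 \<le> d i" using d by blast
  obtain x v where x: "L2_set x {..n} = 1" "L2_set v {..n} = 1" "dotp {..n} x v = 0"
    and f': "\<And>i. i < n \<Longrightarrow> \<bar>eval_form n (d i) (f i) x\<bar> \<le> sqrt (real n) * system_norm n d f / t"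
    and r': "\<And>i. i < n \<Longrightarrow> \<bar>dotp {..n} (rowv n d f x i) v\<bar> \<le> sqrt (real n) * system_norm n d f / t"
    using kappa_greater[OF n d1 t k] by blast
  have f: "\<And>i. i < n \<Longrightarrow> \<bar>eval_form n (d i) (f i) x\<bar> \<le> \<epsilon>"
    using order.trans[OF f' \<epsilon>] by blast
  have r: "\<And>i. i < n \<Longrightarrow> \<bar>dotp {..n} (rowv n d f x i) v\<bar> \<le> \<epsilon>"
    using order.trans[OF r' \<epsilon>] by blast
  have "(\<Sum>j<n. \<bar>dotp {..n} (rowv n d f x j) x\<bar> + \<bar>dotp {..n} (rowv n d f x j) v\<bar>) \<le>
     (\<Sum>j<n. 2 * real D * \<epsilon>)"
  proof (intro sum_mono)
    fix j assume "j \<in> {..<n}"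
    then have j: "j < n" by simp
    have e0: "0 \<le> \<epsilon>" using f[OF j] by linarith
    have "1 \<le> real D" using d[OF j] by linarith
    have "sqrt (real (d j)) \<le> real (d j)"
      using d[OF j] self_le_power[of "real (d j)" 2] by (intro real_le_lsqrt) auto
    then have "sqrt (real (d j)) \<le> real D" using d[OF j] by linarith
    moreover have "\<bar>dotp {..n} (rowv n d f x j) x\<bar> = sqrt (real (d j)) * \<bar>eval_form n (d j) (f j) x\<bar>"
      unfolding dotp_rowv Euler_form using d[OF j]
      by (simp add: abs_mult abs_divide field_simps)
    ultimately have "\<bar>dotp {..n} (rowv n d f x j) x\<bar> \<le> real D * \<epsilon>"
      using f[OF j] by (auto intro!: mult_mono)
    moreover have "\<epsilon> \<le> real D * \<epsilon>" using e0 \<open>1 \<le> real D\<close> by (simp add: mult_le_cancel_right1)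
    ultimately show "\<bar>dotp {..n} (rowv n d f x j) x\<bar> + \<bar>dotp {..n} (rowv n d f x j) v\<bar> \<le> 2 * real D * \<epsilon>"
      using r[OF j] by linarith
  qed
  also have "\<dots> = 2 * real n * real D * \<epsilon>" by simp
  finally have S: "(\<Sum>j<n. \<bar>dotp {..n} (rowv n d f x j) x\<bar> + \<bar>dotp {..n} (rowv n d f x j) v\<bar>) \<le> 2 * real n * real D * \<epsilon>" .
  obtain i c where i: "i < n" "\<forall>j<n. \<bar>c j\<bar> \<le> 1"
    "\<And>u. \<bar>dotp {..n} (rowv n d f x i) u - (\<Sum>j\<in>{..<n} - {i}. c j * dotp {..n} (rowv n d f x j) u)\<bar> \<le>
      (\<Sum>j<n. \<bar>dotp {..n} (rowv n d f x j) x\<bar> + \<bar>dotp {..n} (rowv n d f x j) v\<bar>) * L2_set u {..n}"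
    using nearly_dependent_row[OF x, of "rowv n d f x"] by blast
  have "\<bar>dotp {..n} (rowv n d f x i) u - (\<Sum>j\<in>{..<n} - {i}. c j * dotp {..n} (rowv n d f x j) u)\<bar>
       \<le> 2 * real n * real D * \<epsilon> * L2_set u {..n}" for u
    using order.trans[OF i(3)[of u] mult_right_mono[OF S L2_set_nonneg]] .
  then show ?thesis using x f i by blast
qed

subsection \<open>The weighted volume near an ill-conditioned point\<close>

lemma gI_mono:
  assumes A: "finite A" "\<And>a. a \<in> A \<Longrightarrow> 0 < s a" "finite L"
    and B: "\<And>a. a \<in> A \<Longrightarrow> 0 < s' a" "finite L'" and c: "0 < c"
    and le: "\<And>w. bform A s L g w w \<le> c * bform A s' L' g' w w"
  shows "(1 / sqrt c) ^ card A * gI A s' L' g' \<le> gI A s L g"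
proof -
  have "ennreal ((1 / sqrt c) ^ card A * gI A s' L' g') =
      (\<integral>\<^sup>+u. ennreal (exp (- (c * bform A s' L' g' u u) / 2)) \<partial>lam A)"
    using gint_scale[of A s' L' c g'] A B c by simp
  also have "\<dots> \<le> gint A s L g"
    unfolding gint_def using le by (intro nn_integral_mono ennreal_leI) simp
  also have "\<dots> = ennreal (gI A s L g)" using gint_eq_gI[of A s L g] A by simp
  finally show ?thesis using gI_pos[of A s L g] A by (simp add: ennreal_le_iff)
qed

text \<open>Applied with \<open>c = 1 + O(1 / n)\<close> in dimension \<open>m = n + 1\<close>: a
  relative change of order \<open>1 / n\<close> in a quadratic form changes its Gaussian volume by a
  constant factor.\<close>

lemma exp_le_inverse_sqrt_power:
  assumes "0 < c"
  shows "exp (- ((c - 1) * real m / 2)) \<le> (1 / sqrt c) ^ m"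
proof -
  have "sqrt c \<le> exp ((c - 1) / 2)"
  proof (rule real_le_lsqrt)
    have "(exp ((c - 1) / 2))\<^sup>2 = exp (c - 1)" by (simp add: exp_double[symmetric])
    then show "c \<le> (exp ((c - 1) / 2))\<^sup>2" using exp_ge_add_one_self[of "c - 1"] by simp
  qed (use assms in auto)
  then have "sqrt c ^ m \<le> exp ((c - 1) / 2) ^ m" using assms by (intro power_mono) auto
  also have "\<dots> = exp ((c - 1) * real m / 2)" by (simp add: exp_of_nat_mult[symmetric] mult_ac)
  finally have "1 / exp ((c - 1) * real m / 2) \<le> 1 / sqrt c ^ m"
    using assms by (intro divide_left_mono) auto
  then show ?thesis by (simp add: exp_minus inverse_eq_divide power_one_over)
qed

definition gI0 :: "nat \<Rightarrow> real \<Rightarrow> real \<Rightarrow> nat \<Rightarrow> (nat \<Rightarrow> nat \<Rightarrow> real) \<Rightarrow> real" where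
  "gI0 n \<eta> r i b = gI {..n} (\<lambda>_. (\<eta> / r)\<^sup>2) ({..<n} - {i}) (\<lambda>j k. 1 / r * b j k)"

text \<open>The quotient \<open>gI0 / gI1\<close> is \<open>sqrt (1 + V)\<close>, where
  \<open>V\<close> is the squared length of the rescaled row \<open>i\<close> in the inverse of the
  form built from the other rows. A bounded quotient thus tests whether row \<open>i\<close> nearly
  depends on the others. The divisor \<open>sqrt 6 * n\<close> is the weakening under which
  \<open>wt_lower\<close> can guarantee the test.\<close>

definition gI1 :: "nat \<Rightarrow> real \<Rightarrow> real \<Rightarrow> nat \<Rightarrow> (nat \<Rightarrow> nat \<Rightarrow> real) \<Rightarrow> real" where
  "gI1 n \<eta> r i b = gI {..n} (\<lambda>_. (\<eta> / r)\<^sup>2) {..<n}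
     (\<lambda>j k. (if j = i then 1 / (sqrt 6 * real n * r) else 1 / r) * b j k)"

text \<open>The weight makes the volume of the ellipsoid spanned by the rows other than \<open>i\<close>, regularised at
  scale \<open>\<eta>\<close>, cancel: this is what produces the exact factor \<open>sqrt (\<Prod>i<n. d i)\<close> in the expectation.\<close>

definition wt :: "nat \<Rightarrow> (nat \<Rightarrow> nat) \<Rightarrow> nat \<Rightarrow> real \<Rightarrow> real \<Rightarrow> nat \<Rightarrow> (nat \<Rightarrow> nat \<Rightarrow> real) \<Rightarrow> (nat \<Rightarrow> real) \<Rightarrow> real" where
  "wt n d D \<eta> r i b y = 1 / gI0 n \<eta> r i b *
     exp (- (\<Sum>j\<in>{..<n} - {i}. (y j)\<^sup>2 / (real (d j) * r\<^sup>2)) / 2) *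
     (exp (- ((y i)\<^sup>2 / (2 * real D * (real n)\<^sup>2 * r\<^sup>2)) / 2) *
      (if gI0 n \<eta> r i b \<le> exp 1 * gI1 n \<eta> r i b then 1 else 0))"

definition qf :: "nat \<Rightarrow> real \<Rightarrow> nat \<Rightarrow> (nat \<Rightarrow> nat \<Rightarrow> real) \<Rightarrow> (nat \<Rightarrow> real) \<Rightarrow> real" where
  "qf n \<eta> i b w = (\<Sum>j\<in>{..<n} - {i}. (dotp {..n} (b j) w)\<^sup>2) + \<eta>\<^sup>2 * (L2_set w {..n})\<^sup>2"

lemma bform_gI0:
  "bform {..n} (\<lambda>_. (\<eta> / r)\<^sup>2) ({..<n} - {i}) (\<lambda>j k. 1 / r * b j k) w w = qf n \<eta> i b w / r\<^sup>2"
  unfolding bform_def qf_def dotp_scale_left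
  by (simp add: L2_set_def sum_nonneg add_divide_distrib sum_divide_distrib sum_distrib_left
      power2_eq_square power_divide mult_ac)

lemma bform_gI1:
  assumes "i < n"
  shows "bform {..n} (\<lambda>_. (\<eta> / r)\<^sup>2) {..<n} (\<lambda>j k. (if j = i then 1 / (sqrt 6 * real n * r) else 1 / r) * b j k) w w
    = (qf n \<eta> i b w + (dotp {..n} (b i) w)\<^sup>2 / (6 * (real n)\<^sup>2)) / r\<^sup>2"
proof -
  have "(\<Sum>j<n. ((if j = i then 1 / (sqrt 6 * real n * r) else 1 / r) * dotp {..n} (b j) w) *
      ((if j = i then 1 / (sqrt 6 * real n * r) else 1 / r) * dotp {..n} (b j) w)) =
    (dotp {..n} (b i) w)\<^sup>2 / (6 * (real n)\<^sup>2) / r\<^sup>2 + (\<Sum>j\<in>{..<n} - {i}. (dotp {..n} (b j) w)\<^sup>2 / r\<^sup>2)"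
    using assms
    by (subst sum.remove[of _ i]) (auto simp: power2_eq_square power_divide mult_ac)
  then show ?thesis
    unfolding bform_def qf_def dotp_scale_left
    by (simp add: L2_set_def sum_nonneg add_divide_distrib sum_divide_distrib sum_distrib_left
        power2_eq_square[of "_ / _"] mult_ac) (simp add: power2_eq_square mult_ac)
qed

text \<open>Young's inequality with weight \<open>n\<close>: the main term is kept up to
  \<open>1 + 1 / n\<close>, and the error pays with a factor \<open>1 + n\<close>.\<close>

lemma square_le_eps: "0 < n \<Longrightarrow> (p::real)\<^sup>2 \<le> (1 + 1 / n) * q\<^sup>2 + (1 + n) * (p - q)\<^sup>2"
proof -
  assume n: "0 < n"
  have "0 \<le> (q / sqrt n - sqrt n * (p - q))\<^sup>2" by simp
  also have "\<dots> = q\<^sup>2 / n + n * (p - q)\<^sup>2 - 2 * q * (p - q)"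
    using n by (simp add: power2_diff power_divide power_mult_distrib)
  also have "\<dots> = (1 + 1 / n) * q\<^sup>2 + (1 + n) * (p - q)\<^sup>2 - p\<^sup>2"
    using n by (simp add: power2_eq_square algebra_simps)
  finally show ?thesis by simp
qed

text \<open>Every squared row produces an error of at most \<open>(1 + n) * z\<^sup>2\<close> times
  the squared length of \<open>w\<close>. There are at most \<open>n\<close> of them, and the
  regularisation absorbs them, since \<open>\<eta>\<^sup>2\<close> is of order
  \<open>n ^ 4 * z\<^sup>2\<close>.\<close>

lemma qf_compare:
  assumes n: "1 \<le> n" and z: "0 \<le> z" and l: "\<eta> = 32 * (real n)\<^sup>2 * z"
    and d: "\<And>j. j < n \<Longrightarrow> \<bar>dotp {..n} (b j) w - dotp {..n} (b' j) w\<bar> \<le> z * L2_set w {..n}"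
  shows "qf n \<eta> i b w \<le> (1 + 1 / real n) * qf n \<eta> i b' w"
proof -
  let ?N = "L2_set w {..n}"
  have n0: "0 < real n" using n by simp
  have "(\<Sum>j\<in>{..<n} - {i}. (dotp {..n} (b j) w)\<^sup>2) \<le>
    (\<Sum>j\<in>{..<n} - {i}. (1 + 1 / real n) * (dotp {..n} (b' j) w)\<^sup>2 + (1 + real n) * (z * ?N)\<^sup>2)"
  proof (intro sum_mono)
    fix j assume j: "j \<in> {..<n} - {i}"
    have "(dotp {..n} (b j) w - dotp {..n} (b' j) w)\<^sup>2 \<le> (z * ?N)\<^sup>2"
      using d[of j] j by (subst abs_le_square_iff[symmetric]) (auto simp: abs_mult z L2_set_nonneg)
    then have "(1 + real n) * (dotp {..n} (b j) w - dotp {..n} (b' j) w)\<^sup>2 \<le> (1 + real n) * (z * ?N)\<^sup>2"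
      by (intro mult_left_mono) auto
    then show "(dotp {..n} (b j) w)\<^sup>2 \<le> (1 + 1 / real n) * (dotp {..n} (b' j) w)\<^sup>2 + (1 + real n) * (z * ?N)\<^sup>2"
      using square_le_eps[OF n0, of "dotp {..n} (b j) w" "dotp {..n} (b' j) w"] by linarith
  qed
  also have "\<dots> = (1 + 1 / real n) * (\<Sum>j\<in>{..<n} - {i}. (dotp {..n} (b' j) w)\<^sup>2)
     + real (card ({..<n} - {i})) * ((1 + real n) * (z * ?N)\<^sup>2)"
    by (simp add: sum.distrib sum_distrib_left)
  also have "real (card ({..<n} - {i})) * ((1 + real n) * (z * ?N)\<^sup>2) \<le> 1 / real n * (\<eta>\<^sup>2 * ?N\<^sup>2)"
  proof -
    have "card ({..<n} - {i}) \<le> card {..<n}" by (intro card_mono) auto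
    then have "real (card ({..<n} - {i})) \<le> real n" by simp
    then have "real (card ({..<n} - {i})) * ((1 + real n) * (z * ?N)\<^sup>2) \<le> real n * ((2 * real n) * (z * ?N)\<^sup>2)"
      using n by (intro mult_mono) auto
    also have "\<dots> = 2 * (real n)\<^sup>2 * (z * ?N)\<^sup>2" by (simp add: power2_eq_square)
    also have "\<dots> \<le> 1024 * real n ^ 3 * (z * ?N)\<^sup>2"
      using n power_increasing[of 2 3 "real n"] by (intro mult_right_mono mult_mono) auto
    also have "\<dots> = 1 / real n * (\<eta>\<^sup>2 * ?N\<^sup>2)"
      using n0 by (simp add: l power_mult_distrib power2_eq_square power3_eq_cube)
    finally show ?thesis .
  qed
  finally show ?thesis by (simp add: qf_def algebra_simps)
qed

context
  fixes n i D :: nat and d :: "nat \<Rightarrow> nat" and z l \<eta> r :: real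
  assumes n: "1 \<le> n" and i: "i < n" and z: "0 < z" and l: "0 < l"
    and eta_eq: "\<eta> = 32 * (real n)\<^sup>2 * z" and r_eq: "r = 8 * real n * z * l"
    and d: "\<And>j. j < n \<Longrightarrow> 1 \<le> d j \<and> d j \<le> D"
begin

lemma r_pos: "0 < r" and eta_pos: "0 < \<eta>"
  using n z l by (simp_all add: r_eq eta_eq)

lemma gI0_pos: "0 < gI0 n \<eta> r i b"
  unfolding gI0_def using r_pos eta_pos by (intro gI_pos) auto

text \<open>The rows vary by at most \<open>z\<close> in a ball of radius \<open>l\<close>, and the
  values differ from their linear part by at most \<open>2 * z * l\<close>. The scale
  \<open>r\<close> exceeds this error by a factor \<open>4 * n\<close>, and \<open>\<eta>\<close>
  exceeds \<open>z\<close> by a factor of order \<open>n\<^sup>2\<close>. So the volume loses at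
  most a factor \<open>e\<close> and the exponent grows to at most
  \<open>(1 + 2 / n) * Q + 2\<close>, with \<open>Q\<close> the quadratic form at the
  centre.\<close>

lemma wt_lower:
  fixes b b0 :: "nat \<Rightarrow> nat \<Rightarrow> real" and y :: "nat \<Rightarrow> real"
  assumes a: "\<And>j w. j < n \<Longrightarrow> \<bar>dotp {..n} (b j) w - dotp {..n} (b0 j) w\<bar> \<le> z * L2_set w {..n}"
    and y: "\<And>j. j < n \<Longrightarrow> \<bar>y j - sqrt (real (d j)) * dotp {..n} (b0 j) u\<bar> \<le> 2 * z * l"
    and c: "\<And>j. j < n \<Longrightarrow> \<bar>c j\<bar> \<le> 1"
      "\<And>w. \<bar>dotp {..n} (b0 i) w - (\<Sum>j\<in>{..<n} - {i}. c j * dotp {..n} (b0 j) w)\<bar> \<le> \<eta> * L2_set w {..n}"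
  shows "exp (- 2) / gI0 n \<eta> r i b0 * exp (- ((1 + 2 / real n) * (qf n \<eta> i b0 u / r\<^sup>2)) / 2)
    \<le> wt n d D \<eta> r i b y"
proof -
  have n0: "0 < real n" and n1: "1 \<le> real n" using n by auto
  have z0: "0 \<le> z" using z by simp
  let ?L = "{..<n} - {i}"
  have a': "\<And>j w. j < n \<Longrightarrow> \<bar>dotp {..n} (b0 j) w - dotp {..n} (b j) w\<bar> \<le> z * L2_set w {..n}"
    using a by (metis abs_minus_commute)
  have q2: "qf n \<eta> i b0 w \<le> (1 + 1 / real n) * qf n \<eta> i b w" for w
    by (intro qf_compare[OF n z0 eta_eq] a')
  have qn: "0 \<le> qf n \<eta> i h w" for h w by (simp add: qf_def sum_nonneg)
  have s: "\<And>a. a \<in> {..n} \<Longrightarrow> 0 < (\<eta> / r)\<^sup>2" using r_pos eta_pos by simp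
  have e1: "exp (- 1) \<le> (1 / sqrt (1 + 1 / real n)) ^ Suc n"
  proof -
    have "real (Suc n) / (2 * real n) \<le> 1" using n by simp
    then have "exp (- 1) \<le> exp (- ((1 + 1 / real n - 1) * real (Suc n) / 2))" by simp
    also have "\<dots> \<le> (1 / sqrt (1 + 1 / real n)) ^ Suc n"
      using n0 by (intro exp_le_inverse_sqrt_power) (simp add: add_pos_pos)
    finally show ?thesis .
  qed
  have cp: "0 < 1 + 1 / real n" using n0 by (simp add: add_pos_pos)
  have g0: "exp (- 1) * gI0 n \<eta> r i b \<le> gI0 n \<eta> r i b0"
  proof -
    have "(1 / sqrt (1 + 1 / real n)) ^ card {..n} * gI0 n \<eta> r i b \<le> gI0 n \<eta> r i b0"
      unfolding gI0_def
    proof (rule gI_mono[OF _ s _ s _ cp])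
      show "bform {..n} (\<lambda>_. (\<eta> / r)\<^sup>2) ?L (\<lambda>j k. 1 / r * b0 j k) w w \<le>
        (1 + 1 / real n) * bform {..n} (\<lambda>_. (\<eta> / r)\<^sup>2) ?L (\<lambda>j k. 1 / r * b j k) w w" for w
        unfolding bform_gI0 using divide_right_mono[OF q2[of w], of "r\<^sup>2"] by simp
    qed auto
    moreover have "exp (- 1) * gI0 n \<eta> r i b \<le> (1 / sqrt (1 + 1 / real n)) ^ card {..n} * gI0 n \<eta> r i b"
      using e1 gI0_pos[of b] by (intro mult_right_mono) auto
    ultimately show ?thesis by linarith
  qed
  \<comment> \<open>By near dependence row \<open>i\<close> is dominated by the \<open>n - 1\<close>
    other rows and one regularisation term, so Cauchy-Schwarz runs over \<open>n\<close>
    terms.\<close>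
  have p: "(dotp {..n} (b0 i) w)\<^sup>2 \<le> real n * qf n \<eta> i b0 w" for w
  proof -
    let ?p = "\<lambda>j. if j = i then \<eta> * L2_set w {..n} else \<bar>dotp {..n} (b0 j) w\<bar>"
    have "\<bar>dotp {..n} (b0 i) w\<bar> \<le> \<bar>\<Sum>j\<in>?L. c j * dotp {..n} (b0 j) w\<bar> + \<eta> * L2_set w {..n}"
      using c(2)[of w] by linarith
    also have "\<bar>\<Sum>j\<in>?L. c j * dotp {..n} (b0 j) w\<bar> \<le> (\<Sum>j\<in>?L. \<bar>dotp {..n} (b0 j) w\<bar>)"
      using c(1) by (intro order.trans[OF sum_abs] sum_mono) (auto simp: abs_mult intro!: mult_left_le_one_le)
    also have "(\<Sum>j\<in>?L. \<bar>dotp {..n} (b0 j) w\<bar>) + \<eta> * L2_set w {..n} = (\<Sum>j<n. ?p j)"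
      using i by (subst (2) sum.remove[of _ i]) auto
    finally have "\<bar>dotp {..n} (b0 i) w\<bar>\<^sup>2 \<le> (\<Sum>j<n. 1 * ?p j)\<^sup>2"
      by (intro power_mono) auto
    also have "\<dots> \<le> (\<Sum>j<n. 1\<^sup>2) * (\<Sum>j<n. (?p j)\<^sup>2)"
      by (rule Cauchy_Schwarz_ineq_sum)
    also have "(\<Sum>j<n. (?p j)\<^sup>2) = qf n \<eta> i b0 w"
      using i by (subst sum.remove[of _ i]) (auto simp: qf_def power_mult_distrib)
    finally show ?thesis by simp
  qed
  \<comment> \<open>The constant of \<open>gI1\<close> originates here:
    \<open>2 * n + 1 \<le> 3 * n\<close> and the comparison factor \<open>1 + 1 / n \<le> 2\<close>
    bound the squared row \<open>i\<close> by \<open>6 * n\<close> times the form. After division by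
    \<open>6 * n\<^sup>2\<close> it adds a relative \<open>1 / n\<close>.\<close>
  have ind: "gI0 n \<eta> r i b \<le> exp 1 * gI1 n \<eta> r i b"
  proof -
    have "(dotp {..n} (b i) w)\<^sup>2 / (6 * (real n)\<^sup>2) \<le> 1 / real n * qf n \<eta> i b w" for w
    proof -
      have "(dotp {..n} (b i) w)\<^sup>2 \<le> (1 + 1 / 1) * (dotp {..n} (b0 i) w)\<^sup>2 + (1 + 1) * (dotp {..n} (b i) w - dotp {..n} (b0 i) w)\<^sup>2"
        by (rule square_le_eps) simp
      also have "(dotp {..n} (b i) w - dotp {..n} (b0 i) w)\<^sup>2 \<le> (z * L2_set w {..n})\<^sup>2"
        using a[OF i, of w] z0 by (subst abs_le_square_iff[symmetric]) (auto simp: abs_mult L2_set_nonneg)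
      also have "(z * L2_set w {..n})\<^sup>2 \<le> 1/2 * qf n \<eta> i b0 w"
      proof -
        have "1 \<le> (real n)\<^sup>2" using n1 by (simp add: one_le_power)
        then have "2 * z \<le> \<eta>" unfolding eta_eq using z by (intro mult_right_mono) auto
        then have "(2 * z)\<^sup>2 \<le> \<eta>\<^sup>2" using z by (intro power_mono) auto
        then have "4 * z\<^sup>2 \<le> \<eta>\<^sup>2" by (simp add: power_mult_distrib)
        moreover have "0 \<le> z\<^sup>2" by (rule zero_le_power2)
        ultimately have "2 * z\<^sup>2 \<le> \<eta>\<^sup>2" by linarith
        then have "2 * z\<^sup>2 * (L2_set w {..n})\<^sup>2 \<le> \<eta>\<^sup>2 * (L2_set w {..n})\<^sup>2" by (intro mult_right_mono) auto
        also have "\<dots> \<le> qf n \<eta> i b0 w" by (simp add: qf_def sum_nonneg)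
        finally show ?thesis by (simp add: power_mult_distrib)
      qed
      finally have "(dotp {..n} (b i) w)\<^sup>2 \<le> 2 * (real n * qf n \<eta> i b0 w) + qf n \<eta> i b0 w"
        using p[of w] by simp
      also have "\<dots> \<le> 3 * real n * qf n \<eta> i b0 w"
        using mult_right_mono[OF n1 qn[of b0 w]] by simp
      also have "\<dots> \<le> 3 * real n * (2 * qf n \<eta> i b w)"
      proof (intro mult_left_mono)
        have "1 + 1 / real n \<le> 2" using n1 by (simp add: field_simps)
        then show "qf n \<eta> i b0 w \<le> 2 * qf n \<eta> i b w"
          using q2[of w] mult_right_mono[OF _ qn[of b w]] by (meson order.trans)
      qed (use n in auto)
      finally have "(dotp {..n} (b i) w)\<^sup>2 \<le> 6 * real n * qf n \<eta> i b w" by simp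
      then have "(dotp {..n} (b i) w)\<^sup>2 / (6 * (real n)\<^sup>2) \<le> 6 * real n * qf n \<eta> i b w / (6 * (real n)\<^sup>2)"
        by (intro divide_right_mono) auto
      also have "\<dots> = 1 / real n * qf n \<eta> i b w" using n0 by (simp add: power2_eq_square)
      finally show ?thesis .
    qed
    then have q3: "qf n \<eta> i b w + (dotp {..n} (b i) w)\<^sup>2 / (6 * (real n)\<^sup>2) \<le> (1 + 1 / real n) * qf n \<eta> i b w" for w
      by (simp add: algebra_simps)
    have "(1 / sqrt (1 + 1 / real n)) ^ card {..n} * gI0 n \<eta> r i b \<le> gI1 n \<eta> r i b"
      unfolding gI0_def gI1_def
    proof (rule gI_mono[OF _ s _ s _ cp])
      show "bform {..n} (\<lambda>_. (\<eta> / r)\<^sup>2) {..<n} (\<lambda>j k. (if j = i then 1 / (sqrt 6 * real n * r) else 1 / r) * b j k) w w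
       \<le> (1 + 1 / real n) * bform {..n} (\<lambda>_. (\<eta> / r)\<^sup>2) ?L (\<lambda>j k. 1 / r * b j k) w w" for w
        unfolding bform_gI0 bform_gI1[OF i] using divide_right_mono[OF q3[of w], of "r\<^sup>2"] by simp
    qed auto
    moreover have "exp (- 1) * gI0 n \<eta> r i b \<le> (1 / sqrt (1 + 1 / real n)) ^ card {..n} * gI0 n \<eta> r i b"
      using e1 gI0_pos[of b] by (intro mult_right_mono) auto
    ultimately have "exp (- 1) * gI0 n \<eta> r i b \<le> gI1 n \<eta> r i b" by linarith
    then have "exp 1 * (exp (- 1) * gI0 n \<eta> r i b) \<le> exp 1 * gI1 n \<eta> r i b" by (intro mult_left_mono) auto
    then show ?thesis by (simp add: mult.assoc[symmetric] exp_minus)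
  qed
  let ?Q = "qf n \<eta> i b0 u / r\<^sup>2"
  have r2: "r\<^sup>2 = 64 * (real n)\<^sup>2 * (z * l)\<^sup>2" by (simp add: r_eq power_mult_distrib)
  \<comment> \<open>The choice of \<open>r\<close> makes each linearisation error at most
    \<open>1 / n\<close> after rescaling; fewer than \<open>n\<close> of them add up to at most
    1.\<close>
  have S: "(\<Sum>j\<in>?L. (y j)\<^sup>2 / (real (d j) * r\<^sup>2)) \<le> (1 + 1 / real n) * ?Q + 1"
  proof -
    have "(\<Sum>j\<in>?L. (y j)\<^sup>2 / (real (d j) * r\<^sup>2)) \<le> (\<Sum>j\<in>?L. (1 + 1 / real n) * ((dotp {..n} (b0 j) u)\<^sup>2 / r\<^sup>2) + 1 / real n)"
    proof (intro sum_mono)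
      fix j assume j: "j \<in> ?L"
      then have dj: "1 \<le> real (d j)" using d[of j] by auto
      let ?p = "dotp {..n} (b0 j) u"
      have "(y j - sqrt (real (d j)) * ?p)\<^sup>2 \<le> (2 * z * l)\<^sup>2"
        using y[of j] j z l by (subst abs_le_square_iff[symmetric]) auto
      then have "(1 + real n) * (y j - sqrt (real (d j)) * ?p)\<^sup>2 \<le> (1 + real n) * (2 * z * l)\<^sup>2"
        by (intro mult_left_mono) auto
      then have "(y j)\<^sup>2 \<le> (1 + 1 / real n) * (sqrt (real (d j)) * ?p)\<^sup>2 + (1 + real n) * (2 * z * l)\<^sup>2"
        using square_le_eps[OF n0, of "y j" "sqrt (real (d j)) * ?p"] by linarith
      also have "(1 + real n) * (2 * z * l)\<^sup>2 \<le> real (d j) * (r\<^sup>2 / real n)"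
      proof -
        have "(1 + real n) * (2 * z * l)\<^sup>2 \<le> (2 * real n) * (4 * (z * l)\<^sup>2)"
          using n1 by (intro mult_mono) (auto simp: power_mult_distrib)
        also have "\<dots> \<le> 64 * real n * (z * l)\<^sup>2" by simp
        also have "\<dots> = r\<^sup>2 / real n" using n0 unfolding r2 by (simp add: power2_eq_square[of "real n"])
        also have "\<dots> = 1 * (r\<^sup>2 / real n)" by simp
        also have "\<dots> \<le> real (d j) * (r\<^sup>2 / real n)" using dj by (intro mult_right_mono) auto
        finally show ?thesis .
      qed
      finally have "(y j)\<^sup>2 \<le> real (d j) * ((1 + 1 / real n) * ?p\<^sup>2 + r\<^sup>2 / real n)"
        using dj by (simp add: power_mult_distrib algebra_simps)
      then have "(y j)\<^sup>2 / (real (d j) * r\<^sup>2) \<le> real (d j) * ((1 + 1 / real n) * ?p\<^sup>2 + r\<^sup>2 / real n) / (real (d j) * r\<^sup>2)"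
        by (intro divide_right_mono) auto
      also have "\<dots> = (1 + 1 / real n) * (?p\<^sup>2 / r\<^sup>2) + 1 / real n"
        using dj r_pos by (simp add: add_divide_distrib)
      finally show "(y j)\<^sup>2 / (real (d j) * r\<^sup>2) \<le> (1 + 1 / real n) * (?p\<^sup>2 / r\<^sup>2) + 1 / real n" .
    qed
    also have "\<dots> = (1 + 1 / real n) * (\<Sum>j\<in>?L. (dotp {..n} (b0 j) u)\<^sup>2 / r\<^sup>2) + real (card ?L) * (1 / real n)"
      by (simp add: sum.distrib sum_distrib_left)
    also have "\<dots> \<le> (1 + 1 / real n) * ?Q + 1"
    proof (intro add_mono mult_left_mono)
      show "(\<Sum>j\<in>?L. (dotp {..n} (b0 j) u)\<^sup>2 / r\<^sup>2) \<le> ?Q"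
        unfolding sum_divide_distrib[symmetric] qf_def by (intro divide_right_mono) auto
      have "card ?L \<le> card {..<n}" by (intro card_mono) auto
      then show "real (card ?L) * (1 / real n) \<le> 1" using n0 by simp
    qed (use cp in auto)
    finally show ?thesis .
  qed
  \<comment> \<open>In the divisor of the distinguished value, 2 pays for the square of a sum,
    \<open>D\<close> for the degree, and one factor \<open>n\<close> for Cauchy-Schwarz; the other
    \<open>n\<close> leaves only \<open>1 / n\<close> times the form.\<close>
  have I: "(y i)\<^sup>2 / (2 * real D * (real n)\<^sup>2 * r\<^sup>2) \<le> 1 / real n * ?Q + 1"
  proof -
    let ?p = "dotp {..n} (b0 i) u"
    have D1: "1 \<le> real D" and dD: "real (d i) \<le> real D" using d[OF i] by auto
    have "(y i)\<^sup>2 \<le> (1 + 1 / 1) * (sqrt (real (d i)) * ?p)\<^sup>2 + (1 + 1) * (y i - sqrt (real (d i)) * ?p)\<^sup>2"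
      by (rule square_le_eps) simp
    also have "(y i - sqrt (real (d i)) * ?p)\<^sup>2 \<le> (2 * z * l)\<^sup>2"
      using y[of i] i z l by (subst abs_le_square_iff[symmetric]) auto
    also have "(sqrt (real (d i)) * ?p)\<^sup>2 \<le> real D * (real n * qf n \<eta> i b0 u)"
      using p[of u] dD by (auto simp: power_mult_distrib intro!: mult_mono)
    finally have "(y i)\<^sup>2 \<le> 2 * (real D * (real n * qf n \<eta> i b0 u)) + 8 * (z * l)\<^sup>2"
      by (simp add: power_mult_distrib)
    also have "\<dots> \<le> 2 * (real D * (real n * qf n \<eta> i b0 u)) + 2 * real D * (real n)\<^sup>2 * r\<^sup>2"
    proof -
      have n2: "1 \<le> (real n)\<^sup>2" using n1 by (simp add: one_le_power)
      have "8 * (z * l)\<^sup>2 \<le> 64 * (real n)\<^sup>2 * (z * l)\<^sup>2" using n2 by (intro mult_right_mono) auto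
      also have "\<dots> = 1 * 1 * r\<^sup>2" by (simp add: r2)
      also have "\<dots> \<le> (2 * real D) * (real n)\<^sup>2 * r\<^sup>2" using D1 n2 by (intro mult_right_mono mult_mono) auto
      finally show ?thesis by simp
    qed
    finally have "(y i)\<^sup>2 / (2 * real D * (real n)\<^sup>2 * r\<^sup>2) \<le>
      (2 * (real D * (real n * qf n \<eta> i b0 u)) + 2 * real D * (real n)\<^sup>2 * r\<^sup>2) / (2 * real D * (real n)\<^sup>2 * r\<^sup>2)"
      by (intro divide_right_mono) auto
    also have "\<dots> = 1 / real n * ?Q + 1"
      using D1 n0 r_pos by (simp add: add_divide_distrib power2_eq_square)
    finally show ?thesis .
  qed
  let ?S = "\<Sum>j\<in>?L. (y j)\<^sup>2 / (real (d j) * r\<^sup>2)" and ?I = "(y i)\<^sup>2 / (2 * real D * (real n)\<^sup>2 * r\<^sup>2)"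
  have "(1 + 2 / real n) * ?Q = (1 + 1 / real n) * ?Q + 1 / real n * ?Q"
    by (simp only: distrib_right[symmetric]) simp
  then have "?S + ?I \<le> (1 + 2 / real n) * ?Q + 2" using S I by linarith
  have ex: "exp (- 1) * exp (- ((1 + 2 / real n) * ?Q) / 2) \<le> exp (- ?S / 2) * exp (- ?I / 2)"
  proof -
    have "exp (- 1) * exp (- T / 2) \<le> exp (- S / 2) * exp (- I / 2)" if "S + I \<le> T + 2" for S I T :: real
      unfolding exp_add[symmetric] using that by simp
    then show ?thesis using \<open>?S + ?I \<le> (1 + 2 / real n) * ?Q + 2\<close> by blast
  qed
  have "exp (- 1) / gI0 n \<eta> r i b0 \<le> 1 / gI0 n \<eta> r i b"
    using g0 gI0_pos[of b] gI0_pos[of b0] by (simp add: field_simps)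
  then have "exp (- 1) / gI0 n \<eta> r i b0 * (exp (- 1) * exp (- ((1 + 2 / real n) * ?Q) / 2))
     \<le> 1 / gI0 n \<eta> r i b * (exp (- ?S / 2) * exp (- ?I / 2))"
    using gI0_pos[of b] by (intro mult_mono ex) auto
  also have "\<dots> = wt n d D \<eta> r i b y"
    unfolding wt_def using ind by simp
  also have "exp (- 1) / gI0 n \<eta> r i b0 * (exp (- 1) * exp (- ((1 + 2 / real n) * ?Q) / 2)) =
     exp (- 2) / gI0 n \<eta> r i b0 * exp (- ((1 + 2 / real n) * ?Q) / 2)"
    using exp_add[of "- 1 :: real" "- 1"] by (simp add: mult.assoc[symmetric])
  finally show ?thesis .
qed

text \<open>In \<open>n + 1\<close> dimensions the relative change \<open>2 / n\<close> of the form
  costs at most \<open>e\<^sup>2\<close>. Outside the ball the regularisation alone makes the form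
  at least \<open>(\<eta> * l / r)\<^sup>2 = 16 * n\<^sup>2\<close>; giving up half of the exponent
  bounds that part by \<open>exp (- 4 * n\<^sup>2) * sqrt 2 ^ (n + 1)\<close>, which is below
  \<open>exp (- 3)\<close> in the same units. The rest is at least
  \<open>exp (- 2) - exp (- 3) \<ge> exp (- 3)\<close>.\<close>

lemma nn_integral_local_lower:
  "ennreal (exp (- 5)) \<le> (\<integral>\<^sup>+u. ennreal (exp (- 2) / gI0 n \<eta> r i b0 *
      exp (- ((1 + 2 / real n) * (qf n \<eta> i b0 u / r\<^sup>2)) / 2)) * indicator {u. L2_set u {..n} \<le> l} u \<partial>lam {..n})"
proof -
  let ?B = "bform {..n} (\<lambda>_. (\<eta> / r)\<^sup>2) ({..<n} - {i}) (\<lambda>j k. 1 / r * b0 j k)"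
  let ?G = "gI0 n \<eta> r i b0"
  let ?h = "\<lambda>u. exp (- ((1 + 2 / real n) * ?B u u) / 2)"
  let ?in = "\<lambda>u. indicator {u. L2_set u {..n} \<le> l} u :: ennreal"
  let ?out = "\<lambda>u. indicator {u. \<not> L2_set u {..n} \<le> l} u :: ennreal"
  have n0: "0 < real n" and n1: "1 \<le> real n" using n by auto
  have G: "0 < ?G" by (rule gI0_pos)
  have s: "\<And>a. a \<in> {..n} \<Longrightarrow> 0 < (\<eta> / r)\<^sup>2" using r_pos eta_pos by simp
  have [measurable]: "(\<lambda>u. L2_set u {..n}) \<in> borel_measurable (lam {..n})"
    unfolding L2_set_def by measurable
  have sc: "(\<integral>\<^sup>+u. ennreal (exp (- (c * ?B u u) / 2)) \<partial>lam {..n}) = ennreal ((1 / sqrt c) ^ Suc n * ?G)" if "0 < c" for c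
    using gint_scale[of "{..n}" "\<lambda>_. (\<eta> / r)\<^sup>2" "{..<n} - {i}" c "\<lambda>j k. 1 / r * b0 j k"] s that
    by (simp add: gI0_def)
  have full: "ennreal (exp (- 2) * ?G) \<le> (\<integral>\<^sup>+u. ennreal (?h u) \<partial>lam {..n})"
  proof -
    have "real (Suc n) / real n \<le> 2" using n by (simp add: field_simps)
    moreover have "(1 + 2 / real n - 1) * real (Suc n) / 2 = real (Suc n) / real n" using n0 by (simp add: field_simps)
    ultimately have "exp (- 2) \<le> exp (- ((1 + 2 / real n - 1) * real (Suc n) / 2))" by simp
    also have "\<dots> \<le> (1 / sqrt (1 + 2 / real n)) ^ Suc n"
      using n0 by (intro exp_le_inverse_sqrt_power) (simp add: add_pos_pos)
    finally have "exp (- 2) * ?G \<le> (1 / sqrt (1 + 2 / real n)) ^ Suc n * ?G"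
      using G by (intro mult_right_mono) auto
    moreover have "0 < 1 + 2 / real n" using n0 by (simp add: add_pos_pos)
    ultimately show ?thesis using sc[of "1 + 2 / real n"] by (simp add: ennreal_leI)
  qed
  have tail: "(\<integral>\<^sup>+u. ennreal (?h u) * ?out u \<partial>lam {..n}) \<le> ennreal (exp (- 3) * ?G)"
  proof -
    have "(\<integral>\<^sup>+u. ennreal (?h u) * ?out u \<partial>lam {..n}) \<le>
      (\<integral>\<^sup>+u. ennreal (exp (- 4 * (real n)\<^sup>2)) * ennreal (exp (- (1 / 2 * ?B u u) / 2)) \<partial>lam {..n})"
    proof (intro nn_integral_mono)
      fix u
      show "ennreal (?h u) * ?out u \<le> ennreal (exp (- 4 * (real n)\<^sup>2)) * ennreal (exp (- (1 / 2 * ?B u u) / 2))"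
      proof (cases "L2_set u {..n} \<le> l")
        case False
        have "\<eta>\<^sup>2 * l\<^sup>2 \<le> \<eta>\<^sup>2 * (L2_set u {..n})\<^sup>2"
          using False l by (intro mult_left_mono power_mono) auto
        also have "\<dots> \<le> qf n \<eta> i b0 u" by (simp add: qf_def sum_nonneg)
        finally have "\<eta>\<^sup>2 * l\<^sup>2 / r\<^sup>2 \<le> ?B u u" unfolding bform_gI0 by (intro divide_right_mono) auto
        moreover have "\<eta>\<^sup>2 * l\<^sup>2 / r\<^sup>2 = 16 * (real n)\<^sup>2"
          using n0 z l by (simp add: eta_eq r_eq power2_eq_square)
        ultimately have B: "16 * (real n)\<^sup>2 \<le> ?B u u" by simp
        have Bn: "0 \<le> ?B u u" using B zero_le_power2[of "real n"] by linarith
        have "?B u u \<le> (1 + 2 / real n) * ?B u u" using Bn by (simp add: algebra_simps)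
        moreover have "- T / 2 \<le> - 4 * N + (- (1 / 2 * b) / 2)" if "b \<le> T" "16 * N \<le> b" for b T N :: real
          using that by (simp add: field_simps)
        ultimately have "- ((1 + 2 / real n) * ?B u u) / 2 \<le> - 4 * (real n)\<^sup>2 + (- (1 / 2 * ?B u u) / 2)"
          using B by blast
        then have "?h u \<le> exp (- 4 * (real n)\<^sup>2) * exp (- (1 / 2 * ?B u u) / 2)"
          unfolding exp_add[symmetric] by simp
        then show ?thesis using False by (simp add: ennreal_mult[symmetric] ennreal_leI)
      qed simp
    qed
    also have "\<dots> = ennreal (exp (- 4 * (real n)\<^sup>2)) * ennreal ((1 / sqrt (1 / 2)) ^ Suc n * ?G)"
      by (subst sc[of "1/2", symmetric], simp, intro nn_integral_cmult) measurable
    also have "\<dots> = ennreal (exp (- 4 * (real n)\<^sup>2) * ((1 / sqrt (1 / 2)) ^ Suc n * ?G))"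
      using G by (intro ennreal_mult[symmetric]) auto
    also have "\<dots> \<le> ennreal (exp (- 3) * ?G)"
    proof (rule ennreal_leI)
      have "1 / sqrt (1 / 2) = sqrt 2" by (simp add: real_sqrt_divide)
      moreover have "sqrt 2 \<le> exp (1 / 2 :: real)"
      proof (rule real_le_lsqrt)
        have "(exp (1 / 2 :: real))\<^sup>2 = exp 1" by (simp add: exp_double[symmetric])
        then show "2 \<le> (exp (1 / 2 :: real))\<^sup>2" using exp_ge_add_one_self[of "1::real"] by simp
      qed auto
      ultimately have "(1 / sqrt (1 / 2)) ^ Suc n \<le> exp (1 / 2 :: real) ^ Suc n" by (intro power_mono) auto
      also have "\<dots> = exp (real (Suc n) / 2)"
        using exp_of_nat_mult[of "Suc n" "1 / 2 :: real"] by (simp only: times_divide_eq_right mult_1_right)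
      finally have "exp (- 4 * (real n)\<^sup>2) * ((1 / sqrt (1 / 2)) ^ Suc n) \<le> exp (- 4 * (real n)\<^sup>2) * exp (real (Suc n) / 2)"
        by (intro mult_left_mono) auto
      also have "\<dots> \<le> exp (- 3)"
      proof -
        have "real n \<le> (real n)\<^sup>2" using n1 by (simp add: power2_eq_square)
        moreover have "- 4 * N + (1 + m) / 2 \<le> - 3" if "m \<le> N" "1 \<le> m" for m N :: real
          using that by (simp add: field_simps)
        ultimately have "- 4 * (real n)\<^sup>2 + real (Suc n) / 2 \<le> - 3" using n1 unfolding of_nat_Suc by blast
        then show ?thesis unfolding exp_add[symmetric] by simp
      qed
      finally show "exp (- 4 * (real n)\<^sup>2) * ((1 / sqrt (1 / 2)) ^ Suc n * ?G) \<le> exp (- 3) * ?G"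
        using G unfolding mult.assoc[symmetric] by (intro mult_right_mono) (simp_all only: less_imp_le)
    qed
    finally show ?thesis .
  qed
  have "(\<integral>\<^sup>+u. ennreal (?h u) \<partial>lam {..n}) = (\<integral>\<^sup>+u. ennreal (?h u) * ?in u + ennreal (?h u) * ?out u \<partial>lam {..n})"
    by (intro nn_integral_cong) (auto simp: indicator_def)
  also have "\<dots> = (\<integral>\<^sup>+u. ennreal (?h u) * ?in u \<partial>lam {..n}) + (\<integral>\<^sup>+u. ennreal (?h u) * ?out u \<partial>lam {..n})"
    by (intro nn_integral_add) measurable
  also have "\<dots> \<le> (\<integral>\<^sup>+u. ennreal (?h u) * ?in u \<partial>lam {..n}) + ennreal (exp (- 3) * ?G)"
    by (intro add_left_mono tail)
  finally have *: "ennreal (exp (- 2) * ?G) \<le> (\<integral>\<^sup>+u. ennreal (?h u) * ?in u \<partial>lam {..n}) + ennreal (exp (- 3) * ?G)"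
    using full by (rule order.trans[rotated])
  have e23: "exp (- 3) + exp (- 3) \<le> exp (- 2 :: real)"
  proof -
    have "exp (- 3) * 2 \<le> exp (- 3) * exp (1 :: real)"
      using exp_ge_add_one_self[of "1::real"] by (intro mult_left_mono) auto
    also have "\<dots> = exp (- 2)" unfolding exp_add[symmetric] by simp
    finally show ?thesis by simp
  qed
  then have "ennreal (exp (- 3) * ?G) + ennreal (exp (- 3) * ?G) \<le> ennreal (exp (- 2) * ?G)"
    using mult_right_mono[OF e23, of ?G] G
    by (subst ennreal_plus[symmetric]) (auto intro!: ennreal_leI simp: algebra_simps)
  from order.trans[OF order.trans[OF this *] eq_refl[OF add.commute]]
  have in_: "ennreal (exp (- 3) * ?G) \<le> (\<integral>\<^sup>+u. ennreal (?h u) * ?in u \<partial>lam {..n})"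
    unfolding ennreal_add_left_cancel_le by simp
  have "ennreal (exp (- 5)) = ennreal (exp (- 2) / ?G) * ennreal (exp (- 3) * ?G)"
    using G exp_add[of "- 2 :: real" "- 3"] by (simp add: ennreal_mult[symmetric])
  also have "\<dots> \<le> ennreal (exp (- 2) / ?G) * (\<integral>\<^sup>+u. ennreal (?h u) * ?in u \<partial>lam {..n})"
    by (intro mult_left_mono in_) auto
  also have "\<dots> = (\<integral>\<^sup>+u. ennreal (exp (- 2) / ?G) * (ennreal (?h u) * ?in u) \<partial>lam {..n})"
    by (intro nn_integral_cmult[symmetric]) measurable
  also have "\<dots> = (\<integral>\<^sup>+u. ennreal (exp (- 2) / ?G * exp (- ((1 + 2 / real n) * (qf n \<eta> i b0 u / r\<^sup>2)) / 2)) * ?in u \<partial>lam {..n})"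
  proof (intro nn_integral_cong)
    fix u
    have m: "ennreal a * (ennreal b * k) = ennreal (a * b) * k" if "0 \<le> a" "0 \<le> b" for a b :: real and k :: ennreal
      using that by (simp add: ennreal_mult mult.assoc)
    show "ennreal (exp (- 2) / ?G) * (ennreal (?h u) * ?in u) =
      ennreal (exp (- 2) / ?G * exp (- ((1 + 2 / real n) * (qf n \<eta> i b0 u / r\<^sup>2)) / 2)) * ?in u"
      unfolding bform_gI0 by (rule m) (use G in simp_all)
  qed
  finally show ?thesis .
qed

end

subsection \<open>Measurable dependence on parameters\<close>

lemma gint_measurable:
  fixes g :: "'w \<Rightarrow> 'j \<Rightarrow> 'i \<Rightarrow> real"
  assumes A: "finite A" and g: "\<And>j a. j \<in> L \<Longrightarrow> a \<in> A \<Longrightarrow> (\<lambda>\<omega>. g \<omega> j a) \<in> borel_measurable N"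
  shows "(\<lambda>\<omega>. gint A s L (g \<omega>)) \<in> borel_measurable N"
proof -
  interpret AF: finite_product_sigma_finite "\<lambda>_. lborel :: real measure" A by standard (fact A)
  have "(\<lambda>(\<omega>, u). ennreal (exp (- bform A s L (g \<omega>) u u / 2))) \<in> borel_measurable (N \<Otimes>\<^sub>M lam A)"
  proof -
    have 1: "(\<lambda>p. g (fst p) j a) \<in> borel_measurable (N \<Otimes>\<^sub>M lam A)" if "j \<in> L" "a \<in> A" for j a
      by (rule measurable_compose[OF measurable_fst g[OF that]])
    have 2: "(\<lambda>p. snd p a) \<in> borel_measurable (N \<Otimes>\<^sub>M lam A)" if "a \<in> A" for a
      using measurable_compose[OF measurable_snd, of "\<lambda>u. u a" "lam A" borel N] that by simp
    have "(\<lambda>p. bform A s L (g (fst p)) (snd p) (snd p)) \<in> borel_measurable (N \<Otimes>\<^sub>M lam A)"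
      unfolding bform_def dotp_def
      by (intro borel_measurable_add borel_measurable_sum borel_measurable_times borel_measurable_const 1 2)
    then show ?thesis unfolding case_prod_beta by measurable
  qed
  then show ?thesis unfolding gint_def
    by (rule AF.borel_measurable_nn_integral)
qed

lemma gI_measurable:
  assumes "finite A" "\<And>j a. j \<in> L \<Longrightarrow> a \<in> A \<Longrightarrow> (\<lambda>\<omega>. g \<omega> j a) \<in> borel_measurable N"
  shows "(\<lambda>\<omega>. gI A s L (g \<omega>)) \<in> borel_measurable N"
  unfolding gI_def using gint_measurable[OF assms] by measurable

lemma psi_measurable:
  assumes "finite A" "\<And>j a. j \<in> L \<Longrightarrow> a \<in> A \<Longrightarrow> (\<lambda>\<omega>. g \<omega> j a) \<in> borel_measurable N"
  shows "(\<lambda>\<omega>. psi A s L (g \<omega>)) \<in> borel_measurable N"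
  unfolding psi_def using gI_measurable[OF assms] by measurable

subsection \<open>Expected determinants of random rows\<close>

text \<open>A majorant of the mean determinant in dimension \<open>p\<close> after adding
  \<open>k\<close> random rows with second moments at most \<open>\<theta>\<close> to
  \<open>s\<close> times the identity. One row adds \<open>\<theta>\<close> times the sum of the
  \<open>p\<close> principal minors of dimension \<open>p - 1\<close>. At \<open>p = 0\<close> the
  factor \<open>real p\<close> makes the truncated index harmless.\<close>

primrec qrec :: "real \<Rightarrow> real \<Rightarrow> nat \<Rightarrow> nat \<Rightarrow> real" where
  "qrec s \<theta> 0 p = s ^ p"
| "qrec s \<theta> (Suc k) p = qrec s \<theta> k p + \<theta> * real p * qrec s \<theta> k (p - 1)"

lemma qrec_nonneg: "0 \<le> s \<Longrightarrow> 0 \<le> \<theta> \<Longrightarrow> 0 \<le> qrec s \<theta> k p"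
  by (induction k arbitrary: p) auto

lemma qrec_zero: "qrec s \<theta> k 0 = 1"
  by (induction k) auto

text \<open>The recursion has the solution \<open>\<Sum>m\<le>k. (k choose m) * (p! / (p - m)!) *
  \<theta> ^ m * s ^ (p - m)\<close>; bounding the falling factorials by the one at
  \<open>m = k\<close> gives the estimate. For \<open>k = n - 1\<close> and \<open>p = n + 1\<close>
  the factor \<open>y ^ 2\<close> reflects the two directions that the rows leave to the
  regularisation.\<close>

lemma qrec_le:
  assumes "0 \<le> y" "0 \<le> \<theta>" "k \<le> p"
  shows "qrec (\<theta> * y) \<theta> k p \<le> \<theta> ^ p * (fact p / fact (p - k)) * y ^ (p - k) * (1 + y) ^ k"
  using assms(3)
proof (induction k arbitrary: p)
  case 0
  then show ?case by (simp add: power_mult_distrib)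
next
  case (Suc k)
  then obtain p' where p: "p = Suc p'" "k \<le> p'" by (cases p) auto
  obtain m where m: "p' = k + m" using p by (metis le_Suc_ex)
  have "qrec (\<theta> * y) \<theta> (Suc k) p = qrec (\<theta> * y) \<theta> k p + \<theta> * real p * qrec (\<theta> * y) \<theta> k p'"
    by (simp add: p)
  also have "\<dots> \<le> \<theta> ^ p * (fact p / fact (p - k)) * y ^ (p - k) * (1 + y) ^ k +
     \<theta> * real p * (\<theta> ^ p' * (fact p' / fact (p' - k)) * y ^ (p' - k) * (1 + y) ^ k)"
    using Suc.IH[of p] Suc.IH[of p'] p assms by (intro add_mono mult_left_mono) auto
  also have "\<dots> = \<theta> ^ p * (fact p / fact m) * y ^ m * (1 + y) ^ k * (y / real (Suc m) + 1)"
  proof -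
    have "p - k = Suc m" "p' - k = m" using p m by auto
    moreover have "(fact p :: real) = real p * fact p'" by (simp add: p)
    ultimately show ?thesis by (simp add: p divide_simps) (simp add: algebra_simps)
  qed
  also have "\<dots> \<le> \<theta> ^ p * (fact p / fact m) * y ^ m * (1 + y) ^ k * (1 + y)"
    using assms by (intro mult_left_mono) (auto simp: divide_le_eq mult_le_cancel_left1)
  also have "\<dots> = \<theta> ^ p * (fact p / fact (p - Suc k)) * y ^ (p - Suc k) * (1 + y) ^ Suc k"
    using p m by simp
  finally show ?case .
qed

section \<open>Independent coefficients grouped by equation, and their covariances\<close>

definition fs :: "(nat \<times> (nat \<Rightarrow> nat) \<Rightarrow> real) \<Rightarrow> system" where
  "fs c = (\<lambda>i j. c (i, j))"

definition blk :: "nat \<Rightarrow> (nat \<Rightarrow> nat) \<Rightarrow> nat \<Rightarrow> (nat \<times> (nat \<Rightarrow> nat)) set" where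
  "blk n d j = {j} \<times> multi_indices n (d j)"

definition blks :: "nat \<Rightarrow> (nat \<Rightarrow> nat) \<Rightarrow> nat set \<Rightarrow> (nat \<times> (nat \<Rightarrow> nat)) set" where
  "blks n d L = (SIGMA j:L. multi_indices n (d j))"

definition vr :: "nat \<Rightarrow> (nat \<Rightarrow> nat) \<Rightarrow> nat \<times> (nat \<Rightarrow> nat) \<Rightarrow> real" where
  "vr n d p = multinomial n (d (fst p)) (snd p)"

lemma vr_pos: "0 < vr n d p" by (simp add: vr_def multinomial_pos)

lemma finite_blk [simp]: "finite (blk n d j)" by (simp add: blk_def)

lemma finite_blks [simp]: "finite L \<Longrightarrow> finite (blks n d L)" by (auto simp: blks_def)

lemma blks_insert: "blks n d (insert j L) = blks n d L \<union> blk n d j"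
  by (auto simp: blks_def blk_def)

lemma blks_disjoint: "j \<notin> L \<Longrightarrow> blks n d L \<inter> blk n d j = {}"
  by (auto simp: blks_def blk_def)

lemma sum_blk: "(\<Sum>p\<in>blk n d j. h (fst p) (snd p)) = (\<Sum>\<alpha>\<in>multi_indices n (d j). h j \<alpha>)"
proof -
  have "blk n d j = Pair j ` multi_indices n (d j)" by (auto simp: blk_def)
  then show ?thesis by (simp add: sum.reindex inj_on_def)
qed

lemma dotp_blk: "dotp (blk n d j) (\<lambda>p. h (snd p)) c = dotp (multi_indices n (d j)) h (fs c j)"
proof -
  have "dotp (blk n d j) (\<lambda>p. h (snd p)) c = (\<Sum>p\<in>blk n d j. h (snd p) * c (fst p, snd p))"
    by (simp add: dotp_def)
  also have "\<dots> = (\<Sum>\<alpha>\<in>multi_indices n (d j). h \<alpha> * c (j, \<alpha>))"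
    by (rule sum_blk[of "\<lambda>i \<alpha>. h \<alpha> * c (i, \<alpha>)"])
  finally show ?thesis by (simp add: dotp_def fs_def)
qed

lemma eval_form_blk: "eval_form n (d j) (fs c j) x = dotp (blk n d j) (\<lambda>p. mon_eval n (snd p) x) c"
  unfolding eval_form_eq_dotp by (rule dotp_blk[symmetric])

lemma dotp_rowv_blk:
  "dotp {..n} (rowv n d (fs c) x j) u =
   dotp (blk n d j) (\<lambda>p. 1 / sqrt (real (d j)) * dotp {..n} (mon_grad n (snd p) x) u) c"
  unfolding dotp_rowv dotp_grad dotp_scale_left by (subst dotp_blk) simp

text \<open>The variance of the value, the variance of the component of the row along
  \<open>u\<close>, and their covariance. The covariance is proportional to the inner product of
  \<open>x\<close> and \<open>u\<close>, so the value is independent of the tangential part of the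
  row.\<close>

lemma blk_kernels:
  assumes d: "2 \<le> d j"
  shows "(\<Sum>p\<in>blk n d j. vr n d p * (mon_eval n (snd p) x)\<^sup>2) = dotp {..n} x x ^ d j"
    and "(\<Sum>p\<in>blk n d j. vr n d p * (1 / sqrt (real (d j)) * dotp {..n} (mon_grad n (snd p) x) u)\<^sup>2) =
      real (d j - 1) * dotp {..n} x x ^ (d j - 2) * (dotp {..n} x u)\<^sup>2 + dotp {..n} x x ^ (d j - 1) * dotp {..n} u u"
    and "(\<Sum>p\<in>blk n d j. vr n d p * mon_eval n (snd p) x * (1 / sqrt (real (d j)) * dotp {..n} (mon_grad n (snd p) x) u)) =
      sqrt (real (d j)) * dotp {..n} x x ^ (d j - 1) * dotp {..n} x u"
proof -
  have d0: "0 < real (d j)" using d by simp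
  show "(\<Sum>p\<in>blk n d j. vr n d p * (mon_eval n (snd p) x)\<^sup>2) = dotp {..n} x x ^ d j"
    using kernel_eval[of n "d j" x x] unfolding vr_def
    by (subst sum_blk[of "\<lambda>j \<alpha>. multinomial n (d j) \<alpha> * (mon_eval n \<alpha> x)\<^sup>2"])
       (simp add: power2_eq_square mult.assoc)
  show "(\<Sum>p\<in>blk n d j. vr n d p * (1 / sqrt (real (d j)) * dotp {..n} (mon_grad n (snd p) x) u)\<^sup>2) =
      real (d j - 1) * dotp {..n} x x ^ (d j - 2) * (dotp {..n} x u)\<^sup>2 + dotp {..n} x x ^ (d j - 1) * dotp {..n} u u"
  proof -
    have "(\<Sum>p\<in>blk n d j. vr n d p * (1 / sqrt (real (d j)) * dotp {..n} (mon_grad n (snd p) x) u)\<^sup>2) =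
      (\<Sum>\<alpha>\<in>multi_indices n (d j). multinomial n (d j) \<alpha> * (1 / sqrt (real (d j)) * dotp {..n} (mon_grad n \<alpha> x) u)\<^sup>2)"
      unfolding vr_def
      by (rule sum_blk[of "\<lambda>i \<alpha>. multinomial n (d i) \<alpha> * (1 / sqrt (real (d j)) * dotp {..n} (mon_grad n \<alpha> x) u)\<^sup>2"])
    also have "\<dots> = 1 / real (d j) * (\<Sum>\<alpha>\<in>multi_indices n (d j). multinomial n (d j) \<alpha> *
        dotp {..n} (mon_grad n \<alpha> x) u * dotp {..n} (mon_grad n \<alpha> x) u)"
      using d0 by (simp add: sum_distrib_left power_mult_distrib power_divide power2_eq_square mult_ac)
    also have "\<dots> = real (d j - 1) * dotp {..n} x x ^ (d j - 2) * (dotp {..n} x u)\<^sup>2 + dotp {..n} x x ^ (d j - 1) * dotp {..n} u u"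
      unfolding kernel_grad_grad using d0 by simp
    finally show ?thesis .
  qed
  show "(\<Sum>p\<in>blk n d j. vr n d p * mon_eval n (snd p) x * (1 / sqrt (real (d j)) * dotp {..n} (mon_grad n (snd p) x) u)) =
      sqrt (real (d j)) * dotp {..n} x x ^ (d j - 1) * dotp {..n} x u"
  proof -
    have "(\<Sum>p\<in>blk n d j. vr n d p * mon_eval n (snd p) x * (1 / sqrt (real (d j)) * dotp {..n} (mon_grad n (snd p) x) u)) =
      (\<Sum>\<alpha>\<in>multi_indices n (d j). multinomial n (d j) \<alpha> * mon_eval n \<alpha> x * (1 / sqrt (real (d j)) * dotp {..n} (mon_grad n \<alpha> x) u))"
      unfolding vr_def
      by (rule sum_blk[of "\<lambda>i \<alpha>. multinomial n (d i) \<alpha> * mon_eval n \<alpha> x * (1 / sqrt (real (d j)) * dotp {..n} (mon_grad n \<alpha> x) u)"])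
    also have "\<dots> = 1 / sqrt (real (d j)) * (\<Sum>\<alpha>\<in>multi_indices n (d j). multinomial n (d j) \<alpha> * mon_eval n \<alpha> x * dotp {..n} (mon_grad n \<alpha> x) u)"
      by (simp add: sum_distrib_left mult_ac)
    also have "\<dots> = real (d j) / sqrt (real (d j)) * dotp {..n} x x ^ (d j - 1) * dotp {..n} x u"
      unfolding kernel_eval_grad by simp
    also have "real (d j) / sqrt (real (d j)) = sqrt (real (d j))" by (simp add: real_div_sqrt)
    finally show ?thesis .
  qed
qed

lemma measurable_coef:
  "p \<in> S \<Longrightarrow> (\<lambda>c. c p) \<in> borel_measurable (gm S v)"
  by (subst measurable_cong_sets[OF sets_gm refl]) measurable

lemma dotp_measurable_gm [measurable]: "dotp A h \<in> borel_measurable (gm A v)"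
  by (subst measurable_cong_sets[OF sets_gm refl]) measurable

context
  fixes n D :: nat and d :: "nat \<Rightarrow> nat" and r l \<eta> :: real and x :: "nat \<Rightarrow> real"
  assumes n: "1 \<le> n" and d: "\<And>j. j < n \<Longrightarrow> 2 \<le> d j \<and> d j \<le> D"
    and r: "0 < r" "4 * (real D)\<^sup>2 * r\<^sup>2 \<le> 1" and l: "0 \<le> l" "2 * real n * real D * l \<le> 1"
    and x: "\<bar>L2_set x {..n} - 1\<bar> \<le> l"
begin

text \<open>The shell is so thin that any power of the norm up to the degree deviates from 1 by
  \<open>O(1 / n)\<close>; over all equations this costs a constant factor.\<close>

lemma norm_power_bounds:
  assumes k: "k \<le> D"
  shows "1 - 1 / (2 * real n) \<le> L2_set x {..n} ^ k" and "L2_set x {..n} ^ k \<le> exp (1 / (2 * real n))"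
proof -
  let ?s = "L2_set x {..n}"
  have n0: "1 \<le> real n" using n by simp
  have kl: "real k * l \<le> 1 / (2 * real n)"
  proof -
    have "real k * l \<le> real D * l" using k l by (intro mult_right_mono) auto
    then have "2 * real n * (real k * l) \<le> 2 * real n * (real D * l)" by (intro mult_left_mono) auto
    also have "\<dots> \<le> 1" using l(2) by (simp only: mult.assoc)
    finally have "2 * real n * (real k * l) \<le> 1" .
    then show ?thesis using n0 by (simp add: field_simps)
  qed
  show "1 - 1 / (2 * real n) \<le> ?s ^ k"
  proof (cases "k = 0")
    case False
    then have "l \<le> real k * l" using l by (simp add: mult_le_cancel_right1)
    moreover have "1 / (2 * real n) \<le> 1" using n0 by simp
    ultimately have "l \<le> 1" using kl by linarith
    then have "1 - real k * l \<le> (1 - l) ^ k" using Bernoulli_inequality[of "- l" k] by simp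
    also have "\<dots> \<le> ?s ^ k" using x \<open>l \<le> 1\<close> by (intro power_mono) auto
    finally show ?thesis using kl by linarith
  qed (use n0 in simp)
  have "?s ^ k \<le> exp l ^ k"
  proof (intro power_mono)
    show "?s \<le> exp l" using x exp_ge_add_one_self[of l] by linarith
  qed (rule L2_set_nonneg)
  also have "\<dots> = exp (real k * l)" by (simp add: exp_of_nat_mult)
  also have "\<dots> \<le> exp (1 / (2 * real n))" using kl by simp
  finally show "?s ^ k \<le> exp (1 / (2 * real n))" .
qed

lemma inverse_norm_power_le: "k \<le> D \<Longrightarrow> 0 < L2_set x {..n} ^ k \<and> 1 / L2_set x {..n} ^ k \<le> 1 + 1 / real n"
proof -
  assume k: "k \<le> D"
  have n0: "1 \<le> real n" using n by simp
  have h: "1/2 \<le> 1 - 1 / (2 * real n)" using n0 by (simp add: field_simps)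
  then have p: "0 < 1 - 1 / (2 * real n)" by linarith
  have "1 / L2_set x {..n} ^ k \<le> 1 / (1 - 1 / (2 * real n))"
    using norm_power_bounds(1)[OF k] p by (intro divide_left_mono mult_pos_pos) auto
  also have "\<dots> \<le> 1 + 1 / real n"
  proof -
    have "1 \<le> (1 + 1 / real n) * (1 - 1 / (2 * real n))"
      using n0 by (simp add: field_simps)
    then show ?thesis using p by (simp add: divide_le_eq)
  qed
  finally show ?thesis using norm_power_bounds(1)[OF k] p by auto
qed

lemma rho_eq: "dotp {..n} x x = (L2_set x {..n})\<^sup>2" by (rule dotp_self)

text \<open>The mean of the cut-off is about \<open>sqrt (d j) * r\<close>, the origin of the square
  root of the product of the degrees. Under the weighted law the radial excess variance of the row
  is compensated by its correlation with the value, provided that the value is pinned sharply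
  enough. What remains is the identity covariance, up to \<open>exp (1 / n)\<close> and the
  rescaling by \<open>1 / r\<close>.\<close>

lemma row_moments:
  assumes j: "j < n"
  defines "\<phi> \<equiv> sqrt (real (d j)) * r * (1 + 1 / real n)" and "\<theta> \<equiv> exp (1 / real n) / r\<^sup>2"
  defines "Phi \<equiv> \<lambda>c. exp (- ((eval_form n (d j) (fs c j) x)\<^sup>2 / (real (d j) * r\<^sup>2)) / 2)"
  shows "(\<integral>\<^sup>+c. ennreal (Phi c) \<partial>gm (blk n d j) (vr n d)) \<le> ennreal \<phi>"
    and "(\<integral>\<^sup>+c. ennreal (Phi c * (dotp {..n} u (\<lambda>k. 1 / r * rowv n d (fs c) x j k))\<^sup>2) \<partial>gm (blk n d j) (vr n d))
      \<le> ennreal (\<phi> * \<theta> * (dotp {..n} u u))"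
proof -
  let ?s = "L2_set x {..n}" and ?\<rho> = "dotp {..n} x x"
  let ?c = "1 / (real (d j) * r\<^sup>2)"
  let ?l = "\<lambda>p. mon_eval n (snd p) x" and ?l' = "\<lambda>p. 1 / sqrt (real (d j)) * dotp {..n} (mon_grad n (snd p) x) u"
  have dj: "2 \<le> d j" "d j \<le> D" using d[OF j] by auto
  have d0: "0 < real (d j)" using dj by simp
  have c0: "0 \<le> ?c" by simp
  have s: "0 < ?s" using inverse_norm_power_le[of 1] dj by simp
  note K = blk_kernels(1)[where d=d and j=j and n=n and x=x, OF dj(1)]
    blk_kernels(2,3)[where d=d and j=j and n=n and x=x and u=u, OF dj(1)]
  have V: "0 < ?\<rho> ^ d j" using s by (simp add: rho_eq)
  have E: "Phi c = exp (- (?c * (dotp (blk n d j) ?l c)\<^sup>2) / 2)" for c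
    by (simp add: Phi_def eval_form_blk)
  have sq: "1 / sqrt (1 + ?c * ?\<rho> ^ d j) \<le> \<phi>"
  proof -
    have "sqrt (?c * ?\<rho> ^ d j) = ?s ^ d j / (sqrt (real (d j)) * r)"
      using r s by (simp add: rho_eq real_sqrt_divide real_sqrt_mult power_mult[symmetric])
        (simp add: power_mult mult.commute[of 2] real_sqrt_power[symmetric])
    moreover have "sqrt (?c * ?\<rho> ^ d j) \<le> sqrt (1 + ?c * ?\<rho> ^ d j)" by simp
    moreover have p: "0 < ?s ^ d j / (sqrt (real (d j)) * r)" using s r d0 by simp
    ultimately have le: "?s ^ d j / (sqrt (real (d j)) * r) \<le> sqrt (1 + ?c * ?\<rho> ^ d j)" by linarith
    have "1 / sqrt (1 + ?c * ?\<rho> ^ d j) \<le> 1 / (?s ^ d j / (sqrt (real (d j)) * r))"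
      by (rule divide_left_mono[OF le]) (use mult_pos_pos[OF less_le_trans[OF p le] p] in simp_all)
    also have "\<dots> = sqrt (real (d j)) * r * (1 / ?s ^ d j)" by simp
    also have "\<dots> \<le> \<phi>" unfolding \<phi>_def using inverse_norm_power_le[OF dj(2)] r by (intro mult_left_mono) auto
    finally show ?thesis .
  qed
  have "(\<integral>\<^sup>+c. ennreal (Phi c) \<partial>gm (blk n d j) (vr n d)) = ennreal (1 / sqrt (1 + ?c * ?\<rho> ^ d j))"
    using nn_integral_gm_exp2(2)[where A="blk n d j" and v="vr n d" and l="?l" and l'="?l" and c="?c" and c'=0, OF finite_blk vr_pos c0 order.refl] K(1) by (simp add: E)
  also have "\<dots> \<le> ennreal \<phi>" using sq by (rule ennreal_leI)
  finally show "(\<integral>\<^sup>+c. ennreal (Phi c) \<partial>gm (blk n d j) (vr n d)) \<le> ennreal \<phi>" .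
  let ?t = "dotp {..n} x u"
  let ?X = "(real (d j - 1) * ?\<rho> ^ (d j - 2) * ?t\<^sup>2 + ?\<rho> ^ (d j - 1) * dotp {..n} u u) -
     ?c * (sqrt (real (d j)) * ?\<rho> ^ (d j - 1) * ?t)\<^sup>2 / (1 + ?c * ?\<rho> ^ d j)"
  have X: "?X \<le> exp (1 / real n) * dotp {..n} u u"
  proof -
    obtain e where e: "d j = Suc (Suc e)" using dj(1) by (metis add_2_eq_Suc le_Suc_ex)
    \<comment> \<open>The bound \<open>2 * D * r \<le> 1\<close> enters here: with \<open>C\<close>
      the right-hand side, \<open>d - 1 \<le> C\<close> is exactly
      \<open>(d - 1) * (1 + C) \<le> d * C\<close>, so the subtracted square dominates the radial
      excess.\<close>
    have "real (d j) - 1 \<le> ?c * ?\<rho> ^ d j"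
    proof -
      have "real (d j) * (real (d j) - 1) * r\<^sup>2 \<le> (real D)\<^sup>2 * r\<^sup>2"
        using dj by (intro mult_right_mono) (auto simp: power2_eq_square intro!: mult_mono)
      also have "\<dots> \<le> (1 / 2)\<^sup>2" using r by (simp add: power_divide)
      also have "\<dots> \<le> (?s ^ d j)\<^sup>2"
      proof (intro power_mono)
        have "1 / 2 \<le> 1 - 1 / (2 * real n)" using n by (simp add: field_simps)
        then show "1 / 2 \<le> ?s ^ d j" using norm_power_bounds(1)[OF dj(2)] by linarith
      qed simp
      also have "\<dots> = ?\<rho> ^ d j" by (simp add: rho_eq power_mult[symmetric] mult.commute)
      finally have "real (d j) * (real (d j) - 1) * r\<^sup>2 \<le> ?\<rho> ^ d j" .
      then show ?thesis using d0 r by (simp add: le_divide_eq mult_ac)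
    qed
    moreover have c1: "0 < 1 + ?c * ?\<rho> ^ d j" using V c0 by (intro add_pos_nonneg mult_nonneg_nonneg) auto
    moreover have "(e - 1) * (1 + C) \<le> e * C" if "e - 1 \<le> C" for e C :: real
      using that by (simp add: algebra_simps)
    ultimately have "(real (d j) - 1) * (1 + ?c * ?\<rho> ^ d j) \<le> real (d j) * (?c * ?\<rho> ^ d j)"
      by blast
    also have "\<dots> = ?c * real (d j) * ?\<rho> ^ d j" by (simp only: mult_ac)
    finally have "(real (d j) - 1) * (1 + ?c * ?\<rho> ^ d j) \<le> ?c * real (d j) * ?\<rho> ^ d j" .
    then have k: "real (d j) - 1 \<le> ?c * real (d j) * ?\<rho> ^ d j / (1 + ?c * ?\<rho> ^ d j)"
      using c1 by (simp only: le_divide_eq if_True)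
    have "real (d j - 1) * ?\<rho> ^ (d j - 2) * ?t\<^sup>2 = (real (d j) - 1) * (?\<rho> ^ (d j - 2) * ?t\<^sup>2)"
      using dj by (simp add: of_nat_diff)
    also have "\<dots> \<le> (?c * real (d j) * ?\<rho> ^ d j / (1 + ?c * ?\<rho> ^ d j)) * (?\<rho> ^ (d j - 2) * ?t\<^sup>2)"
      using k by (intro mult_right_mono) (auto simp: rho_eq)
    also have "\<dots> = ?c * (sqrt (real (d j)) * ?\<rho> ^ (d j - 1) * ?t)\<^sup>2 / (1 + ?c * ?\<rho> ^ d j)"
    proof -
      have "(sqrt (real (d j)) * ?\<rho> ^ (d j - 1) * ?t)\<^sup>2 = real (d j) * (?\<rho> ^ d j * ?\<rho> ^ (d j - 2)) * ?t\<^sup>2"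
        by (simp add: power_mult_distrib) (simp add: e power2_eq_square mult_ac)
      then show ?thesis by (simp only: times_divide_eq_left times_divide_eq_right mult_ac)
    qed
    finally have X1: "?X \<le> ?\<rho> ^ (d j - 1) * dotp {..n} u u" by simp
    have "?\<rho> ^ (d j - 1) = (?s ^ (d j - 1))\<^sup>2" by (simp add: rho_eq power_mult[symmetric] mult.commute)
    also have "\<dots> \<le> (exp (1 / (2 * real n)))\<^sup>2"
      using norm_power_bounds(2)[of "d j - 1"] dj s by (intro power_mono) auto
    also have "\<dots> = exp (1 / real n)" by (simp add: exp_double[symmetric])
    finally have "?\<rho> ^ (d j - 1) * dotp {..n} u u \<le> exp (1 / real n) * dotp {..n} u u"
      by (intro mult_right_mono) (simp_all add: dotp_self)
    with X1 show ?thesis by (rule order.trans)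
  qed
  have m2: "(\<integral>\<^sup>+c. ennreal (Phi c * (dotp (blk n d j) ?l' c)\<^sup>2) \<partial>gm (blk n d j) (vr n d)) \<le>
      ennreal (1 / sqrt (1 + ?c * ?\<rho> ^ d j) * ?X)"
    unfolding E using nn_integral_gm_exp_square_le[where A="blk n d j" and v="vr n d" and l="?l" and l'="?l'" and c="?c", OF finite_blk vr_pos c0]
    unfolding K by simp
  also have "\<dots> \<le> ennreal (\<phi> * (exp (1 / real n) * dotp {..n} u u))"
    using sq X by (intro ennreal_leI order.trans[OF mult_left_mono[OF X]] mult_right_mono)
      (auto simp: dotp_self intro!: add_nonneg_nonneg)
  finally have m2': "(\<integral>\<^sup>+c. ennreal (Phi c * (dotp (blk n d j) ?l' c)\<^sup>2) \<partial>gm (blk n d j) (vr n d)) \<le>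
      ennreal (\<phi> * (exp (1 / real n) * dotp {..n} u u))" .
  have "(\<integral>\<^sup>+c. ennreal (Phi c * (dotp {..n} u (\<lambda>k. 1 / r * rowv n d (fs c) x j k))\<^sup>2) \<partial>gm (blk n d j) (vr n d))
     = (\<integral>\<^sup>+c. ennreal (1 / r\<^sup>2) * ennreal (Phi c * (dotp (blk n d j) ?l' c)\<^sup>2) \<partial>gm (blk n d j) (vr n d))"
  proof (intro nn_integral_cong)
    fix c
    have "dotp {..n} u (\<lambda>k. 1 / r * rowv n d (fs c) x j k) = 1 / r * dotp (blk n d j) ?l' c"
      unfolding dotp_scale by (subst dotp_commute) (simp add: dotp_rowv_blk)
    then show "ennreal (Phi c * (dotp {..n} u (\<lambda>k. 1 / r * rowv n d (fs c) x j k))\<^sup>2) =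
      ennreal (1 / r\<^sup>2) * ennreal (Phi c * (dotp (blk n d j) ?l' c)\<^sup>2)"
      by (simp add: ennreal_mult[symmetric] Phi_def power_divide)
  qed
  also have "\<dots> = ennreal (1 / r\<^sup>2) * (\<integral>\<^sup>+c. ennreal (Phi c * (dotp (blk n d j) ?l' c)\<^sup>2) \<partial>gm (blk n d j) (vr n d))"
    unfolding E by (intro nn_integral_cmult) measurable
  also have "\<dots> \<le> ennreal (1 / r\<^sup>2) * ennreal (\<phi> * (exp (1 / real n) * dotp {..n} u u))"
    by (intro mult_left_mono m2') simp
  also have "\<dots> = ennreal (\<phi> * \<theta> * (dotp {..n} u u))"
    using r by (subst ennreal_mult[symmetric]) (auto simp: \<theta>_def \<phi>_def dotp_self)
  finally show "(\<integral>\<^sup>+c. ennreal (Phi c * (dotp {..n} u (\<lambda>k. 1 / r * rowv n d (fs c) x j k))\<^sup>2) \<partial>gm (blk n d j) (vr n d))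
      \<le> ennreal (\<phi> * \<theta> * (dotp {..n} u u))" .
qed

end

section \<open>Dependence on single blocks, and measurability in coefficients and points\<close>

lemma eval_form_cong: "(\<And>\<alpha>. \<alpha> \<in> multi_indices n d \<Longrightarrow> g \<alpha> = g' \<alpha>) \<Longrightarrow> eval_form n d g x = eval_form n d g' x"
  by (simp add: eval_form_def)

lemma rowv_cong:
  "(\<And>\<alpha>. \<alpha> \<in> multi_indices n (d j) \<Longrightarrow> f j \<alpha> = f' j \<alpha>) \<Longrightarrow> rowv n d f x j = rowv n d f' x j"
  by (simp add: rowv_def grad_def fun_eq_iff)

lemma mon_eval_measurable:
  assumes "\<And>k. k \<le> n \<Longrightarrow> (\<lambda>\<omega>. X \<omega> k) \<in> borel_measurable N"
  shows "(\<lambda>\<omega>. mon_eval n \<alpha> (X \<omega>)) \<in> borel_measurable N"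
  unfolding mon_eval_def
  by (rule borel_measurable_prod, rule borel_measurable_power, rule assms) simp

lemma eval_form_measurable:
  assumes C: "\<And>\<alpha>. \<alpha> \<in> multi_indices n (d j) \<Longrightarrow> (\<lambda>\<omega>. C \<omega> (j, \<alpha>)) \<in> borel_measurable N"
    and X: "\<And>k. k \<le> n \<Longrightarrow> (\<lambda>\<omega>. X \<omega> k) \<in> borel_measurable N"
  shows "(\<lambda>\<omega>. eval_form n (d j) (fs (C \<omega>) j) (X \<omega>)) \<in> borel_measurable N"
  unfolding eval_form_eq_dotp dotp_def fs_def
  by (intro borel_measurable_sum borel_measurable_times mon_eval_measurable X C)

lemma rowv_measurable:
  assumes C: "\<And>\<alpha>. \<alpha> \<in> multi_indices n (d j) \<Longrightarrow> (\<lambda>\<omega>. C \<omega> (j, \<alpha>)) \<in> borel_measurable N"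
    and X: "\<And>k. k \<le> n \<Longrightarrow> (\<lambda>\<omega>. X \<omega> k) \<in> borel_measurable N"
  shows "(\<lambda>\<omega>. rowv n d (fs (C \<omega>)) (X \<omega>) j k) \<in> borel_measurable N"
  unfolding rowv_def grad_def fs_def mon_grad_def
  by (intro borel_measurable_divide borel_measurable_sum borel_measurable_times borel_measurable_const
      mon_eval_measurable X C)

lemma wt_measurable:
  assumes b: "\<And>j k. j < n \<Longrightarrow> k \<le> n \<Longrightarrow> (\<lambda>\<omega>. b \<omega> j k) \<in> borel_measurable N"
    and y: "\<And>j. j < n \<Longrightarrow> (\<lambda>\<omega>. y \<omega> j) \<in> borel_measurable N" and i: "i < n"
  shows "(\<lambda>\<omega>. wt n d D \<eta> r i (b \<omega>) (y \<omega>)) \<in> borel_measurable N"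
proof -
  have 1: "(\<lambda>\<omega>. gI0 n \<eta> r i (b \<omega>)) \<in> borel_measurable N"
    unfolding gI0_def
    by (rule gI_measurable, simp, rule borel_measurable_times, rule borel_measurable_const, rule b) auto
  have 2: "(\<lambda>\<omega>. gI1 n \<eta> r i (b \<omega>)) \<in> borel_measurable N"
    unfolding gI1_def
    by (rule gI_measurable, simp, rule borel_measurable_times, rule borel_measurable_const, rule b) auto
  have 3: "(\<lambda>\<omega>. \<Sum>j\<in>{..<n} - {i}. (y \<omega> j)\<^sup>2 / (real (d j) * r\<^sup>2)) \<in> borel_measurable N"
    by (rule borel_measurable_sum, rule borel_measurable_divide, rule borel_measurable_power, rule y) auto
  have *: "(\<lambda>\<omega>. 1 / A \<omega> * exp (- S \<omega> / 2) * (exp (- ((Y \<omega>)\<^sup>2 / c) / 2) *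
      (if A \<omega> \<le> exp 1 * B \<omega> then 1 else 0))) \<in> borel_measurable N"
    if [measurable]: "A \<in> borel_measurable N" "B \<in> borel_measurable N" "S \<in> borel_measurable N"
      "Y \<in> borel_measurable N" for A B S Y :: "'a \<Rightarrow> real" and c
    by measurable
  show ?thesis unfolding wt_def by (rule *[OF 1 2 3 y[OF i]])
qed

lemma qrec_pos:
  assumes "0 < s" "0 \<le> \<theta>"
  shows "0 < qrec s \<theta> k p"
proof (induction k arbitrary: p)
  case (Suc k)
  have "0 \<le> \<theta> * real p * qrec s \<theta> k (p - 1)"
    using assms Suc[of "p - 1"] by (intro mult_nonneg_nonneg) auto
  then show ?case using Suc[of p] by simp
qed (use assms in simp)

lemma psi_empty: "psi {} s L g = 1"
  by (simp add: psi_def gI_def gint_def bform_def dotp_def PiM_empty nn_integral_count_space_finite)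

definition Phiv :: "nat \<Rightarrow> (nat \<Rightarrow> nat) \<Rightarrow> real \<Rightarrow> (nat \<Rightarrow> real) \<Rightarrow> nat \<Rightarrow> (nat \<times> (nat \<Rightarrow> nat) \<Rightarrow> real) \<Rightarrow> real" where
  "Phiv n d r x j c = exp (- ((eval_form n (d j) (fs c j) x)\<^sup>2 / (real (d j) * r\<^sup>2)) / 2)"

lemma Phiv_nonneg: "0 \<le> Phiv n d r x j c" by (simp add: Phiv_def)

lemma fs_merge:
  assumes "\<alpha> \<in> multi_indices n (d k)"
  shows "k \<in> L \<Longrightarrow> j \<notin> L \<Longrightarrow> fs (merge (blks n d L) (blk n d j) (y, z)) k \<alpha> = fs y k \<alpha>"
    and "j \<notin> L \<Longrightarrow> k = j \<Longrightarrow> fs (merge (blks n d L) (blk n d j) (y, z)) k \<alpha> = fs z k \<alpha>"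
  using assms by (auto simp: fs_def merge_def blks_def blk_def)

lemma coef_measurable_gm:
  "j \<in> L \<Longrightarrow> \<alpha> \<in> multi_indices n (d j) \<Longrightarrow> (\<lambda>c. c (j, \<alpha>)) \<in> borel_measurable (gm (blks n d L) v)"
  by (rule measurable_coef) (auto simp: blks_def)

lemma coef_measurable_gm_blk:
  "\<alpha> \<in> multi_indices n (d j) \<Longrightarrow> (\<lambda>c. c (j, \<alpha>)) \<in> borel_measurable (gm (blk n d j) v)"
  by (rule measurable_coef) (auto simp: blk_def)

lemma eval_form_measurable_gm:
  "j \<in> L \<Longrightarrow> (\<lambda>c. eval_form n (d j) (fs c j) x) \<in> borel_measurable (gm (blks n d L) v)"
  by (rule eval_form_measurable[where C="\<lambda>c. c" and X="\<lambda>_. x"]) (erule coef_measurable_gm, assumption, simp)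

lemma eval_form_measurable_gm_blk:
  "(\<lambda>c. eval_form n (d j) (fs c j) x) \<in> borel_measurable (gm (blk n d j) v)"
  by (rule eval_form_measurable[where C="\<lambda>c. c" and X="\<lambda>_. x"]) (erule coef_measurable_gm_blk, simp)

lemma rowv_measurable_gm:
  "j \<in> L \<Longrightarrow> (\<lambda>c. rowv n d (fs c) x j k) \<in> borel_measurable (gm (blks n d L) v)"
  by (rule rowv_measurable[where C="\<lambda>c. c" and X="\<lambda>_. x"]) (erule coef_measurable_gm, assumption, simp)

lemma rowv_measurable_gm_blk:
  "(\<lambda>c. rowv n d (fs c) x j k) \<in> borel_measurable (gm (blk n d j) v)"
  by (rule rowv_measurable[where C="\<lambda>c. c" and X="\<lambda>_. x"]) (erule coef_measurable_gm_blk, simp)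

lemma Phiv_measurable_gm:
  assumes "j \<in> L"
  shows "Phiv n d r x j \<in> borel_measurable (gm (blks n d L) v)"
proof -
  note [measurable] = eval_form_measurable_gm[OF assms]
  show ?thesis unfolding Phiv_def by measurable
qed

lemma Phiv_measurable_gm_blk:
  "Phiv n d r x j \<in> borel_measurable (gm (blk n d j) v)"
proof -
  note [measurable] = eval_form_measurable_gm_blk[where j=j and d=d and n=n and x=x and v=v]
  show ?thesis unfolding Phiv_def by measurable
qed

context
  fixes n D :: nat and d :: "nat \<Rightarrow> nat" and r l \<eta> :: real and x :: "nat \<Rightarrow> real"
  assumes n: "1 \<le> n" and d: "\<And>j. j < n \<Longrightarrow> 2 \<le> d j \<and> d j \<le> D"
    and r: "0 < r" "4 * (real D)\<^sup>2 * r\<^sup>2 \<le> 1" and l: "0 \<le> l" "2 * real n * real D * l \<le> 1"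
    and x: "\<bar>L2_set x {..n} - 1\<bar> \<le> l" and \<eta>: "0 < \<eta>"
begin

abbreviation "phic j \<equiv> sqrt (real (d j)) * r * (1 + 1 / real n)"
abbreviation "thc \<equiv> exp (1 / real n) / r\<^sup>2"
abbreviation "rw c \<equiv> (\<lambda>j k. 1 / r * rowv n d (fs c) x j k)"

text \<open>Different equations use disjoint blocks of coefficients. Integrating the block
  \<open>j\<close> with the others fixed is one determinant update in the mean and reproduces one
  step of \<open>qrec\<close>. The coordinate set \<open>A\<close> has to vary in the induction,
  since minors delete coordinates.\<close>

lemma psi_expectation:
  assumes "finite L" "L \<subseteq> {..<n}" "A \<subseteq> {..n}" and s: "0 < s"
  shows "(\<integral>\<^sup>+c. ennreal ((\<Prod>j\<in>L. Phiv n d r x j c) * psi A (\<lambda>_. s) L (rw c)) \<partial>gm (blks n d L) (vr n d))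
    \<le> ennreal ((\<Prod>j\<in>L. phic j) * qrec s thc (card L) (card A))"
  using assms(1,2,3)
proof (induction L arbitrary: A rule: finite_induct)
  case empty
  have "finite A" using empty by (metis finite_atMost finite_subset)
  then have "psi A (\<lambda>_. s) {} (rw c) = s ^ card A" for c
    using s by (subst psi_base) auto
  moreover have "blks n d {} = {}" by (simp add: blks_def)
  ultimately show ?case by (simp add: PiM_empty nn_integral_count_space_finite)
next
  case (insert j L)
  interpret G: product_prob_space "\<lambda>a. gauss (vr n d a)"
    by (rule product_prob_space_gm[OF vr_pos])
  have fA: "finite A" using insert.prems by (metis finite_atMost finite_subset)
  have j: "j < n" "L \<subseteq> {..<n}" using insert.prems by auto
  have jL: "j \<notin> L" and fL: "finite L" using insert.hyps by auto
  have ph: "0 \<le> phic k" for k using r by simp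
  have th: "0 \<le> thc" by simp
  let ?GL = "gm (blks n d L) (vr n d)" and ?Gj = "gm (blk n d j) (vr n d)"
  let ?P = "\<lambda>y. \<Prod>k\<in>L. Phiv n d r x k y"
  let ?F = "\<lambda>c. ennreal ((\<Prod>j\<in>insert j L. Phiv n d r x j c) * psi A (\<lambda>_. s) (insert j L) (rw c))"
  have P0: "0 \<le> ?P y" for y by (intro prod_nonneg) (simp add: Phiv_nonneg)
  have Phim: "(\<lambda>c. Phiv n d r x k c) \<in> borel_measurable (gm (blks n d L') (vr n d))" if "k \<in> L'" for k L'
    using Phiv_measurable_gm[OF that] .
  have psim: "(\<lambda>c. psi A' (\<lambda>_. s) L' (rw c)) \<in> borel_measurable (gm (blks n d L') (vr n d))" if "finite A'" for A' L'
    using that by (intro psi_measurable borel_measurable_times borel_measurable_const rowv_measurable_gm)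
  have [measurable]: "?P \<in> borel_measurable ?GL"
    using Phim[of _ L] by (intro borel_measurable_prod) auto
  have Fm: "?F \<in> borel_measurable (gm (blks n d L \<union> blk n d j) (vr n d))"
    unfolding blks_insert[symmetric]
    using Phim[of _ "insert j L"] psim[OF fA, of "insert j L"]
    by (intro measurable_compose[OF _ measurable_ennreal] borel_measurable_times borel_measurable_prod) auto
  have split: "?F (merge (blks n d L) (blk n d j) (y, z)) =
     ennreal (?P y) * ennreal (Phiv n d r x j z * psi A (\<lambda>_. s) (insert j L) ((rw y)(j := (\<lambda>k. 1 / r * rowv n d (fs z) x j k))))" for y z
  proof -
    let ?m = "merge (blks n d L) (blk n d j) (y, z)"
    have 1: "Phiv n d r x k ?m = Phiv n d r x k y" if "k \<in> L" for k
    proof -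
      have "eval_form n (d k) (fs ?m k) x = eval_form n (d k) (fs y k) x"
        by (rule eval_form_cong) (rule fs_merge(1)[OF _ that jL])
      then show ?thesis by (simp add: Phiv_def)
    qed
    have 2: "Phiv n d r x j ?m = Phiv n d r x j z"
    proof -
      have "eval_form n (d j) (fs ?m j) x = eval_form n (d j) (fs z j) x"
        by (rule eval_form_cong) (rule fs_merge(2)[OF _ jL refl])
      then show ?thesis by (simp add: Phiv_def)
    qed
    have 3: "rowv n d (fs ?m) x k = rowv n d (fs y) x k" if "k \<in> L" for k
      by (rule rowv_cong) (rule fs_merge(1)[OF _ that jL])
    have 4: "rowv n d (fs ?m) x j = rowv n d (fs z) x j"
      by (rule rowv_cong) (rule fs_merge(2)[OF _ jL refl])
    have "psi A (\<lambda>_. s) (insert j L) (rw ?m) = psi A (\<lambda>_. s) (insert j L) ((rw y)(j := (\<lambda>k. 1 / r * rowv n d (fs z) x j k)))"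
      by (rule psi_row_cong) (use 3 4 in auto)
    moreover have "(\<Prod>j\<in>insert j L. Phiv n d r x j ?m) = ?P y * Phiv n d r x j z"
      using jL fL 1 2 by simp
    ultimately show ?thesis using P0 by (simp add: ennreal_mult' mult.assoc)
  qed
  have inner: "(\<integral>\<^sup>+z. ?F (merge (blks n d L) (blk n d j) (y, z)) \<partial>?Gj) \<le>
     ennreal (phic j) * (ennreal (?P y * psi A (\<lambda>_. s) L (rw y)) +
       ennreal thc * (\<Sum>a\<in>A. ennreal (?P y * psi (A - {a}) (\<lambda>_. s) L (rw y))))" for y
  proof -
    have bm: "(\<lambda>z. dotp A u (\<lambda>k. 1 / r * rowv n d (fs z) x j k)) \<in> borel_measurable ?Gj" for u
      unfolding dotp_def
      by (intro borel_measurable_sum borel_measurable_times borel_measurable_const rowv_measurable_gm_blk)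
    have Pm: "Phiv n d r x j \<in> borel_measurable ?Gj"
      by (rule Phiv_measurable_gm_blk)
    have psn: "0 \<le> psi A' (\<lambda>_. s) L (rw y)" for A' by (simp add: psi_def)
    note RM = row_moments[OF n d r l x j(1)]
    have st: "(\<integral>\<^sup>+z. ennreal (Phiv n d r x j z * psi A (\<lambda>_. s) (insert j L) ((rw y)(j := (\<lambda>k. 1 / r * rowv n d (fs z) x j k)))) \<partial>?Gj)
       \<le> ennreal (phic j * (psi A (\<lambda>_. s) L (rw y) + thc * (\<Sum>a\<in>A. psi (A - {a}) (\<lambda>_. s) L (rw y))))"
    proof (rule nn_integral_psi_insert_le[OF fA _ fL jL bm Pm Phiv_nonneg ph th])
      show "(\<integral>\<^sup>+z. ennreal (Phiv n d r x j z) \<partial>?Gj) \<le> ennreal (phic j)"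
        using RM(1) by (simp add: Phiv_def)
      fix u :: "nat \<Rightarrow> real"
      \<comment> \<open>Rows restricted to \<open>A\<close> are tested through the extension of
        \<open>u\<close> by zero, for which the full moments are known.\<close>
      define u' where "u' = (\<lambda>a. if a \<in> A then u a else 0)"
      have e1: "dotp A u b = dotp {..n} u' b" for b
        unfolding dotp_def u'_def using insert.prems(2)
        by (simp add: if_distrib[where f="\<lambda>t. t * _"] sum.If_cases Int_absorb1 cong: if_cong)
      have e2: "(\<Sum>a\<in>A. (u a)\<^sup>2) = dotp {..n} u' u'"
        unfolding dotp_def u'_def using insert.prems(2)
        by (simp add: if_distrib[where f="\<lambda>t. t * _"] sum.If_cases Int_absorb1 power2_eq_square cong: if_cong)
      show "(\<integral>\<^sup>+z. ennreal (Phiv n d r x j z * (dotp A u (\<lambda>k. 1 / r * rowv n d (fs z) x j k))\<^sup>2) \<partial>?Gj)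
         \<le> ennreal (phic j * thc * (\<Sum>a\<in>A. (u a)\<^sup>2))"
        unfolding e1 e2 using RM(2)[where u=u'] by (simp add: Phiv_def)
    qed (use s in auto)
    have "(\<integral>\<^sup>+z. ?F (merge (blks n d L) (blk n d j) (y, z)) \<partial>?Gj) =
      ennreal (?P y) * (\<integral>\<^sup>+z. ennreal (Phiv n d r x j z * psi A (\<lambda>_. s) (insert j L) ((rw y)(j := (\<lambda>k. 1 / r * rowv n d (fs z) x j k)))) \<partial>?Gj)"
      unfolding split
    proof (rule nn_integral_cmult)
      have "(\<lambda>z. psi A (\<lambda>_. s) (insert j L) ((rw y)(j := (\<lambda>k. 1 / r * rowv n d (fs z) x j k)))) \<in> borel_measurable ?Gj"
      proof (rule psi_measurable[OF fA])
        fix k a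
        show "(\<lambda>z. ((rw y)(j := (\<lambda>k. 1 / r * rowv n d (fs z) x j k))) k a) \<in> borel_measurable ?Gj"
        proof (cases "k = j")
          case True
          then show ?thesis
            by (simp add: borel_measurable_divide rowv_measurable_gm_blk)
        qed simp
      qed
      then show "(\<lambda>z. ennreal (Phiv n d r x j z * psi A (\<lambda>_. s) (insert j L) ((rw y)(j := (\<lambda>k. 1 / r * rowv n d (fs z) x j k))))) \<in> borel_measurable ?Gj"
        using Pm by measurable
    qed
    also have "\<dots> \<le> ennreal (?P y) * ennreal (phic j * (psi A (\<lambda>_. s) L (rw y) + thc * (\<Sum>a\<in>A. psi (A - {a}) (\<lambda>_. s) L (rw y))))"
      by (intro mult_left_mono st) simp
    also have "\<dots> = ennreal (phic j * (?P y * psi A (\<lambda>_. s) L (rw y) + thc * (\<Sum>a\<in>A. ?P y * psi (A - {a}) (\<lambda>_. s) L (rw y))))"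
      using P0[of y] by (subst ennreal_mult'[symmetric]) (simp_all only: sum_distrib_left distrib_left mult_ac)
    also have "\<dots> = ennreal (phic j) * (ennreal (?P y * psi A (\<lambda>_. s) L (rw y)) +
       ennreal thc * (\<Sum>a\<in>A. ennreal (?P y * psi (A - {a}) (\<lambda>_. s) L (rw y))))"
    proof -
      have nn: "0 \<le> ?P y * psi A' (\<lambda>_. s) L (rw y)" for A' using P0 psn by (intro mult_nonneg_nonneg) auto
      have "0 \<le> (\<Sum>a\<in>A. ?P y * psi (A - {a}) (\<lambda>_. s) L (rw y))" by (intro sum_nonneg nn)
      moreover have "(\<Sum>a\<in>A. ennreal (?P y * psi (A - {a}) (\<lambda>_. s) L (rw y))) = ennreal (\<Sum>a\<in>A. ?P y * psi (A - {a}) (\<lambda>_. s) L (rw y))"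
        by (intro sum_ennreal nn)
      ultimately show ?thesis
        using nn[of A] ph[of j] th by (simp only: ennreal_mult' ennreal_plus mult_nonneg_nonneg)
    qed
    finally show ?thesis .
  qed
  have "(\<integral>\<^sup>+c. ?F c \<partial>gm (blks n d (insert j L)) (vr n d)) =
    (\<integral>\<^sup>+y. \<integral>\<^sup>+z. ?F (merge (blks n d L) (blk n d j) (y, z)) \<partial>?Gj \<partial>?GL)"
    unfolding blks_insert
    by (rule G.product_nn_integral_fold[OF blks_disjoint[OF jL] finite_blks[OF fL] finite_blk Fm])
  also have "\<dots> \<le> (\<integral>\<^sup>+y. ennreal (phic j) * (ennreal (?P y * psi A (\<lambda>_. s) L (rw y)) +
       ennreal thc * (\<Sum>a\<in>A. ennreal (?P y * psi (A - {a}) (\<lambda>_. s) L (rw y)))) \<partial>?GL)"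
    by (intro nn_integral_mono inner)
  also have "\<dots> = ennreal (phic j) * ((\<integral>\<^sup>+y. ennreal (?P y * psi A (\<lambda>_. s) L (rw y)) \<partial>?GL) +
       ennreal thc * (\<Sum>a\<in>A. \<integral>\<^sup>+y. ennreal (?P y * psi (A - {a}) (\<lambda>_. s) L (rw y)) \<partial>?GL))"
  proof -
    have Pm: "?P \<in> borel_measurable ?GL" using Phim[of _ L] by (intro borel_measurable_prod) auto
    have "(\<lambda>y. ennreal (?P y * psi A' (\<lambda>_. s) L (rw y))) \<in> borel_measurable ?GL" if "finite A'" for A'
      by (rule measurable_compose[OF borel_measurable_times[OF Pm psim[OF that, of L]] measurable_ennreal])
    note mm = this
    have m: "(\<lambda>y. ennreal (?P y * psi A (\<lambda>_. s) L (rw y))) \<in> borel_measurable ?GL"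
      "\<And>a. (\<lambda>y. ennreal (?P y * psi (A - {a}) (\<lambda>_. s) L (rw y))) \<in> borel_measurable ?GL"
      using mm[OF fA] mm[OF finite_Diff[OF fA]] by blast+
    show ?thesis
      by (subst nn_integral_cmult, (intro borel_measurable_add borel_measurable_times_ennreal borel_measurable_sum borel_measurable_const m),
          subst nn_integral_add, (intro m), (intro borel_measurable_times_ennreal borel_measurable_sum borel_measurable_const m),
          subst nn_integral_cmult, (intro borel_measurable_sum m),
          subst nn_integral_sum, (intro m), rule refl)
  qed
  also have "\<dots> \<le> ennreal (phic j) * (ennreal ((\<Prod>k\<in>L. phic k) * qrec s thc (card L) (card A)) +
       ennreal thc * (\<Sum>a\<in>A. ennreal ((\<Prod>k\<in>L. phic k) * qrec s thc (card L) (card (A - {a})))))"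
    using insert.prems j by (intro mult_left_mono add_mono sum_mono insert.IH) auto
  also have "\<dots> = ennreal (phic j) * (ennreal ((\<Prod>k\<in>L. phic k) * qrec s thc (card L) (card A)) +
       ennreal thc * (\<Sum>a\<in>A. ennreal ((\<Prod>k\<in>L. phic k) * qrec s thc (card L) (card A - 1))))"
    using fA by simp
  also have "\<dots> = ennreal ((\<Prod>k\<in>insert j L. phic k) * qrec s thc (card (insert j L)) (card A))"
  proof -
    have pn: "0 \<le> (\<Prod>k\<in>L. phic k)" by (intro prod_nonneg ph)
    have qn: "0 \<le> qrec s thc (card L) p" for p using s th by (intro qrec_nonneg) auto
    have nn: "0 \<le> (\<Prod>k\<in>L. phic k) * qrec s thc (card L) p" for p using pn qn by (intro mult_nonneg_nonneg)
    have "(\<Sum>a\<in>A. ennreal ((\<Prod>k\<in>L. phic k) * qrec s thc (card L) (card A - 1))) =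
      ennreal (\<Sum>a\<in>A. (\<Prod>k\<in>L. phic k) * qrec s thc (card L) (card A - 1))"
      by (intro sum_ennreal nn)
    also have "(\<Sum>a\<in>A. (\<Prod>k\<in>L. phic k) * qrec s thc (card L) (card A - 1)) =
       real (card A) * ((\<Prod>k\<in>L. phic k) * qrec s thc (card L) (card A - 1))" by simp
    finally have 1: "(\<Sum>a\<in>A. ennreal ((\<Prod>k\<in>L. phic k) * qrec s thc (card L) (card A - 1))) =
      ennreal (real (card A) * ((\<Prod>k\<in>L. phic k) * qrec s thc (card L) (card A - 1)))" .
    have 2: "(\<Prod>k\<in>insert j L. phic k) * qrec s thc (card (insert j L)) (card A) =
      phic j * ((\<Prod>k\<in>L. phic k) * qrec s thc (card L) (card A) +
        thc * (real (card A) * ((\<Prod>k\<in>L. phic k) * qrec s thc (card L) (card A - 1))))"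
    proof -
      have "(\<Prod>k\<in>insert j L. phic k) = phic j * (\<Prod>k\<in>L. phic k)" using jL fL by simp
      moreover have "qrec s thc (card (insert j L)) (card A) =
        qrec s thc (card L) (card A) + thc * real (card A) * qrec s thc (card L) (card A - 1)" using jL fL by simp
      ultimately show ?thesis by (simp only: distrib_left mult_ac)
    qed
    have "0 \<le> real (card A) * ((\<Prod>k\<in>L. phic k) * qrec s thc (card L) (card A - 1))"
      by (intro mult_nonneg_nonneg nn) simp
    then show ?thesis unfolding 1 2 using nn[of "card A"] ph[of j] th
      by (simp only: ennreal_mult' ennreal_plus mult_nonneg_nonneg)
  qed
  finally show ?case .
qed

text \<open>Given the other rows, the surviving conditions on row \<open>i\<close> are two orthogonal constraints: one
  along \<open>x\<close> and one along a unit vector orthogonal to \<open>x\<close> and to all other rows.\<close>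

lemma distinguished_row:
  assumes i: "i < n"
  shows "(\<integral>\<^sup>+z. ennreal (exp (- ((eval_form n (d i) (fs z i) x)\<^sup>2 / (2 * real D * (real n)\<^sup>2 * r\<^sup>2)) / 2) *
      (if gI0 n \<eta> r i b \<le> exp 1 * gI1 n \<eta> r i (b(i := rowv n d (fs z) x i)) then 1 else 0)) \<partial>gm (blk n d i) (vr n d))
    \<le> ennreal (80 * real D * (real n)\<^sup>2 * r * \<eta>)"
proof -
  let ?D = "dotp {..n}"
  let ?L = "{..<n} - {i}"
  have n0: "1 \<le> real n" using n by simp
  have di: "2 \<le> d i" "d i \<le> D" using d[OF i] by auto
  have D1: "1 \<le> real D" using di by linarith
  \<comment> \<open>Row \<open>i\<close> is replaced by \<open>x\<close>: these are \<open>n\<close>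
    conditions in \<open>n + 1\<close> dimensions, so a unit vector orthogonal to \<open>x\<close>
    and to all other rows exists.\<close>
  define M where "M = (\<lambda>e. if e = i then x else b e)"
  obtain w0 where w0: "\<exists>a\<in>{..n}. w0 a \<noteq> 0" "\<And>e. e < n \<Longrightarrow> ?D (M e) w0 = 0"
    using homogeneous_system_solution[of "{..<n}" "{..n}" M] by auto
  have "L2_set w0 {..n} \<noteq> 0" using w0(1) by (simp add: L2_set_eq_0_iff)
  then have wp: "0 < L2_set w0 {..n}" by (metis L2_set_nonneg order_le_imp_less_or_eq)
  define w where "w = (\<lambda>k. 1 / L2_set w0 {..n} * w0 k)"
  have w1: "L2_set w {..n} = 1"
    unfolding w_def using wp by (subst L2_set_right_distrib[symmetric]) auto
  have wM: "?D (M e) w = 0" if "e < n" for e unfolding w_def dotp_scale using w0(2)[OF that] by simp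
  have xw: "?D x w = 0" using wM[OF i] by (simp add: M_def)
  have ww: "?D w w = 1" using w1 by (simp add: dotp_self)
  have bw: "?D (b e) w = 0" if "e \<in> ?L" for e using wM[of e] that by (simp add: M_def)
  have s: "\<And>a. a \<in> {..n} \<Longrightarrow> 0 < (\<eta> / r)\<^sup>2" using r \<eta> by simp
  \<comment> \<open>As \<open>exp 1 \<le> 3\<close>, the test forces \<open>1 + V \<le> 9\<close>.
    At \<open>w\<close> the form reduces to its regularisation
    \<open>\<eta>\<^sup>2 / r\<^sup>2\<close>, so Cauchy-Schwarz for the form bounds the component
    of the new row; \<open>48 = 8 * 6\<close>, with 6 from the scaling in
    \<open>gI1\<close>.\<close>
  have small: "(?D h w)\<^sup>2 \<le> 48 * (real n)\<^sup>2 * \<eta>\<^sup>2" if S: "gI0 n \<eta> r i b \<le> exp 1 * gI1 n \<eta> r i (b(i := h))" for h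
  proof -
    let ?k = "1 / (sqrt 6 * real n * r)"
    define g where "g = (\<lambda>j k. (if j = i then ?k else 1 / r) * (b(i := h)) j k)"
    let ?B = "bform {..n} (\<lambda>_. (\<eta> / r)\<^sup>2) ?L g"
    obtain W where W: "\<And>u. ?B W u = ?D (g i) u"
      using bform_solve[of "{..n}" "\<lambda>_. (\<eta> / r)\<^sup>2" ?L g "g i"] s by auto
    have ins: "insert i ?L = {..<n}" using i by auto
    have V0: "0 \<le> ?D (g i) W"
      using gI_insert(1)[of "{..n}" "\<lambda>_. (\<eta> / r)\<^sup>2" ?L i g W] s W by auto
    have "gI {..n} (\<lambda>_. (\<eta> / r)\<^sup>2) ?L g = sqrt (1 + ?D (g i) W) * gI {..n} (\<lambda>_. (\<eta> / r)\<^sup>2) (insert i ?L) g"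
      using gI_insert(2)[of "{..n}" "\<lambda>_. (\<eta> / r)\<^sup>2" ?L i g W] s W by auto
    moreover have "gI {..n} (\<lambda>_. (\<eta> / r)\<^sup>2) ?L g = gI0 n \<eta> r i b"
      unfolding gI0_def gI_def by (intro arg_cong[where f=enn2real] gint_row_cong) (auto simp: g_def)
    moreover have "gI {..n} (\<lambda>_. (\<eta> / r)\<^sup>2) (insert i ?L) g = gI1 n \<eta> r i (b(i := h))"
      unfolding ins gI1_def g_def ..
    ultimately have e: "gI0 n \<eta> r i b = sqrt (1 + ?D (g i) W) * gI1 n \<eta> r i (b(i := h))" by simp
    have "0 < gI1 n \<eta> r i (b(i := h))" unfolding gI1_def using s by (intro gI_pos) auto
    with S have "sqrt (1 + ?D (g i) W) \<le> exp 1" unfolding e by simp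
    also have "\<dots> \<le> 3" by (rule exp_le)
    finally have "(sqrt (1 + ?D (g i) W))\<^sup>2 \<le> 3\<^sup>2" using V0 by (intro power_mono) auto
    then have V8: "?D (g i) W \<le> 8" using V0 by simp
    have Bw: "?B w w = \<eta>\<^sup>2 / r\<^sup>2"
    proof -
      have gz: "?D (g j) w = 0" if "j \<in> ?L" for j
      proof -
        have "g j = (\<lambda>k. 1 / r * b j k)" using that by (simp add: g_def)
        then show ?thesis using bw[OF that] by (simp only: dotp_scale_left mult_zero_right)
      qed
      then have "?B w w = (\<eta> / r)\<^sup>2 * ?D w w"
        by (simp add: bform_def dotp_def sum_distrib_left mult_ac)
      then show ?thesis by (simp add: ww power_divide)
    qed
    have "(?B W w)\<^sup>2 \<le> ?B W W * ?B w w"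
      using s by (intro bform_Cauchy_Schwarz) auto
    then have "(?D (g i) w)\<^sup>2 \<le> ?D (g i) W * (\<eta>\<^sup>2 / r\<^sup>2)" by (simp add: W Bw)
    also have "\<dots> \<le> 8 * (\<eta>\<^sup>2 / r\<^sup>2)" using V8 by (intro mult_right_mono) auto
    also have "?D (g i) w = ?k * ?D h w"
    proof -
      have "g i = (\<lambda>k. ?k * h k)" by (simp add: g_def)
      then show ?thesis by (simp only: dotp_scale_left)
    qed
    finally have "(?D h w)\<^sup>2 / (6 * (real n)\<^sup>2 * r\<^sup>2) \<le> 8 * (\<eta>\<^sup>2 / r\<^sup>2)"
      by (simp add: power_mult_distrib power_divide)
    then have "(?D h w)\<^sup>2 \<le> 8 * (\<eta>\<^sup>2 / r\<^sup>2) * (6 * (real n)\<^sup>2 * r\<^sup>2)"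
      using n0 r by (subst (asm) divide_le_eq) auto
    then show ?thesis using r(1) by (simp add: mult_ac)
  qed
  let ?c = "1 / (2 * real D * (real n)\<^sup>2 * r\<^sup>2)" and ?c' = "1 / (48 * (real n)\<^sup>2 * \<eta>\<^sup>2)"
  let ?l = "\<lambda>p. mon_eval n (snd p) x" and ?l' = "\<lambda>p. 1 / sqrt (real (d i)) * ?D (mon_grad n (snd p) x) w"
  let ?s = "L2_set x {..n}"
  have c0: "0 \<le> ?c" "0 \<le> ?c'" by auto
  note K = blk_kernels(1)[where d=d and j=i and n=n and x=x, OF di(1)]
    blk_kernels(2,3)[where d=d and j=i and n=n and x=x and u=w, OF di(1)]
  have "(\<integral>\<^sup>+z. ennreal (exp (- ((eval_form n (d i) (fs z i) x)\<^sup>2 / (2 * real D * (real n)\<^sup>2 * r\<^sup>2)) / 2) *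
      (if gI0 n \<eta> r i b \<le> exp 1 * gI1 n \<eta> r i (b(i := rowv n d (fs z) x i)) then 1 else 0)) \<partial>gm (blk n d i) (vr n d))
    \<le> (\<integral>\<^sup>+z. ennreal 2 * ennreal (exp (- (?c * (dotp (blk n d i) ?l z)\<^sup>2) / 2 - ?c' * (dotp (blk n d i) ?l' z)\<^sup>2 / 2)) \<partial>gm (blk n d i) (vr n d))"
  proof (intro nn_integral_mono)
    fix z
    let ?Y = "(dotp (blk n d i) ?l' z)\<^sup>2"
    have Y: "?Y = (?D (rowv n d (fs z) x i) w)\<^sup>2" by (simp add: dotp_rowv_blk)
    let ?E = "exp (- (?c * (dotp (blk n d i) ?l z)\<^sup>2) / 2)"
    have "?E * (if gI0 n \<eta> r i b \<le> exp 1 * gI1 n \<eta> r i (b(i := rowv n d (fs z) x i)) then 1 else 0) \<le>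
       ?E * (2 * exp (- (?c' * ?Y) / 2))"
    proof (intro mult_left_mono)
      \<comment> \<open>The indicator is traded for a Gaussian factor: \<open>?c'\<close> makes the
        exponent at least \<open>- 1 / 2\<close> on the event, and
        \<open>2 * exp (- 1 / 2) \<ge> 1\<close>.\<close>
      show "(if gI0 n \<eta> r i b \<le> exp 1 * gI1 n \<eta> r i (b(i := rowv n d (fs z) x i)) then 1 else 0) \<le> 2 * exp (- (?c' * ?Y) / 2)"
      proof (cases "gI0 n \<eta> r i b \<le> exp 1 * gI1 n \<eta> r i (b(i := rowv n d (fs z) x i))")
        case True
        have "?c' * ?Y \<le> 1" unfolding Y using small[OF True] n0 \<eta> by (simp add: divide_le_eq)
        moreover have "1 \<le> 2 * exp (- t / 2)" if "t \<le> 1" for t :: real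
          using that exp_ge_add_one_self[of "- t / 2"] by simp
        ultimately show ?thesis using True by (simp only: if_True)
      qed simp
    qed simp
    also have "\<dots> = 2 * exp (- (?c * (dotp (blk n d i) ?l z)\<^sup>2) / 2 - ?c' * ?Y / 2)"
      by (simp add: exp_add[symmetric])
    finally show "ennreal (exp (- ((eval_form n (d i) (fs z i) x)\<^sup>2 / (2 * real D * (real n)\<^sup>2 * r\<^sup>2)) / 2) *
      (if gI0 n \<eta> r i b \<le> exp 1 * gI1 n \<eta> r i (b(i := rowv n d (fs z) x i)) then 1 else 0)) \<le>
      ennreal 2 * ennreal (exp (- (?c * (dotp (blk n d i) ?l z)\<^sup>2) / 2 - ?c' * ?Y / 2))"
      by (subst ennreal_mult[symmetric]) (auto intro!: ennreal_leI simp: eval_form_blk)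
  qed
  also have "\<dots> = ennreal 2 * (\<integral>\<^sup>+z. ennreal (exp (- (?c * (dotp (blk n d i) ?l z)\<^sup>2) / 2 - ?c' * (dotp (blk n d i) ?l' z)\<^sup>2 / 2)) \<partial>gm (blk n d i) (vr n d))"
    by (intro nn_integral_cmult) measurable
  \<comment> \<open>Orthogonality of \<open>w\<close> and \<open>x\<close> makes the covariance
    vanish, so the mean factors into a part of order \<open>r\<close> and a part of order
    \<open>\<eta>\<close>.\<close>
  also have "\<dots> = ennreal 2 * ennreal (1 / (sqrt (1 + ?c * ?D x x ^ d i) * sqrt (1 + ?c' * ?D x x ^ (d i - 1))))"
    using nn_integral_gm_exp2(2)[where A="blk n d i" and v="vr n d" and l="?l" and l'="?l'" and c="?c" and c'="?c'", OF finite_blk vr_pos c0]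
    unfolding K xw ww by simp
  also have "\<dots> = ennreal (2 * (1 / (sqrt (1 + ?c * ?D x x ^ d i) * sqrt (1 + ?c' * ?D x x ^ (d i - 1)))))"
    by (rule ennreal_mult'[symmetric]) simp
  also have "\<dots> \<le> ennreal (80 * real D * (real n)\<^sup>2 * r * \<eta>)"
  proof (rule ennreal_leI)
    have gen: "1 / sqrt (1 + cc * ?D x x ^ k) \<le> 2 / sqrt cc" if "0 < cc" "k \<le> D" for cc k
    proof -
      have sk: "0 < ?s ^ k" "1 / ?s ^ k \<le> 1 + 1 / real n"
        using inverse_norm_power_le[OF n d r l x that(2)] by auto
      have "sqrt (cc * ?D x x ^ k) = sqrt cc * ?s ^ k"
        using L2_set_nonneg[of x "{..n}"]
        by (simp add: dotp_self real_sqrt_mult real_sqrt_power)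
      moreover have "sqrt (cc * ?D x x ^ k) \<le> sqrt (1 + cc * ?D x x ^ k)" by simp
      ultimately have le: "sqrt cc * ?s ^ k \<le> sqrt (1 + cc * ?D x x ^ k)" by simp
      have p: "0 < sqrt cc * ?s ^ k" using that sk by simp
      have "1 / sqrt (1 + cc * ?D x x ^ k) \<le> 1 / (sqrt cc * ?s ^ k)"
        by (rule divide_left_mono[OF le]) (use mult_pos_pos[OF less_le_trans[OF p le] p] in simp_all)
      also have "\<dots> = (1 / ?s ^ k) / sqrt cc" by simp
      also have "\<dots> \<le> 2 / sqrt cc"
      proof (intro divide_right_mono)
        have "1 / real n \<le> 1" using n0 by simp
        then show "1 / ?s ^ k \<le> 2" using sk by linarith
      qed (use that in simp)
      finally show ?thesis .
    qed
    have cp: "0 < ?c" "0 < ?c'" using D1 n0 r \<eta> by auto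
    have "1 / (sqrt (1 + ?c * ?D x x ^ d i) * sqrt (1 + ?c' * ?D x x ^ (d i - 1))) =
       (1 / sqrt (1 + ?c * ?D x x ^ d i)) * (1 / sqrt (1 + ?c' * ?D x x ^ (d i - 1)))" by simp
    also have "\<dots> \<le> (2 / sqrt ?c) * (2 / sqrt ?c')"
      using di cp by (intro mult_mono gen) (auto intro!: divide_nonneg_nonneg add_nonneg_nonneg mult_nonneg_nonneg simp: dotp_self)
    also have "\<dots> = 4 * (sqrt (2 * real D) * real n * r) * (sqrt 48 * real n * \<eta>)"
      using n0 r \<eta> by (simp add: real_sqrt_divide real_sqrt_mult)
    also have "\<dots> \<le> 4 * ((10 / 7 * real D) * real n * r) * (7 * real n * \<eta>)"
    proof -
      have s2: "sqrt 2 \<le> 10 / 7" by (rule real_le_lsqrt) (auto simp: power2_eq_square)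
      have sD: "sqrt (real D) \<le> real D" using D1 self_le_power[of "real D" 2] by (intro real_le_lsqrt) auto
      have "sqrt (2 * real D) \<le> 10 / 7 * real D"
        unfolding real_sqrt_mult using s2 sD by (intro mult_mono) auto
      moreover have "sqrt 48 \<le> 7" by (rule real_le_lsqrt) auto
      ultimately show ?thesis using r \<eta> by (intro mult_mono) auto
    qed
    also have "\<dots> = 40 * real D * (real n)\<^sup>2 * r * \<eta>" by (simp add: power2_eq_square)
    finally show "2 * (1 / (sqrt (1 + ?c * ?D x x ^ d i) * sqrt (1 + ?c' * ?D x x ^ (d i - 1)))) \<le> 80 * real D * (real n)\<^sup>2 * r * \<eta>"
      by simp
  qed
  finally show ?thesis .
qed

text \<open>The block of row \<open>i\<close> is integrated first, with the other blocks fixed. What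
  remains is the mean of the square root of a determinant against the cut-offs, the inverse volume
  being \<open>sqrt psi / (2 * pi) ^ ((n + 1) / 2)\<close>.\<close>

lemma wt_expectation:
  assumes i: "i < n"
  defines "L \<equiv> {..<n} - {i}"
  shows "(\<integral>\<^sup>+c. ennreal (wt n d D \<eta> r i (rowv n d (fs c) x) (\<lambda>j. eval_form n (d j) (fs c j) x)) \<partial>gm (blks n d {..<n}) (vr n d))
    \<le> ennreal (80 * real D * (real n)\<^sup>2 * r * \<eta> * ((\<Prod>j\<in>L. phic j) *
       sqrt (qrec ((\<eta> / r)\<^sup>2) thc (n - 1) (Suc n)) / sqrt ((2 * pi) ^ Suc n)))"
proof -
  interpret G: product_prob_space "\<lambda>a. gauss (vr n d a)"
    by (rule product_prob_space_gm[OF vr_pos])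
  let ?Q = "qrec ((\<eta> / r)\<^sup>2) thc (n - 1) (Suc n)"
  let ?s = "(\<eta> / r)\<^sup>2"
  have s: "0 < ?s" using r \<eta> by simp
  have Q: "0 < ?Q" using s by (intro qrec_pos) auto
  have L: "finite L" "L \<subseteq> {..<n}" "i \<notin> L" "insert i L = {..<n}" "card L = n - 1"
    using i by (auto simp: L_def)
  let ?GL = "gm (blks n d L) (vr n d)" and ?Gi = "gm (blk n d i) (vr n d)"
  let ?P = "\<lambda>c. \<Prod>k\<in>L. Phiv n d r x k c"
  let ?psi = "\<lambda>c. psi {..n} (\<lambda>_. ?s) L (rw c)"
  let ?C = "80 * real D * (real n)\<^sup>2 * r * \<eta>"
  let ?W = "\<lambda>c. wt n d D \<eta> r i (rowv n d (fs c) x) (\<lambda>j. eval_form n (d j) (fs c j) x)"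
  have C0: "0 \<le> ?C" using r \<eta> by simp
  have P0: "0 \<le> ?P y" for y by (intro prod_nonneg) (simp add: Phiv_nonneg)
  have g0: "0 < gI0 n \<eta> r i b" for b unfolding gI0_def using s by (intro gI_pos) auto
  have inv: "1 / gI0 n \<eta> r i (rowv n d (fs c) x) = sqrt (?psi c) / sqrt ((2 * pi) ^ Suc n)" for c
  proof -
    have "sqrt (?psi c) = sqrt ((2 * pi) ^ Suc n) / gI0 n \<eta> r i (rowv n d (fs c) x)"
      unfolding psi_def gI0_def[symmetric] using g0[of "rowv n d (fs c) x"]
      by (simp add: gI0_def L_def real_sqrt_divide)
    then show ?thesis using g0[of "rowv n d (fs c) x"] by simp
  qed
  have Pexp: "?P c = exp (- (\<Sum>j\<in>L. (eval_form n (d j) (fs c j) x)\<^sup>2 / (real (d j) * r\<^sup>2)) / 2)" for c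
    unfolding Phiv_def exp_sum[OF L(1), symmetric]
    by (simp add: sum_negf sum_divide_distrib)
  have Phim: "(\<lambda>c. Phiv n d r x k c) \<in> borel_measurable ?GL" if "k \<in> L" for k
    using Phiv_measurable_gm[OF that] .
  have Pm: "?P \<in> borel_measurable ?GL"
    using Phim by (intro borel_measurable_prod) auto
  have psim: "?psi \<in> borel_measurable ?GL"
    by (intro psi_measurable borel_measurable_times borel_measurable_const rowv_measurable_gm) auto
  have Wm: "(\<lambda>c. ennreal (?W c)) \<in> borel_measurable (gm (blks n d L \<union> blk n d i) (vr n d))"
    unfolding blks_insert[symmetric] L(4)
    by (rule measurable_compose[OF _ measurable_ennreal], rule wt_measurable[OF _ _ i],
        rule rowv_measurable_gm, simp, rule eval_form_measurable_gm, simp)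
  have inner: "(\<integral>\<^sup>+z. ennreal (?W (merge (blks n d L) (blk n d i) (y, z))) \<partial>?Gi) \<le>
     ennreal (sqrt (?psi y) / sqrt ((2 * pi) ^ Suc n) * ?P y) * ennreal ?C" for y
  proof -
    let ?b = "rowv n d (fs y) x"
    let ?h = "\<lambda>z. exp (- ((eval_form n (d i) (fs z i) x)\<^sup>2 / (2 * real D * (real n)\<^sup>2 * r\<^sup>2)) / 2) *
      (if gI0 n \<eta> r i ?b \<le> exp 1 * gI1 n \<eta> r i (?b(i := rowv n d (fs z) x i)) then 1 else (0::real))"
    have sp: "?W (merge (blks n d L) (blk n d i) (y, z)) = (sqrt (?psi y) / sqrt ((2 * pi) ^ Suc n) * ?P y) * ?h z" for z
    proof -
      let ?m = "merge (blks n d L) (blk n d i) (y, z)"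
      have 1: "eval_form n (d k) (fs ?m k) x = eval_form n (d k) (fs y k) x" if "k \<in> L" for k
        by (rule eval_form_cong) (rule fs_merge(1)[OF _ that L(3)])
      have 2: "eval_form n (d i) (fs ?m i) x = eval_form n (d i) (fs z i) x"
        by (rule eval_form_cong) (rule fs_merge(2)[OF _ L(3) refl])
      have 3: "rowv n d (fs ?m) x k = rowv n d (fs y) x k" if "k \<in> L" for k
        by (rule rowv_cong) (rule fs_merge(1)[OF _ that L(3)])
      have 4: "rowv n d (fs ?m) x i = rowv n d (fs z) x i"
        by (rule rowv_cong) (rule fs_merge(2)[OF _ L(3) refl])
      have 5: "gI0 n \<eta> r i (rowv n d (fs ?m) x) = gI0 n \<eta> r i ?b"
        unfolding gI0_def gI_def
        by (intro arg_cong[where f=enn2real] gint_row_cong) (use 3 in \<open>auto simp: L_def\<close>)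
      have 6: "gI1 n \<eta> r i (rowv n d (fs ?m) x) = gI1 n \<eta> r i (?b(i := rowv n d (fs z) x i))"
        unfolding gI1_def gI_def
        by (intro arg_cong[where f=enn2real] gint_row_cong) (use 3 4 in \<open>auto simp: L_def\<close>)
      have 7: "(\<Sum>j\<in>L. (eval_form n (d j) (fs ?m j) x)\<^sup>2 / (real (d j) * r\<^sup>2)) =
        (\<Sum>j\<in>L. (eval_form n (d j) (fs y j) x)\<^sup>2 / (real (d j) * r\<^sup>2))"
        by (intro sum.cong) (auto simp: 1)
      show ?thesis
        unfolding wt_def L_def[symmetric] 7 5 6 2 inv Pexp by simp
    qed
    have hm: "(\<lambda>z. ennreal (?h z)) \<in> borel_measurable ?Gi"
    proof -
      note [measurable] = eval_form_measurable_gm_blk[where j=i and d=d and n=n and x=x and v="vr n d"]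
      have [measurable]: "(\<lambda>z. gI1 n \<eta> r i (?b(i := rowv n d (fs z) x i))) \<in> borel_measurable ?Gi"
        unfolding gI1_def
      proof (intro gI_measurable borel_measurable_times borel_measurable_const)
        fix j a
        show "(\<lambda>z. (?b(i := rowv n d (fs z) x i)) j a) \<in> borel_measurable ?Gi"
        proof (cases "j = i")
          case True
          then show ?thesis
            by (simp add: rowv_measurable_gm_blk)
        qed simp
      qed simp
      show ?thesis by measurable
    qed
    have k0: "0 \<le> sqrt (?psi y) / sqrt ((2 * pi) ^ Suc n) * ?P y"
      using P0[of y] by (intro mult_nonneg_nonneg) (auto simp: psi_def)
    have "(\<integral>\<^sup>+z. ennreal (?W (merge (blks n d L) (blk n d i) (y, z))) \<partial>?Gi) =
      (\<integral>\<^sup>+z. ennreal (sqrt (?psi y) / sqrt ((2 * pi) ^ Suc n) * ?P y) * ennreal (?h z) \<partial>?Gi)"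
      unfolding sp using k0 by (simp only: ennreal_mult')
    also have "\<dots> = ennreal (sqrt (?psi y) / sqrt ((2 * pi) ^ Suc n) * ?P y) * (\<integral>\<^sup>+z. ennreal (?h z) \<partial>?Gi)"
      by (rule nn_integral_cmult[OF hm])
    also have "\<dots> \<le> ennreal (sqrt (?psi y) / sqrt ((2 * pi) ^ Suc n) * ?P y) * ennreal ?C"
      by (intro mult_left_mono distinguished_row[OF i]) simp
    finally show ?thesis .
  qed
  \<comment> \<open>A linear majorant of the square root, touching it at \<open>?Q\<close>, the
    bound for the determinant per unit mass of the cut-offs. It does the work of
    Cauchy-Schwarz.\<close>
  have amgm: "sqrt p \<le> 1 / 2 * (1 / sqrt ?Q * p + sqrt ?Q)" if "0 \<le> p" for p
  proof -
    have "0 \<le> (sqrt p - sqrt ?Q)\<^sup>2" by simp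
    then have "2 * sqrt p * sqrt ?Q \<le> p + ?Q" using that Q by (simp add: power2_diff)
    then have "2 * sqrt p \<le> (p + ?Q) / sqrt ?Q" using Q by (simp add: le_divide_eq)
    also have "\<dots> = 1 / sqrt ?Q * p + sqrt ?Q" using Q by (simp add: add_divide_distrib real_div_sqrt)
    finally show ?thesis by simp
  qed
  let ?p = "\<Prod>j\<in>L. phic j"
  have p0: "0 \<le> ?p" using r by (intro prod_nonneg) auto
  have main: "(\<integral>\<^sup>+y. ennreal (sqrt (?psi y) * ?P y) \<partial>?GL) \<le> ennreal (?p * sqrt ?Q)"
  proof -
    have "(\<integral>\<^sup>+y. ennreal (sqrt (?psi y) * ?P y) \<partial>?GL) \<le>
      (\<integral>\<^sup>+y. ennreal (1 / (2 * sqrt ?Q)) * ennreal (?P y * ?psi y) + ennreal (sqrt ?Q / 2) * ennreal (?P y * psi {} (\<lambda>_. ?s) L (rw y)) \<partial>?GL)"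
    proof (intro nn_integral_mono)
      fix y
      have ps: "0 \<le> ?psi y" by (simp add: psi_def)
      have "sqrt (?psi y) * ?P y \<le> 1 / 2 * (1 / sqrt ?Q * ?psi y + sqrt ?Q) * ?P y"
        by (intro mult_right_mono amgm ps P0)
      also have "\<dots> = 1 / (2 * sqrt ?Q) * (?P y * ?psi y) + sqrt ?Q / 2 * (?P y * psi {} (\<lambda>_. ?s) L (rw y))"
        by (simp add: psi_empty algebra_simps)
      finally show "ennreal (sqrt (?psi y) * ?P y) \<le>
        ennreal (1 / (2 * sqrt ?Q)) * ennreal (?P y * ?psi y) + ennreal (sqrt ?Q / 2) * ennreal (?P y * psi {} (\<lambda>_. ?s) L (rw y))"
        using Q P0[of y] ps
        by (simp add: ennreal_mult[symmetric] ennreal_plus[symmetric] psi_empty ennreal_leI del: ennreal_plus)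
    qed
    also have "\<dots> = ennreal (1 / (2 * sqrt ?Q)) * (\<integral>\<^sup>+y. ennreal (?P y * ?psi y) \<partial>?GL) +
        ennreal (sqrt ?Q / 2) * (\<integral>\<^sup>+y. ennreal (?P y * psi {} (\<lambda>_. ?s) L (rw y)) \<partial>?GL)"
    proof -
      have m1: "(\<lambda>y. ennreal (?P y * ?psi y)) \<in> borel_measurable ?GL"
        by (rule measurable_compose[OF _ measurable_ennreal], rule borel_measurable_times[OF Pm psim])
      have m2: "(\<lambda>y. ennreal (?P y * psi {} (\<lambda>_. ?s) L (rw y))) \<in> borel_measurable ?GL"
        unfolding psi_empty mult_1_right by (rule measurable_compose[OF Pm measurable_ennreal])
      show ?thesis
        by (simp only: nn_integral_add[OF borel_measurable_times_ennreal[OF borel_measurable_const m1]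
            borel_measurable_times_ennreal[OF borel_measurable_const m2]] nn_integral_cmult[OF m1] nn_integral_cmult[OF m2])
    qed
    \<comment> \<open>In the empty set of coordinates the determinant is 1, so the same lemma also
      bounds the mean of the product of cut-offs.\<close>
    also have "\<dots> \<le> ennreal (1 / (2 * sqrt ?Q)) * ennreal (?p * qrec ?s thc (card L) (card {..n})) +
        ennreal (sqrt ?Q / 2) * ennreal (?p * qrec ?s thc (card L) (card ({} :: nat set)))"
      by (intro add_mono mult_left_mono psi_expectation L s) auto
    also have "\<dots> = ennreal (?p * sqrt ?Q)"
    proof -
      have "1 / (2 * sqrt ?Q) * (?p * ?Q) + sqrt ?Q / 2 * ?p = ?p * sqrt ?Q"
        using Q by (simp add: field_simps)
      then show ?thesis using p0 Q L(5)
        by (simp add: qrec_zero ennreal_mult[symmetric] ennreal_plus[symmetric] del: ennreal_plus qrec.simps)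
    qed
    finally show ?thesis .
  qed
  have "(\<integral>\<^sup>+c. ennreal (?W c) \<partial>gm (blks n d {..<n}) (vr n d)) =
     (\<integral>\<^sup>+y. \<integral>\<^sup>+z. ennreal (?W (merge (blks n d L) (blk n d i) (y, z))) \<partial>?Gi \<partial>?GL)"
    using G.product_nn_integral_fold[OF blks_disjoint[OF L(3)] finite_blks[OF L(1)] finite_blk Wm]
    unfolding blks_insert[symmetric] L(4) .
  also have "\<dots> \<le> (\<integral>\<^sup>+y. ennreal (sqrt (?psi y) / sqrt ((2 * pi) ^ Suc n) * ?P y) * ennreal ?C \<partial>?GL)"
    by (intro nn_integral_mono inner)
  also have "\<dots> = (\<integral>\<^sup>+y. ennreal (?C / sqrt ((2 * pi) ^ Suc n)) * ennreal (sqrt (?psi y) * ?P y) \<partial>?GL)"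
  proof (intro nn_integral_cong)
    fix y
    have ps: "0 \<le> ?psi y" by (simp add: psi_def)
    have e: "ennreal (a / t * p) * ennreal c = ennreal (c / t) * ennreal (a * p)" if "0 \<le> a" "0 < t" "0 \<le> p" "0 \<le> c" for a t p c :: real
      using that by (simp add: ennreal_mult[symmetric] mult_ac)
    show "ennreal (sqrt (?psi y) / sqrt ((2 * pi) ^ Suc n) * ?P y) * ennreal ?C =
      ennreal (?C / sqrt ((2 * pi) ^ Suc n)) * ennreal (sqrt (?psi y) * ?P y)"
      by (rule e) (use ps P0 C0 in auto)
  qed
  also have "\<dots> = ennreal (?C / sqrt ((2 * pi) ^ Suc n)) * (\<integral>\<^sup>+y. ennreal (sqrt (?psi y) * ?P y) \<partial>?GL)"
  proof (rule nn_integral_cmult)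
    have "(\<lambda>y. sqrt (?psi y)) \<in> borel_measurable ?GL" by (rule measurable_compose[OF psim borel_measurable_sqrt])
    then show "(\<lambda>y. ennreal (sqrt (?psi y) * ?P y)) \<in> borel_measurable ?GL"
      by (intro measurable_compose[OF _ measurable_ennreal] borel_measurable_times[OF _ Pm])
  qed
  also have "\<dots> \<le> ennreal (?C / sqrt ((2 * pi) ^ Suc n)) * ennreal (?p * sqrt ?Q)"
    by (intro mult_left_mono main) simp
  also have "\<dots> = ennreal (?C / sqrt ((2 * pi) ^ Suc n) * (?p * sqrt ?Q))"
    using C0 by (intro ennreal_mult'[symmetric] divide_nonneg_nonneg) auto
  also have "?C / sqrt ((2 * pi) ^ Suc n) * (?p * sqrt ?Q) = ?C * (?p * sqrt ?Q / sqrt ((2 * pi) ^ Suc n))"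
    by simp
  finally show ?thesis .
qed

end

subsection \<open>Volume of a spherical shell\<close>

lemma L2_set_measurable_lam [measurable]: "(\<lambda>u. L2_set u {..n}) \<in> borel_measurable (lam {..n})"
  unfolding L2_set_def by measurable

definition ballvol :: "nat \<Rightarrow> real \<Rightarrow> ennreal" where
  "ballvol n R = (\<integral>\<^sup>+u. indicator {u. L2_set u {..n} \<le> R} u \<partial>lam {..n})"

lemma ballvol_scale:
  assumes "0 < R"
  shows "ballvol n R = ennreal (R ^ Suc n) * ballvol n 1"
proof -
  have "ballvol n R = ennreal (\<bar>R\<bar> ^ card {..n}) *
    (\<integral>\<^sup>+u. indicator {u. L2_set u {..n} \<le> R} (\<lambda>a\<in>{..n}. 0 + R * u a) \<partial>lam {..n})"
    unfolding ballvol_def using assms by (intro nn_integral_lam_affine) (auto, measurable)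
  also have "(\<integral>\<^sup>+u. indicator {u. L2_set u {..n} \<le> R} (\<lambda>a\<in>{..n}. 0 + R * u a) \<partial>lam {..n}) = ballvol n 1"
    unfolding ballvol_def
  proof (intro nn_integral_cong)
    fix u :: "nat \<Rightarrow> real"
    have "L2_set (\<lambda>a\<in>{..n}. 0 + R * u a) {..n} = L2_set (\<lambda>a. R * u a) {..n}"
      by (intro L2_set_cong) auto
    also have "\<dots> = R * L2_set u {..n}" using assms by (intro L2_set_right_distrib[symmetric]) auto
    finally show "indicator {u. L2_set u {..n} \<le> R} (\<lambda>a\<in>{..n}. 0 + R * u a) = (indicator {u. L2_set u {..n} \<le> 1} u :: ennreal)"
      using assms by (simp add: indicator_def mult_le_cancel_left1)
  qed
  finally show ?thesis using assms by simp
qed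

text \<open>The indicator of the unit ball is below \<open>exp (m / 2)\<close> times the Gaussian
  with exponent \<open>- m / 2\<close> times the squared length. The choice \<open>m = n + 1\<close>
  gives the correct exponential order of the volume.\<close>

lemma ballvol_le: "ballvol n 1 \<le> ennreal (exp (real (Suc n) / 2) * sqrt (2 * pi / real (Suc n)) ^ Suc n)"
proof -
  let ?m = "real (Suc n)"
  let ?g = "(\<lambda>_ _. 0) :: nat \<Rightarrow> nat \<Rightarrow> real"
  have "ballvol n 1 \<le> (\<integral>\<^sup>+u. ennreal (exp (?m / 2)) * ennreal (exp (- bform {..n} (\<lambda>_. ?m) {} ?g u u / 2)) \<partial>lam {..n})"
    unfolding ballvol_def
  proof (intro nn_integral_mono)
    fix u :: "nat \<Rightarrow> real"
    have B: "bform {..n} (\<lambda>_. ?m) {} ?g u u = ?m * (L2_set u {..n})\<^sup>2"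
      by (simp add: bform_def L2_set_def sum_nonneg power2_eq_square sum_distrib_left mult.assoc)
    show "indicator {u. L2_set u {..n} \<le> 1} u \<le> ennreal (exp (?m / 2)) * ennreal (exp (- bform {..n} (\<lambda>_. ?m) {} ?g u u / 2))"
    proof (cases "L2_set u {..n} \<le> 1")
      case True
      then have "(L2_set u {..n})\<^sup>2 \<le> 1" using L2_set_nonneg[of u "{..n}"] by (simp add: power_le_one)
      then have "?m * (L2_set u {..n})\<^sup>2 \<le> ?m * 1" by (intro mult_left_mono) auto
      then have "0 \<le> ?m / 2 + - bform {..n} (\<lambda>_. ?m) {} ?g u u / 2" unfolding B by linarith
      then have "1 \<le> exp (?m / 2 + - bform {..n} (\<lambda>_. ?m) {} ?g u u / 2)" by simp
      then have "1 \<le> exp (?m / 2) * exp (- bform {..n} (\<lambda>_. ?m) {} ?g u u / 2)" unfolding exp_add .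
      then show ?thesis using True by (subst ennreal_mult[symmetric]) auto
    qed simp
  qed
  also have "\<dots> = ennreal (exp (?m / 2)) * gint {..n} (\<lambda>_. ?m) {} ?g"
    unfolding gint_def by (intro nn_integral_cmult) measurable
  also have "gint {..n} (\<lambda>_. ?m) {} ?g = ennreal (\<Prod>a\<in>{..n}. sqrt (2 * pi / ?m))"
    by (intro gint_base) auto
  also have "(\<Prod>a\<in>{..n}. sqrt (2 * pi / ?m)) = sqrt (2 * pi / ?m) ^ Suc n"
    by (simp only: prod_constant card_atMost)
  also have "ennreal (exp (?m / 2)) * ennreal (sqrt (2 * pi / ?m) ^ Suc n) = ennreal (exp (?m / 2) * sqrt (2 * pi / ?m) ^ Suc n)"
    by (intro ennreal_mult[symmetric]) auto
  finally show ?thesis .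
qed

text \<open>The closed shell and the ball of radius \<open>1 - 2 * l\<close> are disjoint and lie in
  the ball of radius \<open>1 + l\<close>. A radius \<open>1 - l\<close> would let the two sets meet
  in a sphere.\<close>

lemma shell_volume:
  assumes l: "0 < l" "2 * l * real (Suc n) \<le> 1"
  shows "(\<integral>\<^sup>+u. indicator {u. \<bar>L2_set u {..n} - 1\<bar> \<le> l} u \<partial>lam {..n}) \<le>
    ennreal (4 * l * real (Suc n) * (exp (real (Suc n) / 2) * sqrt (2 * pi / real (Suc n)) ^ Suc n))"
proof -
  let ?m = "real (Suc n)" and ?K = "exp (real (Suc n) / 2) * sqrt (2 * pi / real (Suc n)) ^ Suc n"
  let ?S = "\<integral>\<^sup>+u. indicator {u. \<bar>L2_set u {..n} - 1\<bar> \<le> l} u \<partial>lam {..n}"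
  have "ballvol n 1 < top" using ballvol_le[of n] by (simp add: le_less_trans[OF _ ennreal_less_top])
  then obtain v where v: "0 \<le> v" "ballvol n 1 = ennreal v" by (cases "ballvol n 1") auto
  have vK: "v \<le> ?K" using ballvol_le[of n] unfolding v(2) by (simp add: ennreal_le_iff)
  have l1: "2 * l \<le> 2 * l * ?m" using l by simp
  have lh: "2 * l \<le> 1" using l l1 by linarith
  have "?S + ballvol n (1 - 2 * l) = (\<integral>\<^sup>+u. indicator {u. \<bar>L2_set u {..n} - 1\<bar> \<le> l} u + indicator {u. L2_set u {..n} \<le> 1 - 2 * l} u \<partial>lam {..n})"
    unfolding ballvol_def by (intro nn_integral_add[symmetric]) measurable
  also have "\<dots> \<le> ballvol n (1 + l)"
    unfolding ballvol_def using l by (intro nn_integral_mono) (auto simp: indicator_def abs_if split: if_splits)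
  also have "\<dots> = ennreal ((1 + l) ^ Suc n * v)"
    using l v by (subst ballvol_scale) (auto simp: ennreal_mult)
  finally have S1: "?S + ballvol n (1 - 2 * l) \<le> ennreal ((1 + l) ^ Suc n * v)" .
  have S2: "ennreal ((1 - 2 * l) ^ Suc n * v) \<le> ballvol n (1 - 2 * l)"
  proof (cases "2 * l < 1")
    case True
    then show ?thesis using v by (subst ballvol_scale) (auto simp: ennreal_mult)
  next
    case False
    then have "1 - 2 * l = 0" using lh by linarith
    then show ?thesis by simp
  qed
  have "?S < top"
    using S1 by (meson add_increasing2 ennreal_less_top le_less_trans order.trans zero_le order_refl le_add_same_cancel1 le_iff_add)
  then obtain sv where sv: "0 \<le> sv" "?S = ennreal sv" by (cases ?S) auto
  have "ennreal (sv + (1 - 2 * l) ^ Suc n * v) = ?S + ennreal ((1 - 2 * l) ^ Suc n * v)"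
    using sv v lh by (simp add: ennreal_plus[symmetric] del: ennreal_plus power_Suc)
  also have "\<dots> \<le> ennreal ((1 + l) ^ Suc n * v)"
    using add_left_mono[OF S2, of ?S] S1 by (rule order.trans)
  finally have "sv + (1 - 2 * l) ^ Suc n * v \<le> (1 + l) ^ Suc n * v"
    using v l by (subst (asm) ennreal_le_iff) auto
  then have "sv \<le> ((1 + l) ^ Suc n - (1 - 2 * l) ^ Suc n) * v" by (simp add: algebra_simps)
  also have "\<dots> \<le> (4 * l * ?m) * ?K"
  proof (intro mult_mono vK v)
    have "(1 + l) ^ Suc n \<le> exp l ^ Suc n" using l by (intro power_mono exp_ge_add_one_self) auto
    also have "\<dots> = exp (?m * l)" by (simp only: exp_of_nat_mult)
    also have "\<dots> \<le> 1 + ?m * l + (?m * l)\<^sup>2"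
    proof (rule exp_bound)
      show "0 \<le> ?m * l" using l by simp
      show "?m * l \<le> 1" using l(2) by (simp only: mult_ac)
    qed
    also have "\<dots> \<le> 1 + 2 * (?m * l)"
    proof -
      have "?m * l \<le> 1" using l(2) by (simp only: mult_ac; linarith)
      moreover have "0 \<le> ?m * l" using l by simp
      ultimately have "(?m * l)\<^sup>2 \<le> ?m * l" unfolding power2_eq_square by (intro mult_left_le_one_le)
      then show ?thesis by linarith
    qed
    finally have a: "(1 + l) ^ Suc n \<le> 1 + 2 * (?m * l)" .
    have "1 - ?m * (2 * l) \<le> (1 - 2 * l) ^ Suc n"
      using Bernoulli_inequality[of "- (2 * l)" "Suc n"] lh by simp
    with a show "(1 + l) ^ Suc n - (1 - 2 * l) ^ Suc n \<le> 4 * l * ?m"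
      by (simp only: mult_ac; linarith)
  qed (use l in auto)
  finally show ?thesis unfolding sv(2) by (rule ennreal_leI)
qed

lemma sqrt_prod: "sqrt (\<Prod>j\<in>A. f j) = (\<Prod>j\<in>A. sqrt (f j))"
  by (induction A rule: infinite_finite_induct) (auto simp: real_sqrt_mult)

text \<open>Stirling's upper bound with the exact exponential part and a polynomial loss; a cruder
  base would leave an exponential factor in the final estimate.\<close>

lemma fact_le_power:
  assumes "1 \<le> m"
  shows "fact m \<le> exp 1 * real m * (real m / exp 1) ^ m"
  using assms
proof (induction m rule: dec_induct)
  case base
  show ?case by simp
next
  case (step m)
  then have m0: "0 < real m" by simp
  let ?k = "real (Suc m)"
  have "1 - 1 / ?k \<le> exp (- (1 / ?k))" using exp_ge_add_one_self[of "- (1 / ?k)"] by simp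
  then have "real m / ?k \<le> exp (- (1 / ?k))" by (simp add: field_simps)
  then have "(real m / ?k) ^ Suc m \<le> exp (- (1 / ?k)) ^ Suc m" using m0 by (intro power_mono) auto
  also have "\<dots> = exp (- 1)" by (simp add: exp_of_nat_mult[symmetric] del: power_Suc of_nat_Suc)
  finally have "real m ^ Suc m / ?k ^ Suc m \<le> exp (- 1)" by (simp only: power_divide)
  then have "real m ^ Suc m \<le> exp (- 1) * ?k ^ Suc m" by (simp add: divide_le_eq del: power_Suc of_nat_Suc)
  then have k: "real m * (real m / exp 1) ^ m \<le> (?k / exp 1) ^ Suc m"
    by (simp add: power_divide exp_minus field_simps del: of_nat_Suc)
  have "(fact (Suc m) :: real) = ?k * fact m" by simp
  also have "\<dots> \<le> ?k * (exp 1 * real m * (real m / exp 1) ^ m)" by (intro mult_left_mono step.IH) auto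
  also have "\<dots> = exp 1 * ?k * (real m * (real m / exp 1) ^ m)" by (simp only: mult_ac)
  also have "\<dots> \<le> exp 1 * ?k * (?k / exp 1) ^ Suc m" by (intro mult_left_mono k) auto
  finally show ?case .
qed

subsection \<open>The integrated weight\<close>

definition Jv :: "nat \<Rightarrow> (nat \<Rightarrow> nat) \<Rightarrow> nat \<Rightarrow> real \<Rightarrow> real \<Rightarrow> real \<Rightarrow> nat \<Rightarrow> (nat \<times> (nat \<Rightarrow> nat) \<Rightarrow> real) \<Rightarrow> ennreal" where
  "Jv n d D \<eta> r l i c = (\<integral>\<^sup>+x. ennreal (wt n d D \<eta> r i (rowv n d (fs c) x) (\<lambda>j. eval_form n (d j) (fs c j) x)) *
     indicator {x. \<bar>L2_set x {..n} - 1\<bar> \<le> l} x \<partial>lam {..n})"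

lemma Jv_integrand_measurable:
  assumes i: "i < n"
  shows "(\<lambda>(c, x). ennreal (wt n d D \<eta> r i (rowv n d (fs c) x) (\<lambda>j. eval_form n (d j) (fs c j) x)) *
     indicator {x. \<bar>L2_set x {..n} - 1\<bar> \<le> l} x) \<in> borel_measurable (gm (blks n d {..<n}) v \<Otimes>\<^sub>M lam {..n})"
proof -
  let ?N = "gm (blks n d {..<n}) v \<Otimes>\<^sub>M lam {..n}"
  have C: "(\<lambda>p. fst p (j, \<alpha>)) \<in> borel_measurable ?N" if "j < n" "\<alpha> \<in> multi_indices n (d j)" for j \<alpha>
    using coef_measurable_gm[of j "{..<n}" \<alpha> n d v] that by (intro measurable_compose[OF measurable_fst]) auto
  have X: "(\<lambda>p. snd p k) \<in> borel_measurable ?N" if "k \<le> n" for k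
    by (rule measurable_compose[OF measurable_snd]) (use that in simp)
  have 1: "(\<lambda>p. wt n d D \<eta> r i (rowv n d (fs (fst p)) (snd p)) (\<lambda>j. eval_form n (d j) (fs (fst p) j) (snd p))) \<in> borel_measurable ?N"
  proof (rule wt_measurable[OF _ _ i])
    fix j k assume j: "j < n"
    show "(\<lambda>p. rowv n d (fs (fst p)) (snd p) j k) \<in> borel_measurable ?N"
      by (rule rowv_measurable[where C=fst and X=snd], rule C[OF j], assumption, rule X)
    show "(\<lambda>p. eval_form n (d j) (fs (fst p) j) (snd p)) \<in> borel_measurable ?N"
      by (rule eval_form_measurable[where C=fst and X=snd], rule C[OF j], assumption, rule X)
  qed
  have "(\<lambda>x. indicator {x. \<bar>L2_set x {..n} - 1\<bar> \<le> l} x :: ennreal) \<in> borel_measurable (lam {..n})"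
    by measurable
  then have 2: "(\<lambda>p. indicator {x. \<bar>L2_set x {..n} - 1\<bar> \<le> l} (snd p) :: ennreal) \<in> borel_measurable ?N"
    by (rule measurable_compose[OF measurable_snd])
  show ?thesis unfolding case_prod_beta
    by (rule borel_measurable_times_ennreal[OF measurable_compose[OF 1 measurable_ennreal] 2])
qed

lemma sigma_finite_lam: "finite A \<Longrightarrow> sigma_finite_measure (lam A)"
proof -
  assume "finite A"
  then interpret finite_product_sigma_finite "\<lambda>_. lborel :: real measure" A by unfold_locales
  show ?thesis by (rule sigma_finite_measure_axioms)
qed

lemma Jv_measurable:
  assumes "i < n"
  shows "Jv n d D \<eta> r l i \<in> borel_measurable (gm (blks n d {..<n}) v)"
  unfolding Jv_def
  by (rule sigma_finite_measure.borel_measurable_nn_integral[OF sigma_finite_lam]) (use Jv_integrand_measurable[OF assms] in auto)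

text \<open>The powers of the scales: the cut-offs give \<open>r ^ (n - 1)\<close>, the root of the
  determinant gives \<open>\<eta>\<^sup>2 / r ^ (n + 1)\<close>, the distinguished row
  \<open>r * \<eta>\<close>, and the shell \<open>l\<close>. The result
  \<open>\<eta> ^ 3 * l / r\<close> equals \<open>4096 * n ^ 5 * z\<^sup>2\<close>, and
  \<open>1310720 = 80 * 4 * 4096\<close>.\<close>

lemma Jv_upper:
  fixes n D :: nat and d :: "nat \<Rightarrow> nat"
  assumes n: "1 \<le> n" and i: "i < n" and d: "\<And>j. j < n \<Longrightarrow> 2 \<le> d j \<and> d j \<le> D"
    and z: "0 < z" and l: "0 < l" and \<eta>: "\<eta> = 32 * (real n)\<^sup>2 * z" and r: "r = 8 * real n * z * l"
    and c1: "4 * (real D)\<^sup>2 * r\<^sup>2 \<le> 1" and c2: "2 * real n * real D * l \<le> 1" and c3: "real n * \<eta>\<^sup>2 \<le> 1"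
  shows "(\<integral>\<^sup>+c. Jv n d D \<eta> r l i c \<partial>gm (blks n d {..<n}) (vr n d)) \<le>
    ennreal (1310720 * exp 4 * real D * real n ^ 7 * (real (Suc n))\<^sup>2 * sqrt (real (\<Prod>j<n. d j)) * z\<^sup>2)"
proof -
  let ?m = "real (Suc n)" and ?L = "{..<n} - {i}"
  have n0: "1 \<le> real n" using n by simp
  have rp: "0 < r" and ep: "0 < \<eta>" using n z l by (simp_all add: r \<eta>)
  interpret G: product_prob_space "\<lambda>a. gauss (vr n d a)"
    by (rule product_prob_space_gm[OF vr_pos])
  interpret GF: finite_product_sigma_finite "\<lambda>a. gauss (vr n d a)" "blks n d {..<n}"
    by unfold_locales simp
  interpret P: pair_sigma_finite "gm (blks n d {..<n}) (vr n d)" "lam {..n}"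
    by (intro pair_sigma_finite.intro GF.sigma_finite_measure_axioms sigma_finite_lam) simp
  let ?th = "exp (1 / real n) / r\<^sup>2"
  let ?Q = "qrec ((\<eta> / r)\<^sup>2) ?th (n - 1) (Suc n)"
  let ?p = "\<Prod>j\<in>?L. sqrt (real (d j)) * r * (1 + 1 / real n)"
  let ?D = "real (\<Prod>j<n. d j)"
  let ?E = "80 * real D * (real n)\<^sup>2 * r * \<eta> * (?p * sqrt ?Q / sqrt ((2 * pi) ^ Suc n))"
  have Q: "sqrt ?Q \<le> exp 2 * sqrt (fact (Suc n)) * \<eta>\<^sup>2 / r ^ Suc n"
  proof -
    \<comment> \<open>Chosen so that \<open>?th * ?y\<close> is the diagonal
      \<open>(\<eta> / r)\<^sup>2\<close>, the form in which \<open>qrec_le\<close> applies;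
      \<open>n * \<eta>\<^sup>2 \<le> 1\<close> then keeps the power of \<open>1 + ?y\<close> below
      \<open>e\<close>.\<close>
    let ?y = "\<eta>\<^sup>2 * exp (- (1 / real n))"
    have ty: "?th * ?y = (\<eta> / r)\<^sup>2" by (simp add: power_divide exp_minus field_simps)
    have y0: "0 \<le> ?y" by simp
    have ye: "?y \<le> \<eta>\<^sup>2" by (simp add: mult_left_le)
    have "?Q \<le> ?th ^ Suc n * (fact (Suc n) / fact (Suc n - (n - 1))) * ?y ^ (Suc n - (n - 1)) * (1 + ?y) ^ (n - 1)"
      unfolding ty[symmetric] by (rule qrec_le) auto
    also have "Suc n - (n - 1) = 2" using n by simp
    also have "?th ^ Suc n * (fact (Suc n) / fact 2) * ?y ^ 2 * (1 + ?y) ^ (n - 1) \<le>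
       (exp 2 / (r ^ Suc n)\<^sup>2) * fact (Suc n) * (\<eta>\<^sup>2)\<^sup>2 * exp 1"
    proof (intro mult_mono)
      have "?th ^ Suc n = exp (?m / real n) / (r ^ Suc n)\<^sup>2"
        by (simp add: power_divide exp_of_nat_mult[symmetric] power_mult[symmetric] mult.commute del: power_Suc of_nat_Suc)
      also have "\<dots> \<le> exp 2 / (r ^ Suc n)\<^sup>2"
      proof (intro divide_right_mono)
        have "?m / real n \<le> 2" using n0 by (simp add: field_simps)
        then show "exp (?m / real n) \<le> exp 2" by simp
      qed simp
      finally show "?th ^ Suc n \<le> exp 2 / (r ^ Suc n)\<^sup>2" .
      show "(fact (Suc n) / fact 2 :: real) \<le> fact (Suc n)" by (simp add: fact_numeral del: fact_Suc)
      show "?y\<^sup>2 \<le> (\<eta>\<^sup>2)\<^sup>2" using ye y0 by (rule power_mono)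
      have "(1 + ?y) ^ (n - 1) \<le> exp (\<eta>\<^sup>2) ^ (n - 1)"
      proof (intro power_mono)
        show "1 + ?y \<le> exp (\<eta>\<^sup>2)" using ye exp_ge_add_one_self[of "\<eta>\<^sup>2"] by linarith
      qed (use y0 in simp)
      also have "\<dots> \<le> exp (\<eta>\<^sup>2) ^ n" by (intro power_increasing) auto
      also have "\<dots> = exp (real n * \<eta>\<^sup>2)" by (simp add: exp_of_nat_mult)
      also have "\<dots> \<le> exp 1" using c3 by simp
      finally show "(1 + ?y) ^ (n - 1) \<le> exp 1" .
    qed (use rp y0 in \<open>auto simp del: power_Suc fact_Suc\<close>)
    also have "\<dots> \<le> (exp 2 * sqrt (fact (Suc n)) * \<eta>\<^sup>2 / r ^ Suc n)\<^sup>2"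
    proof -
      have e: "exp 2 * exp 1 \<le> (exp 2 :: real)\<^sup>2"
        unfolding exp_double[symmetric] exp_add[symmetric] by simp
      have "exp 2 / (r ^ Suc n)\<^sup>2 * fact (Suc n) * (\<eta>\<^sup>2)\<^sup>2 * exp 1 = (exp 2 * exp 1) * (fact (Suc n) * (\<eta>\<^sup>2)\<^sup>2 / (r ^ Suc n)\<^sup>2)"
        by (simp del: power_Suc fact_Suc)
      also have "\<dots> \<le> (exp 2)\<^sup>2 * (fact (Suc n) * (\<eta>\<^sup>2)\<^sup>2 / (r ^ Suc n)\<^sup>2)"
        by (intro mult_right_mono e) (simp del: power_Suc fact_Suc)
      finally show ?thesis by (simp add: power_mult_distrib power_divide del: power_Suc fact_Suc)
    qed
    finally show ?thesis using rp by (intro real_le_lsqrt) (auto simp del: power_Suc fact_Suc)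
  qed
  have p: "?p \<le> sqrt ?D * r ^ (n - 1) * exp 1"
  proof -
    have "?p = (\<Prod>j\<in>?L. sqrt (real (d j))) * (r * (1 + 1 / real n)) ^ card ?L"
      by (simp add: prod.distrib mult.assoc)
    also have "card ?L = n - 1" using i by simp
    also have "(\<Prod>j\<in>?L. sqrt (real (d j))) * (r * (1 + 1 / real n)) ^ (n - 1) \<le> sqrt ?D * (r ^ (n - 1) * exp 1)"
    proof (intro mult_mono)
      \<comment> \<open>The product misses the degree of the distinguished equation; the missing
        factor is at least 1 and is inserted.\<close>
      have "(\<Prod>j\<in>?L. sqrt (real (d j))) = 1 * (\<Prod>j\<in>?L. sqrt (real (d j)))" by simp
      also have "\<dots> \<le> sqrt (real (d i)) * (\<Prod>j\<in>?L. sqrt (real (d j)))"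
        using d[OF i] by (intro mult_right_mono prod_nonneg) auto
      also have "\<dots> = (\<Prod>j<n. sqrt (real (d j)))" using i by (subst (2) prod.remove[of _ i]) auto
      also have "\<dots> = sqrt ?D" by (simp add: sqrt_prod)
      finally show "(\<Prod>j\<in>?L. sqrt (real (d j))) \<le> sqrt ?D" .
      have "(1 + 1 / real n) ^ (n - 1) \<le> (1 + 1 / real n) ^ n" by (intro power_increasing) auto
      also have "\<dots> \<le> exp (1 / real n) ^ n" by (intro power_mono exp_ge_add_one_self) auto
      also have "\<dots> = exp 1" using n0 by (simp add: exp_of_nat_mult[symmetric])
      finally have e: "(1 + 1 / real n) ^ (n - 1) \<le> exp 1" .
      show "(r * (1 + 1 / real n)) ^ (n - 1) \<le> r ^ (n - 1) * exp 1"
        unfolding power_mult_distrib using rp by (intro mult_left_mono e) auto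
    qed (use rp in \<open>auto intro!: prod_nonneg\<close>)
    finally show ?thesis by (simp add: mult.assoc)
  qed
  have p0: "0 \<le> ?p" using rp by (intro prod_nonneg) auto
  have D0: "0 \<le> sqrt ?D" by (simp add: prod_nonneg)
  have E: "?E \<le> 80 * exp 3 * real D * (real n)\<^sup>2 * sqrt ?D * (\<eta> ^ 3 / r) * (sqrt (fact (Suc n)) / sqrt ((2 * pi) ^ Suc n))"
  proof -
    have "?p * sqrt ?Q \<le> (sqrt ?D * r ^ (n - 1) * exp 1) * (exp 2 * sqrt (fact (Suc n)) * \<eta>\<^sup>2 / r ^ Suc n)"
      using p Q p0 rp D0 qrec_pos[of "(\<eta> / r)\<^sup>2" ?th "n - 1" "Suc n"] ep
      by (intro mult_mono mult_nonneg_nonneg) (auto simp del: power_Suc fact_Suc)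
    also have "\<dots> = exp 3 * sqrt ?D * sqrt (fact (Suc n)) * (\<eta>\<^sup>2 / r\<^sup>2)"
    proof -
      have rr: "r ^ Suc n = r ^ (n - 1) * r\<^sup>2"
        using n by (simp only: power_add[symmetric]) (simp add: Suc_diff_le)
      have ee: "exp 1 * exp 2 = (exp 3 :: real)" unfolding exp_add[symmetric] by simp
      have "(sqrt ?D * r ^ (n - 1) * exp 1) * (exp 2 * sqrt (fact (Suc n)) * \<eta>\<^sup>2 / r ^ Suc n) =
        (exp 1 * exp 2) * sqrt ?D * sqrt (fact (Suc n)) * (r ^ (n - 1) * \<eta>\<^sup>2 / r ^ Suc n)"
        by (simp only: times_divide_eq_right mult_ac)
      also have "r ^ (n - 1) * \<eta>\<^sup>2 / r ^ Suc n = \<eta>\<^sup>2 / r\<^sup>2" unfolding rr using rp by simp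
      finally show ?thesis unfolding ee .
    qed
    finally have pq: "?p * sqrt ?Q \<le> exp 3 * sqrt ?D * sqrt (fact (Suc n)) * (\<eta>\<^sup>2 / r\<^sup>2)" .
    let ?t = "sqrt ((2 * pi) ^ Suc n)"
    have t: "0 < ?t" by (simp del: power_Suc)
    have "?E \<le> 80 * real D * (real n)\<^sup>2 * r * \<eta> * ((exp 3 * sqrt ?D * sqrt (fact (Suc n)) * (\<eta>\<^sup>2 / r\<^sup>2)) / ?t)"
      using pq t rp ep by (intro mult_left_mono divide_right_mono) (auto simp del: power_Suc fact_Suc)
    also have "\<dots> = 80 * exp 3 * real D * (real n)\<^sup>2 * sqrt ?D * (r * \<eta> * (\<eta>\<^sup>2 / r\<^sup>2)) * (sqrt (fact (Suc n)) / ?t)"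
    proof -
      have "80 * a * b * r' * h * ((e * s * f * q) / t) = 80 * e * a * b * s * (r' * h * q) * (f / t)"
        for a b r' h e s f q t :: real by simp
      then show ?thesis .
    qed
    also have "r * \<eta> * (\<eta>\<^sup>2 / r\<^sup>2) = \<eta> ^ 3 / r" using rp by (simp add: power2_eq_square power3_eq_cube)
    finally show ?thesis .
  qed
  have lm: "2 * l * ?m \<le> 1"
  proof -
    have D2: "2 \<le> real D" using d[OF i] by linarith
    have "2 * l * ?m \<le> 2 * l * (2 * real n)" using n0 l by (intro mult_left_mono) auto
    also have "\<dots> = 2 * real n * 2 * l" by simp
    also have "\<dots> \<le> 2 * real n * real D * l" using D2 l by (intro mult_right_mono mult_left_mono) auto
    finally show ?thesis using c2 by linarith
  qed
  let ?W = "\<lambda>c x. ennreal (wt n d D \<eta> r i (rowv n d (fs c) x) (\<lambda>j. eval_form n (d j) (fs c j) x))"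
  let ?I = "\<lambda>x. indicator {x. \<bar>L2_set x {..n} - 1\<bar> \<le> l} x :: ennreal"
  have "(\<integral>\<^sup>+c. Jv n d D \<eta> r l i c \<partial>gm (blks n d {..<n}) (vr n d)) =
    (\<integral>\<^sup>+x. \<integral>\<^sup>+c. ?W c x * ?I x \<partial>gm (blks n d {..<n}) (vr n d) \<partial>lam {..n})"
    unfolding Jv_def by (rule P.Fubini'[OF Jv_integrand_measurable[OF i], symmetric])
  also have "\<dots> \<le> (\<integral>\<^sup>+x. ennreal ?E * ?I x \<partial>lam {..n})"
  proof (intro nn_integral_mono)
    fix x
    show "(\<integral>\<^sup>+c. ?W c x * ?I x \<partial>gm (blks n d {..<n}) (vr n d)) \<le> ennreal ?E * ?I x"
    proof (cases "\<bar>L2_set x {..n} - 1\<bar> \<le> l")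
      case True
      then show ?thesis
        using wt_expectation[OF n d rp c1 less_imp_le[OF l] c2 True ep i] by simp
    qed simp
  qed
  also have "\<dots> = ennreal ?E * (\<integral>\<^sup>+x. ?I x \<partial>lam {..n})"
    by (intro nn_integral_cmult) measurable
  also have "\<dots> \<le> ennreal (80 * exp 3 * real D * (real n)\<^sup>2 * sqrt ?D * (\<eta> ^ 3 / r) * (sqrt (fact (Suc n)) / sqrt ((2 * pi) ^ Suc n))) *
      ennreal (4 * l * ?m * (exp (?m / 2) * sqrt (2 * pi / ?m) ^ Suc n))"
    by (rule mult_mono[OF ennreal_leI[OF E] shell_volume[OF l lm] zero_le zero_le])
  also have "\<dots> = ennreal ((80 * exp 3 * real D * (real n)\<^sup>2 * sqrt ?D * (\<eta> ^ 3 / r) * (sqrt (fact (Suc n)) / sqrt ((2 * pi) ^ Suc n))) *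
      (4 * l * ?m * (exp (?m / 2) * sqrt (2 * pi / ?m) ^ Suc n)))"
    using rp ep l by (intro ennreal_mult[symmetric]) (auto simp: prod_nonneg simp del: power_Suc fact_Suc)
  also have "\<dots> \<le> ennreal (1310720 * exp 4 * real D * real n ^ 7 * ?m\<^sup>2 * sqrt ?D * z\<^sup>2)"
  proof (rule ennreal_leI)
    \<comment> \<open>The exponential factors cancel: the factorial from the determinant, the
      Gaussian normalisation and the volume of the ball leave a polynomial in
      \<open>n\<close>.\<close>
    have f: "sqrt (fact (Suc n)) / sqrt ((2 * pi) ^ Suc n) * (exp (?m / 2) * sqrt (2 * pi / ?m) ^ Suc n) \<le> exp 1 * ?m"
    proof -
      have a: "sqrt (2 * pi / ?m) ^ Suc n = sqrt ((2 * pi) ^ Suc n) / sqrt (?m ^ Suc n)"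
        by (simp only: real_sqrt_power[symmetric] power_divide real_sqrt_divide)
      have b: "exp (?m / 2) = sqrt (exp 1 ^ Suc n)"
      proof -
        have "exp 1 ^ Suc n = exp ?m" by (simp add: exp_of_nat_mult[symmetric] del: power_Suc of_nat_Suc)
        also have "\<dots> = (exp (?m / 2))\<^sup>2" by (simp add: exp_double[symmetric])
        finally show ?thesis by simp
      qed
      have t: "sqrt ((2 * pi) ^ Suc n) \<noteq> 0" by (simp del: power_Suc)
      have "sqrt (fact (Suc n)) / sqrt ((2 * pi) ^ Suc n) * (exp (?m / 2) * sqrt (2 * pi / ?m) ^ Suc n) =
         sqrt (fact (Suc n)) * sqrt (exp 1 ^ Suc n) / sqrt (?m ^ Suc n)"
        unfolding a b using t by (simp del: power_Suc fact_Suc of_nat_Suc)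
      also have "\<dots> = sqrt (fact (Suc n) * exp 1 ^ Suc n / ?m ^ Suc n)"
        by (simp only: real_sqrt_mult real_sqrt_divide)
      also have "\<dots> \<le> sqrt ((exp 1 * ?m)\<^sup>2)"
      proof (rule real_sqrt_le_mono)
        have "fact (Suc n) * exp 1 ^ Suc n / ?m ^ Suc n \<le> (exp 1 * ?m * (?m / exp 1) ^ Suc n) * exp 1 ^ Suc n / ?m ^ Suc n"
          by (intro divide_right_mono mult_right_mono fact_le_power) auto
        also have "\<dots> = exp 1 * ?m" by (simp add: power_divide del: power_Suc of_nat_Suc)
        also have "\<dots> \<le> (exp 1 * ?m) * (exp 1 * ?m)"
        proof -
          have "1 * 1 \<le> exp 1 * ?m" by (intro mult_mono) auto
          then show ?thesis by (simp add: mult_le_cancel_left1 del: of_nat_Suc)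
        qed
        finally show "fact (Suc n) * exp 1 ^ Suc n / ?m ^ Suc n \<le> (exp 1 * ?m)\<^sup>2" by (simp only: power2_eq_square)
      qed
      also have "\<dots> = exp 1 * ?m" by (simp del: of_nat_Suc)
      finally show ?thesis .
    qed
    have k: "\<eta> ^ 3 / r * l = 4096 * real n ^ 5 * z\<^sup>2"
      using n0 z l by (simp add: \<eta> r field_simps power2_eq_square power3_eq_cube eval_nat_numeral)
    have "(80 * exp 3 * real D * (real n)\<^sup>2 * sqrt ?D * (\<eta> ^ 3 / r) * (sqrt (fact (Suc n)) / sqrt ((2 * pi) ^ Suc n))) *
      (4 * l * ?m * (exp (?m / 2) * sqrt (2 * pi / ?m) ^ Suc n)) =
      (320 * exp 3 * real D * (real n)\<^sup>2 * sqrt ?D * ?m) * (\<eta> ^ 3 / r * l) *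
      (sqrt (fact (Suc n)) / sqrt ((2 * pi) ^ Suc n) * (exp (?m / 2) * sqrt (2 * pi / ?m) ^ Suc n))"
    proof -
      have "(80 * e * a * b * s * k * (f / t)) * (4 * l' * m * g) = (320 * e * a * b * s * m) * (k * l') * (f / t * g)"
        for e a b s k f t l' m g :: real by simp
      then show ?thesis .
    qed
    also have "\<dots> \<le> (320 * exp 3 * real D * (real n)\<^sup>2 * sqrt ?D * ?m) * (\<eta> ^ 3 / r * l) * (exp 1 * ?m)"
      using rp ep l D0 by (intro mult_left_mono f mult_nonneg_nonneg) auto
    also have "\<dots> = 1310720 * (exp 3 * exp 1) * real D * (real n ^ 2 * real n ^ 5) * ?m\<^sup>2 * sqrt ?D * z\<^sup>2"
      unfolding k by (simp add: power2_eq_square[of ?m] del: of_nat_Suc)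
    also have "exp 3 * exp 1 = (exp 4 :: real)" unfolding exp_add[symmetric] by simp
    also have "real n ^ 2 * real n ^ 5 = real n ^ 7" unfolding power_add[symmetric] by simp
    finally show "(80 * exp 3 * real D * (real n)\<^sup>2 * sqrt ?D * (\<eta> ^ 3 / r) * (sqrt (fact (Suc n)) / sqrt ((2 * pi) ^ Suc n))) *
      (4 * l * ?m * (exp (?m / 2) * sqrt (2 * pi / ?m) ^ Suc n)) \<le>
      1310720 * exp 4 * real D * real n ^ 7 * ?m\<^sup>2 * sqrt ?D * z\<^sup>2" .
  qed
  finally show ?thesis .
qed

lemma mon_eval_cong: "(\<And>k. k \<le> n \<Longrightarrow> x k = y k) \<Longrightarrow> mon_eval n \<alpha> x = mon_eval n \<alpha> y"
  by (simp add: mon_eval_def)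

lemma eval_form_point_cong: "(\<And>k. k \<le> n \<Longrightarrow> x k = y k) \<Longrightarrow> eval_form n d g x = eval_form n d g y"
  by (simp add: eval_form_def)

lemma rowv_point_cong: "(\<And>k. k \<le> n \<Longrightarrow> x k = y k) \<Longrightarrow> rowv n d f x = rowv n d f y"
  using mon_eval_cong[of n x y] by (simp add: rowv_def grad_def mon_grad_def fun_eq_iff)

text \<open>The shell contains the ball of radius \<open>l\<close> around \<open>x0\<close>. There
  \<open>z = B * l\<close> bounds the change of the rows, and the Taylor remainder
  \<open>B * l\<^sup>2 = z * l\<close> together with the value at \<open>x0\<close> gives the error
  \<open>2 * z * l\<close> required by \<open>wt_lower\<close>.\<close>

lemma Jv_lower:
  assumes n: "1 \<le> n" and i: "i < n" and d: "\<And>j. j < n \<Longrightarrow> 2 \<le> d j \<and> d j \<le> D"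
    and B: "0 < B" and l: "0 < l" "l \<le> 1" and z: "z = B * l"
    and \<eta>: "\<eta> = 32 * (real n)\<^sup>2 * z" and r: "r = 8 * real n * z * l"
    and F: "\<And>j. j < n \<Longrightarrow> lipc n D * weyl_norm n (d j) (fs c j) \<le> B"
    and x0: "L2_set x0 {..n} = 1" and f0: "\<And>j. j < n \<Longrightarrow> \<bar>eval_form n (d j) (fs c j) x0\<bar> \<le> z * l"
    and cc: "\<And>j. j < n \<Longrightarrow> \<bar>cc j\<bar> \<le> 1"
    and dep: "\<And>w. \<bar>dotp {..n} (rowv n d (fs c) x0 i) w - (\<Sum>j\<in>{..<n} - {i}. cc j * dotp {..n} (rowv n d (fs c) x0 j) w)\<bar>
        \<le> \<eta> * L2_set w {..n}"
  shows "ennreal (exp (- 5)) \<le> Jv n d D \<eta> r l i c"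
proof -
  let ?W = "\<lambda>x. ennreal (wt n d D \<eta> r i (rowv n d (fs c) x) (\<lambda>j. eval_form n (d j) (fs c j) x))"
  let ?I = "\<lambda>x. indicator {x. \<bar>L2_set x {..n} - 1\<bar> \<le> l} x :: ennreal"
  let ?b0 = "rowv n d (fs c) x0"
  have z0: "0 < z" using B l by (simp add: z)
  have d1: "\<And>j. j < n \<Longrightarrow> 1 \<le> d j \<and> d j \<le> D" using d by force
  have coord: "\<bar>x0 k\<bar> \<le> 1" if "k \<le> n" for k
    using member_le_L2_set[of "{..n}" k "\<lambda>k. \<bar>x0 k\<bar>"] that x0 by (simp add: L2_set_def)
  have X: "(\<lambda>x. x k) \<in> borel_measurable (lam {..n})" if "k \<le> n" for k
    using that by simp
  have W1: "(\<lambda>x. wt n d D \<eta> r i (rowv n d (fs c) x) (\<lambda>j. eval_form n (d j) (fs c j) x)) \<in> borel_measurable (lam {..n})"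
  proof (rule wt_measurable[OF _ _ i])
    fix j k
    show "(\<lambda>x. rowv n d (fs c) x j k) \<in> borel_measurable (lam {..n})"
      by (rule rowv_measurable[where C="\<lambda>_. c" and X="\<lambda>x. x"], rule borel_measurable_const, rule X)
    show "(\<lambda>x. eval_form n (d j) (fs c j) x) \<in> borel_measurable (lam {..n})"
      by (rule eval_form_measurable[where C="\<lambda>_. c" and X="\<lambda>x. x"], rule borel_measurable_const, rule X)
  qed
  have I1: "?I \<in> borel_measurable (lam {..n})" by measurable
  have "ennreal (exp (- 5)) \<le> (\<integral>\<^sup>+u. ennreal (exp (- 2) / gI0 n \<eta> r i ?b0 *
      exp (- ((1 + 2 / real n) * (qf n \<eta> i ?b0 u / r\<^sup>2)) / 2)) * indicator {u. L2_set u {..n} \<le> l} u \<partial>lam {..n})"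
    by (rule nn_integral_local_lower[OF n i z0 l(1) \<eta> r d1])
  also have "\<dots> \<le> (\<integral>\<^sup>+u. ?W (\<lambda>a\<in>{..n}. x0 a + 1 * u a) * ?I (\<lambda>a\<in>{..n}. x0 a + 1 * u a) \<partial>lam {..n})"
  proof (intro nn_integral_mono)
    fix u :: "nat \<Rightarrow> real"
    let ?x = "\<lambda>a\<in>{..n}. x0 a + 1 * u a" and ?y = "\<lambda>a. x0 a + u a"
    show "ennreal (exp (- 2) / gI0 n \<eta> r i ?b0 * exp (- ((1 + 2 / real n) * (qf n \<eta> i ?b0 u / r\<^sup>2)) / 2)) *
       indicator {u. L2_set u {..n} \<le> l} u \<le> ?W ?x * ?I ?x"
    proof (cases "L2_set u {..n} \<le> l")
      case True
      have uc: "\<bar>u k\<bar> \<le> l" if "k \<le> n" for k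
        using member_le_L2_set[of "{..n}" k "\<lambda>k. \<bar>u k\<bar>"] that True by (simp add: L2_set_def)
      have r1: "rowv n d (fs c) ?x = rowv n d (fs c) ?y" by (rule rowv_point_cong) simp
      have e1: "eval_form n (d j) (fs c j) ?x = eval_form n (d j) (fs c j) ?y" for j
        by (rule eval_form_point_cong) simp
      have "L2_set ?x {..n} = L2_set ?y {..n}" by (intro L2_set_cong) auto
      moreover have "L2_set ?y {..n} \<le> 1 + l" using L2_set_triangle_ineq[of x0 u "{..n}"] x0 True by linarith
      moreover have "1 \<le> L2_set ?y {..n} + l"
      proof -
        have "L2_set x0 {..n} = L2_set (\<lambda>a. ?y a + - u a) {..n}" by simp
        also have "\<dots> \<le> L2_set ?y {..n} + L2_set (\<lambda>a. - u a) {..n}" by (rule L2_set_triangle_ineq)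
        also have "L2_set (\<lambda>a. - u a) {..n} = L2_set u {..n}" by (simp add: L2_set_def)
        finally show ?thesis using x0 True by linarith
      qed
      ultimately have shell: "\<bar>L2_set ?x {..n} - 1\<bar> \<le> l" by linarith
      have wl: "exp (- 2) / gI0 n \<eta> r i ?b0 * exp (- ((1 + 2 / real n) * (qf n \<eta> i ?b0 u / r\<^sup>2)) / 2)
         \<le> wt n d D \<eta> r i (rowv n d (fs c) ?y) (\<lambda>j. eval_form n (d j) (fs c j) ?y)"
      proof (rule wt_lower[OF n i z0 l(1) \<eta> r d1 _ _ cc dep])
        fix j w assume j: "j < n"
        have dj: "1 \<le> sqrt (real (d j))" "d j \<le> D" using d[OF j] by auto
        have "\<bar>dotp {..n} (grad n (d j) (fs c j) ?y) w - dotp {..n} (grad n (d j) (fs c j) x0) w\<bar> \<le>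
          lipc n D * weyl_norm n (d j) (fs c j) * L2_set (\<lambda>k. ?y k - x0 k) {..n} * L2_set w {..n}"
        proof (rule grad_lipschitz[OF _ _ dj(2)])
          fix k assume k: "k \<le> n"
          show "\<bar>?y k\<bar> \<le> 2" using coord[OF k] uc[OF k] l by linarith
          show "\<bar>x0 k\<bar> \<le> 2" using coord[OF k] by linarith
        qed
        also have "\<dots> \<le> B * l * L2_set w {..n}"
          using True F[OF j] B by (intro mult_right_mono mult_mono) (auto simp: L2_set_nonneg)
        finally have g: "\<bar>dotp {..n} (grad n (d j) (fs c j) ?y) w - dotp {..n} (grad n (d j) (fs c j) x0) w\<bar> \<le> z * L2_set w {..n}"
          by (simp add: z)
        have "\<bar>dotp {..n} (rowv n d (fs c) ?y j) w - dotp {..n} (rowv n d (fs c) x0 j) w\<bar> =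
          \<bar>dotp {..n} (grad n (d j) (fs c j) ?y) w - dotp {..n} (grad n (d j) (fs c j) x0) w\<bar> / sqrt (real (d j))"
          using dj by (simp add: dotp_rowv diff_divide_distrib[symmetric] abs_divide)
        also have "\<dots> \<le> \<bar>dotp {..n} (grad n (d j) (fs c j) ?y) w - dotp {..n} (grad n (d j) (fs c j) x0) w\<bar> / 1"
          using dj by (intro divide_left_mono) auto
        finally show "\<bar>dotp {..n} (rowv n d (fs c) ?y j) w - dotp {..n} (rowv n d (fs c) x0 j) w\<bar> \<le> z * L2_set w {..n}"
          using g unfolding div_by_1 by (rule order.trans)
      next
        fix j assume j: "j < n"
        have dj: "0 < sqrt (real (d j))" "d j \<le> D" using d[OF j] by auto
        have "\<bar>eval_form n (d j) (fs c j) ?y - eval_form n (d j) (fs c j) x0 - dotp {..n} (grad n (d j) (fs c j) x0) u\<bar> \<le>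
          lipc n D * weyl_norm n (d j) (fs c j) * (L2_set u {..n})\<^sup>2"
        proof (rule eval_form_taylor[OF coord _ dj(2)])
          fix k assume "k \<le> n"
          then show "\<bar>u k\<bar> \<le> 1" using uc l by (meson order.trans)
        qed
        also have "\<dots> \<le> B * l\<^sup>2"
          using True F[OF j] B by (intro mult_mono power_mono) (auto simp: L2_set_nonneg)
        also have "\<dots> = z * l" by (simp add: z power2_eq_square)
        finally have "\<bar>eval_form n (d j) (fs c j) ?y - dotp {..n} (grad n (d j) (fs c j) x0) u\<bar> \<le> 2 * z * l"
          using f0[OF j] by linarith
        moreover have "sqrt (real (d j)) * dotp {..n} (rowv n d (fs c) x0 j) u = dotp {..n} (grad n (d j) (fs c j) x0) u"
          unfolding dotp_rowv using dj by simp
        ultimately show "\<bar>eval_form n (d j) (fs c j) ?y - sqrt (real (d j)) * dotp {..n} (rowv n d (fs c) x0 j) u\<bar> \<le> 2 * z * l"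
          by simp
      qed
      have i1: "(indicator {u. L2_set u {..n} \<le> l} u :: ennreal) = 1" using True by simp
      have i2: "?I ?x = 1" using shell by simp
      from wl show ?thesis unfolding r1 e1 i1 i2 mult_1_right by (rule ennreal_leI)
    qed simp
  qed
  also have "\<dots> = (\<integral>\<^sup>+x. ?W x * ?I x \<partial>lam {..n})"
    by (subst nn_integral_lam_affine[where c=1 and t=x0, OF _ _ borel_measurable_times_ennreal[OF measurable_compose[OF W1 measurable_ennreal] I1]])
      simp_all
  finally show ?thesis by (simp add: Jv_def)
qed

text \<open>The polynomial loss in the tail bound: \<open>exp 9\<close> joins \<open>exp 4\<close>
  of the upper estimate to \<open>exp 5\<close> of the lower one, and one factor \<open>n\<close>
  stems from the sum over the distinguished row. The square of \<open>D\<close> also serves the case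
  of large scales.\<close>

definition Kc :: "nat \<Rightarrow> nat \<Rightarrow> real" where
  "Kc n D = 1310720 * exp 9 * (real D)\<^sup>2 * real n ^ 8 * (real (Suc n))\<^sup>2 * lipc n D * sqrt (real n)"

text \<open>A measurable majorant of mass at most the wanted bound represents the event, so the
  measurability of \<open>kappa\<close> itself never comes up. The norm is truncated at
  \<open>R\<close> because the Lipschitz constant, and with it all the scales, depends on
  it.\<close>

lemma kappa_tail_majorant:
  assumes n: "1 \<le> n" and d: "\<And>j. j < n \<Longrightarrow> 2 \<le> d j \<and> d j \<le> D" and R: "1 \<le> R" and t: "0 < t"
  shows "\<exists>J\<in>borel_measurable (gm (blks n d {..<n}) (vr n d)).
    (\<forall>c. system_norm n d (fs c) \<le> R \<longrightarrow> ereal t < kappa n d (fs c) \<longrightarrow> 1 \<le> J c) \<and>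
    (\<integral>\<^sup>+c. J c \<partial>gm (blks n d {..<n}) (vr n d)) \<le> ennreal (Kc n D * sqrt (real (\<Prod>j<n. d j)) * R\<^sup>2 / t)"
proof -
  let ?G = "gm (blks n d {..<n}) (vr n d)" and ?P = "sqrt (real (\<Prod>j<n. d j))"
  have n0: "1 \<le> real n" using n by simp
  have D2: "2 \<le> D" using d[of 0] n by auto
  have D1: "1 \<le> real D" using D2 by linarith
  have d1: "\<And>j. j < n \<Longrightarrow> 1 \<le> d j \<and> d j \<le> D" using d by force
  have lip1: "1 \<le> lipc n D"
  proof -
    have "1 * 1 * 1 \<le> lipc n D" unfolding lipc_def
      using D1 by (intro mult_mono one_le_power) auto
    then show ?thesis by simp
  qed
  have P1: "1 \<le> ?P"
  proof -
    have "1 \<le> (\<Prod>j<n. real (d j))" by (intro prod_ge_1) (use d in force)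
    then show ?thesis by simp
  qed
  define B where "B = lipc n D * R"
  define \<epsilon> where "\<epsilon> = sqrt (real n) * R / t"
  \<comment> \<open>This radius balances the Taylor remainder against the size of the values at the
    ill-conditioned point: \<open>B * l\<^sup>2 = z * l = \<epsilon>\<close>. Then
    \<open>z\<^sup>2 = B * \<epsilon>\<close> is proportional to \<open>1 / t\<close>.\<close>
  define l where "l = sqrt (\<epsilon> / B)"
  define z where "z = B * l"
  define \<eta> where "\<eta> = 32 * (real n)\<^sup>2 * z"
  define r where "r = 8 * real n * z * l"
  have B1: "1 \<le> B"
  proof -
    have "1 * 1 \<le> lipc n D * R" using lip1 R by (intro mult_mono) auto
    then show ?thesis by (simp add: B_def)
  qed
  have e0: "0 < \<epsilon>" using n0 R t by (simp add: \<epsilon>_def)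
  have l0: "0 < l" using e0 B1 by (simp add: l_def)
  have z0: "0 < z" using l0 B1 by (simp add: z_def)
  have lsq: "l\<^sup>2 = \<epsilon> / B" using e0 B1 by (simp add: l_def)
  have zl: "z * l = \<epsilon>"
  proof -
    have "z * l = B * l\<^sup>2" by (simp add: z_def power2_eq_square)
    then show ?thesis using B1 by (simp add: lsq)
  qed
  have zsq: "z\<^sup>2 = lipc n D * sqrt (real n) * R\<^sup>2 / t"
  proof -
    have "z\<^sup>2 = B\<^sup>2 * (\<epsilon> / B)" by (simp add: z_def power_mult_distrib lsq)
    also have "\<dots> = B * \<epsilon>" using B1 by (simp add: power2_eq_square)
    finally show ?thesis by (simp add: B_def \<epsilon>_def power2_eq_square)
  qed
  have lz: "l \<le> z" using B1 l0 by (simp add: z_def mult_le_cancel_right1)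
  have K: "Kc n D * ?P * R\<^sup>2 / t = 1310720 * exp 9 * (real D)\<^sup>2 * real n ^ 8 * (real (Suc n))\<^sup>2 * ?P * z\<^sup>2"
    unfolding zsq by (simp add: Kc_def)
  have S1: "1 \<le> (real (Suc n))\<^sup>2" by (intro one_le_power) simp
  show ?thesis
  \<comment> \<open>This inequality implies all smallness conditions on \<open>l\<close>,
    \<open>r\<close> and \<open>\<eta>\<close>; recall that
    \<open>n * \<eta>\<^sup>2 = 1024 * n ^ 5 * z\<^sup>2\<close>. If it fails, the claimed bound is
    at least 1 and the constant majorant 1 works.\<close>
  proof (cases "1024 * real n ^ 5 * (real D)\<^sup>2 * z\<^sup>2 \<le> 1")
    case True
    have n5: "1 \<le> real n ^ 5" "real n \<le> real n ^ 5" "(real n)\<^sup>2 \<le> real n ^ 5"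
      using n0 power_increasing[of 1 5 "real n"] power_increasing[of 2 5 "real n"] by (auto simp: one_le_power)
    have Dsq: "1 \<le> (real D)\<^sup>2" using D1 by (simp add: one_le_power)
    have "(real n)\<^sup>2 * (real D)\<^sup>2 * z\<^sup>2 \<le> real n ^ 5 * (real D)\<^sup>2 * z\<^sup>2"
      using n5 by (intro mult_right_mono) auto
    then have "(32 * real n * real D * z)\<^sup>2 \<le> 1"
      using True by (simp add: power_mult_distrib)
    then have q: "32 * real n * real D * z \<le> 1"
      by (simp add: abs_square_le_1)
    have nD: "1 \<le> real n * real D" using n0 D1 mult_mono[of 1 "real n" 1 "real D"] by simp
    have zz: "32 * z \<le> 1"
    proof -
      have "32 * 1 * z \<le> 32 * (real n * real D) * z" using nD z0 by (intro mult_right_mono mult_left_mono) auto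
      then show ?thesis using q by simp
    qed
    have l1: "l \<le> 1" using lz zz z0 by linarith
    have c2: "2 * real n * real D * l \<le> 1"
    proof -
      have "2 * real n * real D * l \<le> 2 * real n * real D * z" using lz by (intro mult_left_mono) auto
      also have "\<dots> \<le> 32 * real n * real D * z" using z0 by (intro mult_right_mono) auto
      finally show ?thesis using q by linarith
    qed
    have c1: "4 * (real D)\<^sup>2 * r\<^sup>2 \<le> 1"
    proof -
      have "2 * real D * r = (16 * real n * real D * z) * l" by (simp add: r_def)
      also have "\<dots> \<le> 1 * 1" using q l1 z0 l0 nD by (intro mult_mono) auto
      finally have "2 * real D * r \<le> 1" by simp
      moreover have "0 \<le> 2 * real D * r" using z0 l0 by (simp add: r_def)
      ultimately have "(2 * real D * r)\<^sup>2 \<le> 1" by (simp add: power_le_one)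
      then show ?thesis by (simp add: power_mult_distrib)
    qed
    have c3: "real n * \<eta>\<^sup>2 \<le> 1"
    proof -
      have "real n * \<eta>\<^sup>2 = 1024 * real n ^ 5 * 1 * z\<^sup>2"
        by (simp add: \<eta>_def power_mult_distrib eval_nat_numeral)
      also have "\<dots> \<le> 1024 * real n ^ 5 * (real D)\<^sup>2 * z\<^sup>2" using Dsq by (intro mult_right_mono mult_left_mono) auto
      finally show ?thesis using True by linarith
    qed
    let ?J = "\<lambda>c. \<Sum>i<n. ennreal (exp 5) * Jv n d D \<eta> r l i c"
    have Jm: "Jv n d D \<eta> r l i \<in> borel_measurable ?G" if "i < n" for i by (rule Jv_measurable[OF that])
    have J1: "?J \<in> borel_measurable ?G"
      using Jm by (intro borel_measurable_sum borel_measurable_times_ennreal borel_measurable_const) auto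
    have J2: "1 \<le> ?J c" if c: "system_norm n d (fs c) \<le> R" "ereal t < kappa n d (fs c)" for c
    proof -
      have "sqrt (real n) * system_norm n d (fs c) / t \<le> \<epsilon>"
        unfolding \<epsilon>_def using c t by (intro divide_right_mono mult_left_mono) auto
      then obtain x i cc where x: "L2_set x {..n} = 1" "i < n"
        "\<And>j. j < n \<Longrightarrow> \<bar>eval_form n (d j) (fs c j) x\<bar> \<le> \<epsilon>" "\<And>j. j < n \<Longrightarrow> \<bar>cc j\<bar> \<le> 1"
        and dep: "\<And>u. \<bar>dotp {..n} (rowv n d (fs c) x i) u - (\<Sum>j\<in>{..<n} - {i}. cc j * dotp {..n} (rowv n d (fs c) x j) u)\<bar>
           \<le> 2 * real n * real D * \<epsilon> * L2_set u {..n}"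
        using kappa_greater_nearly_dependent[OF n d1 t c(2)] by blast
      have "ennreal (exp (- 5)) \<le> Jv n d D \<eta> r l i c"
      proof (rule Jv_lower[OF n x(2) d _ l0 l1 z_def \<eta>_def r_def _ x(1) _ x(4)])
        show "0 < B" using B1 by simp
        show "lipc n D * weyl_norm n (d j) (fs c j) \<le> B" if "j < n" for j
        proof -
          have "weyl_norm n (d j) (fs c j) \<le> system_norm n d (fs c)"
            unfolding system_norm_def using that by (intro Max_ge) auto
          then show ?thesis unfolding B_def using c(1) lip1 by (intro mult_left_mono) auto
        qed
        show "\<bar>eval_form n (d j) (fs c j) x\<bar> \<le> z * l" if "j < n" for j
          using x(3)[OF that] by (simp add: zl)
        fix u
        have "2 * real n * real D * \<epsilon> \<le> \<eta>"
        proof -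
          have "2 * real n * real D * \<epsilon> = (2 * real n * real D * l) * z" by (simp add: zl[symmetric])
          also have "\<dots> \<le> 1 * z" using c2 z0 by (intro mult_right_mono) auto
          also have "\<dots> \<le> 32 * (real n)\<^sup>2 * z" using z0 one_le_power[OF n0, of 2] by (intro mult_right_mono) auto
          finally show ?thesis by (simp add: \<eta>_def)
        qed
        then show "\<bar>dotp {..n} (rowv n d (fs c) x i) u - (\<Sum>j\<in>{..<n} - {i}. cc j * dotp {..n} (rowv n d (fs c) x j) u)\<bar>
           \<le> \<eta> * L2_set u {..n}"
          using dep[of u] mult_right_mono[OF _ L2_set_nonneg] by (meson order.trans)
      qed
      then have "ennreal (exp 5) * ennreal (exp (- 5)) \<le> ennreal (exp 5) * Jv n d D \<eta> r l i c"
        by (intro mult_left_mono) auto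
      also have "ennreal (exp 5) * ennreal (exp (- 5)) = 1"
        by (simp add: ennreal_mult[symmetric] exp_minus)
      also have "ennreal (exp 5) * Jv n d D \<eta> r l i c \<le> ?J c"
        using x(2) by (intro member_le_sum) auto
      finally show ?thesis .
    qed
    have J3: "(\<integral>\<^sup>+c. ?J c \<partial>?G) \<le> ennreal (Kc n D * ?P * R\<^sup>2 / t)"
    proof -
      define b where "b = 1310720 * exp 4 * real D * real n ^ 7 * (real (Suc n))\<^sup>2 * ?P * z\<^sup>2"
      have b0: "0 \<le> b" unfolding b_def using P1 by (intro mult_nonneg_nonneg) auto
      have "(\<integral>\<^sup>+c. ?J c \<partial>?G) = (\<Sum>i<n. ennreal (exp 5) * (\<integral>\<^sup>+c. Jv n d D \<eta> r l i c \<partial>?G))"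
        by (subst nn_integral_sum) (auto intro!: sum.cong nn_integral_cmult borel_measurable_times_ennreal borel_measurable_const Jm)
      also have "\<dots> \<le> (\<Sum>i<n. ennreal (exp 5) * ennreal b)"
        using Jv_upper[OF n _ d z0 l0 \<eta>_def r_def c1 c2 c3] unfolding b_def by (intro sum_mono mult_left_mono) auto
      also have "\<dots> = (\<Sum>i<n. ennreal (exp 5 * b))"
        using b0 by (intro sum.cong refl ennreal_mult[symmetric]) auto
      also have "\<dots> = ennreal (\<Sum>i<n. exp 5 * b)"
        using b0 by (intro sum_ennreal mult_nonneg_nonneg) auto
      also have "(\<Sum>i<n. exp 5 * b) = real n * (exp 5 * b)" by simp
      also have "real n * (exp 5 * b) = 1310720 * (exp 5 * exp 4) * real D * (real n * real n ^ 7) * (real (Suc n))\<^sup>2 * ?P * z\<^sup>2"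
      proof -
        have "a * (e * (k * e' * D' * b * s * p * w)) = k * (e * e') * D' * (a * b) * s * p * w"
          for a e k e' D' b s p w :: real by simp
        then show ?thesis unfolding b_def .
      qed
      also have "exp 5 * exp 4 = (exp 9 :: real)" unfolding exp_add[symmetric] by simp
      also have "real n * real n ^ 7 = real n ^ 8" unfolding power_Suc[symmetric] by simp
      also have "ennreal (1310720 * exp 9 * real D * real n ^ 8 * (real (Suc n))\<^sup>2 * ?P * z\<^sup>2) \<le> ennreal (Kc n D * ?P * R\<^sup>2 / t)"
        unfolding K using P1 D1 self_le_power[of "real D" 2]
        by (intro ennreal_leI mult_right_mono mult_left_mono) auto
      finally show ?thesis .
    qed
    show ?thesis
      by (intro bexI[where x="?J"] conjI allI impI J1 J2 J3)
  next
    case False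
    have "(\<integral>\<^sup>+c. 1 \<partial>?G) \<le> ennreal (Kc n D * ?P * R\<^sup>2 / t)"
    proof -
      interpret G: product_prob_space "\<lambda>a. gauss (vr n d a)" "blks n d {..<n}"
        by (rule product_prob_space_gm[OF vr_pos])
      have int1: "(\<integral>\<^sup>+c. 1 \<partial>?G) = 1" using G.emeasure_space_1 by simp
      have one: "1 \<le> 1310720 * exp 9 * (real D)\<^sup>2 * real n ^ 8 * (real (Suc n))\<^sup>2 * ?P * z\<^sup>2"
      proof -
        have "1 \<le> 1024 * real n ^ 5 * (real D)\<^sup>2 * z\<^sup>2" using False by linarith
        also have "\<dots> = 1024 * 1 * (real D)\<^sup>2 * real n ^ 5 * 1 * 1 * z\<^sup>2" by simp
        also have "\<dots> \<le> 1310720 * exp 9 * (real D)\<^sup>2 * real n ^ 8 * (real (Suc n))\<^sup>2 * ?P * z\<^sup>2"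
        proof -
          have "real n ^ 5 \<le> real n ^ 8" using n0 by (intro power_increasing) auto
          moreover have "(1024 :: real) * 1 \<le> 1310720 * exp 9" by (intro mult_mono) auto
          ultimately show ?thesis using P1 S1 by (intro mult_mono) (auto simp: prod_nonneg)
        qed
        finally show ?thesis .
      qed
      show ?thesis unfolding K int1 using ennreal_leI[OF one] by (simp only: ennreal_1)
    qed
    then show ?thesis by (intro bexI[of _ "\<lambda>_. 1"]) auto
  qed
qed

subsection \<open>Second moment of the norm\<close>

lemma nn_integral_gm_square_le:
  assumes S: "finite S" "p \<in> S" and v: "\<And>a. 0 < v a"
  shows "(\<integral>\<^sup>+c. ennreal ((c p)\<^sup>2) \<partial>gm S v) \<le> ennreal (v p)"
proof -
  let ?e = "\<lambda>q. if q = p then 1 else 0 :: real"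
  have "(\<Sum>q\<in>S. v q * (?e q)\<^sup>2) = (\<Sum>q\<in>S. if q = p then v p else 0)"
    by (intro sum.cong) auto
  then have "(\<Sum>q\<in>S. v q * (?e q)\<^sup>2) = v p" using S by simp
  then show ?thesis
    using nn_integral_gm_exp_square_le[where A=S and v=v and c=0 and l="\<lambda>_. 0" and l'="?e", OF S(1) v order.refl]
    by (simp add: dotp_unit[OF S])
qed

lemma prod_fact_le: "finite A \<Longrightarrow> (\<Prod>k\<in>A. fact (j k)) \<le> (fact (\<Sum>k\<in>A. j k) :: nat)"
proof (induction A rule: finite_induct)
  case (insert a A)
  have "(\<Prod>k\<in>insert a A. fact (j k)) \<le> fact (j a) * (fact (\<Sum>k\<in>A. j k) :: nat)"
    using insert by simp
  also have "\<dots> \<le> fact (j a + (\<Sum>k\<in>A. j k))"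
    by (intro dvd_imp_le fact_fact_dvd_fact) simp
  finally show ?case using insert by simp
qed simp

lemma multinomial_ge_1:
  assumes "j \<in> multi_indices n d"
  shows "1 \<le> multinomial n d j"
proof -
  have "(\<Prod>k\<le>n. fact (j k)) \<le> (fact d :: nat)"
    using prod_fact_le[of "{..n}" j] assms by (simp add: multi_indices_def)
  then have "real (\<Prod>k\<le>n. fact (j k)) \<le> real (fact d)" by (simp only: of_nat_le_iff)
  then have "(\<Prod>k\<le>n. fact (j k)) \<le> (fact d :: real)" by (simp only: of_nat_prod of_nat_fact)
  then show ?thesis by (simp add: multinomial_def prod_pos)
qed

lemma card_multi_indices_le: "real (card (multi_indices n d)) \<le> real (Suc n) ^ d"
proof -
  have "real (card (multi_indices n d)) = (\<Sum>j\<in>multi_indices n d. 1)" by simp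
  also have "\<dots> \<le> (\<Sum>j\<in>multi_indices n d. multinomial n d j)"
    by (intro sum_mono multinomial_ge_1)
  also have "\<dots> = real (Suc n) ^ d"
    using multinomial_theorem[of "\<lambda>_. 1" n d] by (simp add: mon_eval_def)
  finally show ?thesis .
qed

text \<open>The maximum is bounded by the sum, and every coefficient divided by its standard
  deviation has second moment at most 1, so the number of coefficients is a bound.\<close>

lemma system_norm_second_moment:
  assumes n: "1 \<le> n" and d: "\<And>j. j < n \<Longrightarrow> d j \<le> D"
  shows "(\<integral>\<^sup>+c. ennreal ((system_norm n d (fs c))\<^sup>2) \<partial>gm (blks n d {..<n}) (vr n d)) \<le> ennreal (real n * real (Suc n) ^ D)"
proof -
  let ?S = "blks n d {..<n}" and ?G = "gm (blks n d {..<n}) (vr n d)"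
  have fS: "finite ?S" by simp
  have le: "(system_norm n d (fs c))\<^sup>2 \<le> (\<Sum>p\<in>?S. (c p)\<^sup>2 / vr n d p)" for c
  proof -
    have "system_norm n d (fs c) \<in> (\<lambda>i. weyl_norm n (d i) (fs c i)) ` {..<n}"
      unfolding system_norm_def using n by (intro Max_in) (auto simp: lessThan_empty_iff)
    then obtain i where i: "i < n" "system_norm n d (fs c) = weyl_norm n (d i) (fs c i)" by auto
    let ?w = "\<lambda>i. \<Sum>j\<in>multi_indices n (d i). (c (i, j))\<^sup>2 / multinomial n (d i) j"
    have w0: "0 \<le> ?w i" for i by (intro sum_nonneg) (simp add: less_imp_le[OF multinomial_pos])
    have "(weyl_norm n (d i) (fs c i))\<^sup>2 = ?w i"
      using w0[of i] by (simp add: weyl_norm_def fs_def)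
    also have "\<dots> \<le> (\<Sum>i<n. ?w i)" using i(1) w0 by (intro member_le_sum) auto
    also have "\<dots> = (\<Sum>p\<in>?S. (c p)\<^sup>2 / vr n d p)"
      unfolding blks_def vr_def by (subst sum.Sigma) (auto intro!: sum.cong)
    finally show ?thesis by (simp add: i(2))
  qed
  have m: "(\<lambda>c. ennreal ((c p)\<^sup>2)) \<in> borel_measurable ?G" if "p \<in> ?S" for p
    using measurable_coef[OF that, of "vr n d"] by measurable
  have "(\<integral>\<^sup>+c. ennreal ((system_norm n d (fs c))\<^sup>2) \<partial>?G) \<le> (\<integral>\<^sup>+c. (\<Sum>p\<in>?S. ennreal (1 / vr n d p) * ennreal ((c p)\<^sup>2)) \<partial>?G)"
  proof (intro nn_integral_mono)
    fix c
    have "ennreal ((system_norm n d (fs c))\<^sup>2) \<le> ennreal (\<Sum>p\<in>?S. (c p)\<^sup>2 / vr n d p)"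
      by (intro ennreal_leI le)
    also have "\<dots> = (\<Sum>p\<in>?S. ennreal ((c p)\<^sup>2 / vr n d p))"
      by (intro sum_ennreal[symmetric] divide_nonneg_pos vr_pos) simp
    also have "\<dots> = (\<Sum>p\<in>?S. ennreal (1 / vr n d p) * ennreal ((c p)\<^sup>2))"
      using less_imp_le[OF vr_pos] by (intro sum.cong refl) (simp add: ennreal_mult'[symmetric])
    finally show "ennreal ((system_norm n d (fs c))\<^sup>2) \<le> (\<Sum>p\<in>?S. ennreal (1 / vr n d p) * ennreal ((c p)\<^sup>2))" .
  qed
  also have "\<dots> = (\<Sum>p\<in>?S. ennreal (1 / vr n d p) * (\<integral>\<^sup>+c. ennreal ((c p)\<^sup>2) \<partial>?G))"
    by (subst nn_integral_sum) (auto intro!: sum.cong nn_integral_cmult borel_measurable_times_ennreal m)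
  also have "\<dots> \<le> (\<Sum>p\<in>?S. ennreal (1 / vr n d p) * ennreal (vr n d p))"
    by (intro sum_mono mult_left_mono nn_integral_gm_square_le[OF fS _ vr_pos]) auto
  also have "\<dots> = (\<Sum>p\<in>?S. 1)"
    using less_imp_neq[OF vr_pos, symmetric] less_imp_le[OF vr_pos]
    by (intro sum.cong refl) (simp add: ennreal_mult'[symmetric])
  also have "\<dots> = ennreal (real (card ?S))" by (simp add: ennreal_of_nat_eq_real_of_nat)
  also have "\<dots> \<le> ennreal (real n * real (Suc n) ^ D)"
  proof (rule ennreal_leI)
    have "real (card ?S) = (\<Sum>i<n. real (card (multi_indices n (d i))))"
      by (simp add: blks_def)
    also have "\<dots> \<le> (\<Sum>i<n. real (Suc n) ^ D)"
    proof (intro sum_mono)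
      fix i assume "i \<in> {..<n}"
      then have "real (Suc n) ^ d i \<le> real (Suc n) ^ D" using d by (intro power_increasing) auto
      then show "real (card (multi_indices n (d i))) \<le> real (Suc n) ^ D"
        using card_multi_indices_le[of n "d i"] by linarith
    qed
    finally show "real (card ?S) \<le> real n * real (Suc n) ^ D" by simp
  qed
  finally show ?thesis .
qed

subsection \<open>Integrating the tail\<close>

text \<open>The number of naturals \<open>k\<close> with \<open>exp k < x\<close> is the ceiling of
  \<open>ln x\<close> for finite \<open>x \<ge> 1\<close>, so the series dominates the positive part
  of the logarithm.\<close>

lemma ln_ereal_le_suminf:
  "e2ennreal (ln_ereal x) \<le> (\<Sum>k. if ereal (exp (real k)) < x then 1 else 0)"
proof -
  consider "x = \<infinity>" | "x \<le> 0" | y where "x = ereal y" "0 < y"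
    by (cases x) (auto, force)
  then show ?thesis
  proof cases
    case 1
    have "(\<Sum>k::nat. 1 :: ennreal) = (\<integral>\<^sup>+k. 1 \<partial>count_space (UNIV :: nat set))"
      by (rule nn_integral_count_space_nat[symmetric])
    also have "\<dots> = \<infinity>" by simp
    finally show ?thesis using 1 by simp
  next
    case 2
    then show ?thesis by (auto simp: ln_ereal_def e2ennreal_neg)
  next
    case 3
    define N where "N = nat \<lceil>ln y\<rceil>"
    have "e2ennreal (ln_ereal x) = ennreal (ln y)" using 3 by (simp add: ln_ereal_def)
    also have "\<dots> \<le> ennreal (real N)" by (intro ennreal_leI) (simp add: N_def, linarith)
    also have "\<dots> = (\<Sum>k<N. 1)" by (simp add: ennreal_of_nat_eq_real_of_nat)
    also have "\<dots> \<le> (\<Sum>k<N. if ereal (exp (real k)) < x then 1 else 0)"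
    proof (intro sum_mono)
      fix k assume "k \<in> {..<N}"
      then have "real k < ln y" unfolding N_def by (simp, linarith)
      then have "exp (real k) < exp (ln y)" by simp
      then show "(1 :: ennreal) \<le> (if ereal (exp (real k)) < x then 1 else 0)" using 3 by simp
    qed
    also have "\<dots> \<le> (\<Sum>k. if ereal (exp (real k)) < x then 1 else 0)"
      by (intro sum_le_suminf) auto
    finally show ?thesis .
  qed
qed

lemma kappa_cong:
  assumes "\<And>i j. i < n \<Longrightarrow> j \<in> multi_indices n (d i) \<Longrightarrow> f i j = g i j"
  shows "kappa n d f = kappa n d g"
proof -
  have 1: "eval_form n (d i) (f i) x = eval_form n (d i) (g i) x" if "i < n" for i x
    using assms[OF that] by (rule eval_form_cong)
  have 2: "weyl_norm n (d i) (f i) = weyl_norm n (d i) (g i)" if "i < n" for i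
    using assms[OF that] by (simp add: weyl_norm_def)
  have 3: "system_norm n d f = system_norm n d g"
    unfolding system_norm_def using 2 by (intro arg_cong[where f=Max] image_cong) auto
  have 4: "eval_sup_norm n d f = eval_sup_norm n d g"
    unfolding eval_sup_norm_def using 1 by (intro ext arg_cong[where f=Max] image_cong) auto
  have 5: "system_deriv n d f = system_deriv n d g"
    unfolding system_deriv_def using 1 by (intro ext) auto
  show ?thesis unfolding kappa_def mu_norm_def 3 4 5 ..
qed

section \<open>From the random system to the Gaussian product measure, and summation of the
  tails\<close>

lemma shub_smale_distr:
  assumes "shub_smale M n d a" and n: "1 \<le> n"
  defines "X \<equiv> \<lambda>\<omega>. \<lambda>p\<in>blks n d {..<n}. a (fst p) (snd p) \<omega>"
  shows "X \<in> measurable M (Pi\<^sub>M (blks n d {..<n}) (\<lambda>_. borel))"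
    and "distr M (Pi\<^sub>M (blks n d {..<n}) (\<lambda>_. borel)) X = gm (blks n d {..<n}) (vr n d)"
proof -
  let ?S = "blks n d {..<n}"
  interpret prob_space M using assms(1) by (simp add: shub_smale_def)
  have ind: "indep_vars (\<lambda>_. borel) (\<lambda>p. a (fst p) (snd p)) ?S"
    using assms(1) by (simp add: shub_smale_def blks_def case_prod_beta')
  have dis: "distributed M lborel (a (fst p) (snd p)) (\<lambda>x. ennreal (normal_density 0 (sqrt (vr n d p)) x))"
    if "p \<in> ?S" for p
    using assms(1) that by (auto simp: shub_smale_def blks_def vr_def)
  have rv: "a (fst p) (snd p) \<in> borel_measurable M" if "p \<in> ?S" for p
    using dis[OF that] by (simp add: distributed_def)
  \<comment> \<open>A witness for a nonempty index set, which the characterisation of independence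
    by the product law requires.\<close>
  have "(\<lambda>k. if k = 0 then d 0 else 0) \<in> multi_indices n (d 0)"
    by (simp add: multi_indices_def)
  then have "(0, \<lambda>k. if k = 0 then d 0 else 0) \<in> ?S" using n by (simp add: blks_def)
  then have ne: "?S \<noteq> {}" by blast
  show "X \<in> measurable M (Pi\<^sub>M ?S (\<lambda>_. borel))"
    unfolding X_def by (intro measurable_restrict rv)
  have "distr M (Pi\<^sub>M ?S (\<lambda>_. borel)) X = Pi\<^sub>M ?S (\<lambda>p. distr M borel (a (fst p) (snd p)))"
    using ind indep_vars_iff_distr_eq_PiM'[OF ne, of "\<lambda>p. a (fst p) (snd p)" "\<lambda>_. borel"] rv
    by (simp add: X_def)
  also have "\<dots> = gm ?S (vr n d)"
  proof (intro PiM_cong refl)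
    fix p assume "p \<in> ?S"
    have "distr M borel (a (fst p) (snd p)) = distr M lborel (a (fst p) (snd p))"
      by (intro distr_cong) auto
    also have "\<dots> = gauss (vr n d p)"
      using dis[OF \<open>p \<in> ?S\<close>] by (simp add: distributed_def)
    finally show "distr M borel (a (fst p) (snd p)) = gauss (vr n d p)" .
  qed
  finally show "distr M (Pi\<^sub>M ?S (\<lambda>_. borel)) X = gm ?S (vr n d)" .
qed

lemma summable_inverse_squares: "summable (\<lambda>k. 1 / (1 + real k)\<^sup>2)"
  using summable_Suc_iff[of "\<lambda>k. inverse ((real k)\<^sup>2)"] inverse_power_summable[of 2, where 'a=real]
  by (simp add: inverse_eq_divide)

lemma summable_square_exp: "summable (\<lambda>k. (1 + real k)\<^sup>2 * exp (- real k))"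
proof (rule summable_comparison_test')
  have "summable (\<lambda>k. exp (- (1/2) :: real) ^ k)" by (rule summable_geometric) simp
  then show "summable (\<lambda>k. 16 * exp (- (1/2) :: real) ^ k)" by (rule summable_mult)
  fix k :: nat assume "k \<ge> 0"
  have "1 + real k \<le> 4 * exp (real k / 4)" using exp_ge_add_one_self[of "real k / 4"] by linarith
  then have "(1 + real k)\<^sup>2 \<le> (4 * exp (real k / 4))\<^sup>2" by (intro power_mono) auto
  also have "\<dots> = 16 * exp (real k / 2)" by (simp add: power_mult_distrib exp_double[symmetric])
  finally have "(1 + real k)\<^sup>2 * exp (- real k) \<le> 16 * exp (real k / 2) * exp (- real k)"
    by (intro mult_right_mono) auto
  also have "\<dots> = 16 * exp (- (1/2) :: real) ^ k"
    by (simp add: mult.assoc exp_add[symmetric] exp_of_nat_mult[symmetric])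
  finally show "norm ((1 + real k)\<^sup>2 * exp (- real k)) \<le> 16 * exp (- (1/2) :: real) ^ k" by simp
qed

definition C1 :: real where "C1 = (\<Sum>k. 1 / (1 + real k)\<^sup>2)"
definition C2 :: real where "C2 = (\<Sum>k. (1 + real k)\<^sup>2 * exp (- real k))"

text \<open>The two summands of \<open>b\<close> stand for a large norm and for a large condition
  number. Shifting the index by \<open>K\<close>, the inequality
  \<open>1 + k + K \<le> (1 + K) * (1 + k)\<close> splits the second into a factor in
  \<open>K\<close>, which carries \<open>exp (- K)\<close>, and a convergent series.\<close>

lemma suminf_tail_bound:
  assumes A: "0 \<le> A"
  defines "b \<equiv> \<lambda>k. 1 / (1 + real k)\<^sup>2 + A * (1 + real k)\<^sup>2 * exp (- real k)"
  shows "(\<Sum>k. if k < K then 1 else ennreal (b k)) \<le> ennreal (real K + C1 + A * (1 + real K)\<^sup>2 * exp (- real K) * C2)"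
proof -
  define f where "f = (\<lambda>k. if k < K then 1 else b k)"
  let ?g = "\<lambda>k. 1 / (1 + real k)\<^sup>2 + A * (1 + real K)\<^sup>2 * exp (- real K) * ((1 + real k)\<^sup>2 * exp (- real k))"
  have b0: "0 \<le> b k" for k using A by (simp add: b_def)
  have f0: "0 \<le> f k" for k using b0 by (simp add: f_def)
  have fg: "f (k + K) \<le> ?g k" for k
  proof -
    have "1 / (1 + real (k + K))\<^sup>2 \<le> 1 / (1 + real k)\<^sup>2"
      by (intro divide_left_mono power_mono mult_pos_pos) auto
    moreover have "A * (1 + real (k + K))\<^sup>2 * exp (- real (k + K)) \<le> A * (1 + real K)\<^sup>2 * exp (- real K) * ((1 + real k)\<^sup>2 * exp (- real k))"
    proof -
      have "(1 + real (k + K))\<^sup>2 \<le> ((1 + real K) * (1 + real k))\<^sup>2"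
        by (intro power_mono) (auto simp: algebra_simps)
      then have "A * (1 + real (k + K))\<^sup>2 * exp (- real (k + K)) \<le> A * ((1 + real K) * (1 + real k))\<^sup>2 * exp (- real (k + K))"
        using A by (intro mult_right_mono mult_left_mono) auto
      also have "\<dots> = A * (1 + real K)\<^sup>2 * exp (- real K) * ((1 + real k)\<^sup>2 * exp (- real k))"
      proof -
        have "exp (- real (k + K)) = exp (- real K) * exp (- real k)"
          unfolding exp_add[symmetric] by simp
        then show ?thesis by (simp only: power_mult_distrib mult_ac)
      qed
      finally show ?thesis .
    qed
    ultimately show ?thesis by (simp add: f_def b_def)
  qed
  have gs: "summable ?g"
    by (intro summable_add summable_mult summable_inverse_squares summable_square_exp)
  have "summable (\<lambda>k. f (k + K))"
    by (rule summable_comparison_test'[OF gs, of 0]) (use f0 fg in simp)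
  then have fs: "summable f" by (simp only: summable_iff_shift)
  have "(\<Sum>k. if k < K then 1 else ennreal (b k)) = (\<Sum>k. ennreal (f k))"
    by (intro arg_cong[where f=suminf] ext) (simp add: f_def)
  also have "\<dots> = ennreal (suminf f)" by (rule suminf_ennreal2[OF f0 fs])
  also have "suminf f = (\<Sum>k. f (k + K)) + (\<Sum>k<K. f k)" by (rule suminf_split_initial_segment[OF fs])
  also have "(\<Sum>k<K. f k) = real K" by (simp add: f_def)
  also have "ennreal ((\<Sum>k. f (k + K)) + real K) \<le> ennreal (real K + C1 + A * (1 + real K)\<^sup>2 * exp (- real K) * C2)"
  proof (rule ennreal_leI)
    have "(\<Sum>k. f (k + K)) \<le> suminf ?g"
      by (intro suminf_le fg gs) fact
    also have "\<dots> = C1 + A * (1 + real K)\<^sup>2 * exp (- real K) * C2"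
      unfolding C1_def C2_def
      by (subst suminf_add[symmetric, OF summable_inverse_squares summable_mult[OF summable_square_exp]])
        (simp add: suminf_mult[OF summable_square_exp])
    finally show "(\<Sum>k. f (k + K)) + real K \<le> real K + C1 + A * (1 + real K)\<^sup>2 * exp (- real K) * C2" by simp
  qed
  finally show ?thesis .
qed

text \<open>The level \<open>K\<close> stays free: below it tail probabilities are bounded by 1,
  above it by the majorants. The truncation \<open>R k\<close> of the norm grows with
  \<open>k\<close> so that Chebyshev's inequality leaves the summable
  \<open>1 / (1 + k)\<^sup>2\<close>; the price \<open>(1 + k)\<^sup>2\<close> in the majorant is
  harmless against \<open>exp (- k)\<close>.\<close>

lemma expectation_ln_kappa_le:
  assumes sh: "shub_smale M n d a" and n: "1 \<le> n" and d: "\<And>j. j < n \<Longrightarrow> 2 \<le> d j \<and> d j \<le> D"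
  defines "A \<equiv> Kc n D * sqrt (real (\<Prod>j<n. d j)) * (real (Suc n) ^ Suc D)\<^sup>2"
  shows "ereal_expectation M (\<lambda>\<omega>. ln_ereal (kappa n d (\<lambda>i j. a i j \<omega>))) \<le>
    ereal (real K + C1 + A * (1 + real K)\<^sup>2 * exp (- real K) * C2)"
proof -
  let ?S = "blks n d {..<n}"
  let ?G = "gm ?S (vr n d)"
  define X where "X = (\<lambda>\<omega>. \<lambda>p\<in>?S. a (fst p) (snd p) \<omega>)"
  note X = shub_smale_distr[OF sh n, folded X_def]
  define R where "R = (\<lambda>k. real (Suc n) ^ Suc D * (1 + real k))"
  have R1: "1 \<le> R k" for k
  proof -
    have "1 * 1 \<le> real (Suc n) ^ Suc D * (1 + real k)" by (intro mult_mono one_le_power) auto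
    then show ?thesis by (simp add: R_def)
  qed
  have "\<forall>k. \<exists>J\<in>borel_measurable ?G.
    (\<forall>c. system_norm n d (fs c) \<le> R k \<longrightarrow> ereal (exp (real k)) < kappa n d (fs c) \<longrightarrow> 1 \<le> J c) \<and>
    (\<integral>\<^sup>+c. J c \<partial>?G) \<le> ennreal (Kc n D * sqrt (real (\<Prod>j<n. d j)) * (R k)\<^sup>2 / exp (real k))"
    by (intro allI kappa_tail_majorant[OF n d R1]) simp_all
  then obtain J where Jm: "\<And>k. J k \<in> borel_measurable ?G"
    and J1: "\<And>k c. system_norm n d (fs c) \<le> R k \<Longrightarrow> ereal (exp (real k)) < kappa n d (fs c) \<Longrightarrow> 1 \<le> J k c"
    and J2: "\<And>k. (\<integral>\<^sup>+c. J k c \<partial>?G) \<le> ennreal (Kc n D * sqrt (real (\<Prod>j<n. d j)) * (R k)\<^sup>2 / exp (real k))"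
    by metis
  have nm: "(\<lambda>c. system_norm n d (fs c)) \<in> borel_measurable ?G"
  proof -
    have w: "(\<lambda>c. weyl_norm n (d i) (fs c i)) \<in> borel_measurable ?G" if "i < n" for i
      unfolding weyl_norm_def fs_def
      by (rule measurable_compose[OF _ borel_measurable_sqrt], rule borel_measurable_sum,
          rule borel_measurable_divide, rule borel_measurable_power, rule coef_measurable_gm) (use that in auto)
    have "(\<lambda>c. Max ((\<lambda>i. weyl_norm n (d i) (fs c i)) ` {..<n})) \<in> borel_measurable ?G"
      using n w by (intro borel_measurable_Max) auto
    then show ?thesis by (simp add: system_norm_def)
  qed
  define h where "h = (\<lambda>k c. if k < K then 1 else ennreal (1 / (R k)\<^sup>2) * ennreal ((system_norm n d (fs c))\<^sup>2) + J k c)"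
  have hm: "h k \<in> borel_measurable ?G" for k
  proof (cases "k < K")
    case False
    have "(\<lambda>c. ennreal ((system_norm n d (fs c))\<^sup>2)) \<in> borel_measurable ?G" using nm by measurable
    then have "(\<lambda>c. ennreal (1 / (R k)\<^sup>2) * ennreal ((system_norm n d (fs c))\<^sup>2) + J k c) \<in> borel_measurable ?G"
      by (intro borel_measurable_add borel_measurable_times_ennreal borel_measurable_const Jm)
    then show ?thesis using False by (simp add: h_def)
  qed (simp add: h_def)
  have hle: "(if ereal (exp (real k)) < kappa n d (fs c) then 1 else 0) \<le> h k c" for k c
  proof (cases "k < K \<or> \<not> ereal (exp (real k)) < kappa n d (fs c)")
    case False
    show ?thesis
    proof (cases "system_norm n d (fs c) \<le> R k")
      case True
      then have "1 \<le> J k c" using J1 False by blast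
      then show ?thesis using False by (simp add: h_def add_increasing)
    next
      case g: False
      have "(R k)\<^sup>2 \<le> (system_norm n d (fs c))\<^sup>2" using g R1[of k] by (intro power_mono) auto
      then have "1 \<le> 1 / (R k)\<^sup>2 * (system_norm n d (fs c))\<^sup>2" using R1[of k] by (simp add: le_divide_eq)
      then have "1 \<le> ennreal (1 / (R k)\<^sup>2 * (system_norm n d (fs c))\<^sup>2)" by (simp add: ennreal_ge_1)
      then show ?thesis using False by (simp add: h_def ennreal_mult'[symmetric] add_increasing2)
    qed
  qed (auto simp: h_def)
  have hint: "(\<integral>\<^sup>+c. h k c \<partial>?G) \<le> (if k < K then 1 else ennreal (1 / (1 + real k)\<^sup>2 + A * (1 + real k)\<^sup>2 * exp (- real k)))" for k
  proof (cases "k < K")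
    case True
    interpret G: product_prob_space "\<lambda>a. gauss (vr n d a)" ?S
      by (rule product_prob_space_gm[OF vr_pos])
    show ?thesis using True G.emeasure_space_1 by (simp add: h_def)
  next
    case False
    have "(\<integral>\<^sup>+c. h k c \<partial>?G) = ennreal (1 / (R k)\<^sup>2) * (\<integral>\<^sup>+c. ennreal ((system_norm n d (fs c))\<^sup>2) \<partial>?G) + (\<integral>\<^sup>+c. J k c \<partial>?G)"
    proof -
      have m: "(\<lambda>c. ennreal ((system_norm n d (fs c))\<^sup>2)) \<in> borel_measurable ?G" using nm by measurable
      have "(\<integral>\<^sup>+c. ennreal (1 / (R k)\<^sup>2) * ennreal ((system_norm n d (fs c))\<^sup>2) + J k c \<partial>?G) =
        (\<integral>\<^sup>+c. ennreal (1 / (R k)\<^sup>2) * ennreal ((system_norm n d (fs c))\<^sup>2) \<partial>?G) + (\<integral>\<^sup>+c. J k c \<partial>?G)"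
        by (rule nn_integral_add[OF borel_measurable_times_ennreal[OF borel_measurable_const m] Jm])
      then show ?thesis using False by (simp add: h_def nn_integral_cmult[OF m])
    qed
    also have "\<dots> \<le> ennreal (1 / (R k)\<^sup>2) * ennreal (real n * real (Suc n) ^ D) +
        ennreal (Kc n D * sqrt (real (\<Prod>j<n. d j)) * (R k)\<^sup>2 / exp (real k))"
      using d by (intro add_mono mult_left_mono system_norm_second_moment[OF n] J2) auto
    also have "\<dots> \<le> ennreal (1 / (1 + real k)\<^sup>2) + ennreal (A * (1 + real k)\<^sup>2 * exp (- real k))"
    proof (rule add_mono)
      have "1 / (R k)\<^sup>2 * (real n * real (Suc n) ^ D) \<le> 1 / (1 + real k)\<^sup>2"
      proof -
        have "real n * real (Suc n) ^ D \<le> real (Suc n) ^ Suc D * 1"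
          by (simp add: mult_right_mono)
        also have "\<dots> \<le> real (Suc n) ^ Suc D * real (Suc n) ^ Suc D"
          by (intro mult_left_mono one_le_power) auto
        finally have "real n * real (Suc n) ^ D \<le> (real (Suc n) ^ Suc D)\<^sup>2" by (simp only: power2_eq_square)
        then have "(real n * real (Suc n) ^ D) / (R k)\<^sup>2 \<le> (real (Suc n) ^ Suc D)\<^sup>2 / (R k)\<^sup>2"
          by (intro divide_right_mono) auto
        also have "\<dots> = 1 / (1 + real k)\<^sup>2"
          by (simp add: R_def power_mult_distrib del: power_Suc of_nat_Suc)
        finally show ?thesis by simp
      qed
      then show "ennreal (1 / (R k)\<^sup>2) * ennreal (real n * real (Suc n) ^ D) \<le> ennreal (1 / (1 + real k)\<^sup>2)"
        by (subst ennreal_mult[symmetric]) (auto intro!: ennreal_leI)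
      have "Kc n D * sqrt (real (\<Prod>j<n. d j)) * (R k)\<^sup>2 / exp (real k) = A * (1 + real k)\<^sup>2 * exp (- real k)"
        by (simp add: A_def R_def power_mult_distrib exp_minus divide_inverse mult_ac del: power_Suc of_nat_Suc)
      then show "ennreal (Kc n D * sqrt (real (\<Prod>j<n. d j)) * (R k)\<^sup>2 / exp (real k)) \<le> ennreal (A * (1 + real k)\<^sup>2 * exp (- real k))"
        by simp
    qed
    also have "\<dots> = ennreal (1 / (1 + real k)\<^sup>2 + A * (1 + real k)\<^sup>2 * exp (- real k))"
    proof -
      have "0 \<le> A" by (simp add: A_def Kc_def lipc_def prod_nonneg)
      then show ?thesis by (subst ennreal_plus) auto
    qed
    finally show ?thesis using False by simp
  qed
  have A0: "0 \<le> A" by (simp add: A_def Kc_def lipc_def prod_nonneg)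
  have "(\<integral>\<^sup>+\<omega>. e2ennreal (ln_ereal (kappa n d (\<lambda>i j. a i j \<omega>))) \<partial>M) \<le> (\<integral>\<^sup>+\<omega>. (\<Sum>k. h k (X \<omega>)) \<partial>M)"
  proof (intro nn_integral_mono)
    fix \<omega>
    have "kappa n d (\<lambda>i j. a i j \<omega>) = kappa n d (fs (X \<omega>))"
      by (rule kappa_cong) (simp add: fs_def X_def blks_def)
    then have "e2ennreal (ln_ereal (kappa n d (\<lambda>i j. a i j \<omega>))) \<le> (\<Sum>k. if ereal (exp (real k)) < kappa n d (fs (X \<omega>)) then 1 else 0)"
      using ln_ereal_le_suminf by simp
    also have "\<dots> \<le> (\<Sum>k. h k (X \<omega>))" by (intro suminf_le hle) auto
    finally show "e2ennreal (ln_ereal (kappa n d (\<lambda>i j. a i j \<omega>))) \<le> (\<Sum>k. h k (X \<omega>))" .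
  qed
  also have "\<dots> = (\<integral>\<^sup>+c. (\<Sum>k. h k c) \<partial>?G)"
  proof -
    have sm: "(\<lambda>c. \<Sum>k. h k c) \<in> borel_measurable (Pi\<^sub>M ?S (\<lambda>_. borel))"
    proof -
      have "(\<lambda>c. \<Sum>k. h k c) \<in> borel_measurable ?G" using hm by (intro borel_measurable_suminf_order)
      then show ?thesis
        using measurable_cong_sets[of ?G "Pi\<^sub>M ?S (\<lambda>_. borel)" borel borel] sets_PiM_cong[of ?S ?S "\<lambda>a. gauss (vr n d a)" "\<lambda>_. borel"]
        by auto
    qed
    then have "(\<lambda>c. \<Sum>k. h k c) \<in> borel_measurable (distr M (Pi\<^sub>M ?S (\<lambda>_. borel)) X)" by simp
    then show ?thesis unfolding X(2)[symmetric] by (rule nn_integral_distr[OF X(1), symmetric])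
  qed
  also have "\<dots> = (\<Sum>k. \<integral>\<^sup>+c. h k c \<partial>?G)" by (rule nn_integral_suminf[OF hm])
  also have "\<dots> \<le> (\<Sum>k. if k < K then 1 else ennreal (1 / (1 + real k)\<^sup>2 + A * (1 + real k)\<^sup>2 * exp (- real k)))"
    by (intro suminf_le hint) auto
  also have "\<dots> \<le> ennreal (real K + C1 + A * (1 + real K)\<^sup>2 * exp (- real K) * C2)"
    by (rule suminf_tail_bound[OF A0])
  finally have le: "(\<integral>\<^sup>+\<omega>. e2ennreal (ln_ereal (kappa n d (\<lambda>i j. a i j \<omega>))) \<partial>M) \<le> ennreal (real K + C1 + A * (1 + real K)\<^sup>2 * exp (- real K) * C2)" .
  have C: "0 \<le> C1" "0 \<le> C2" unfolding C1_def C2_def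
    by (intro suminf_nonneg summable_inverse_squares summable_square_exp; simp)+
  \<comment> \<open>Subtracting the integral of the negative part can only lower the value, so the
    positive part of the logarithm is enough.\<close>
  have "ereal_expectation M (\<lambda>\<omega>. ln_ereal (kappa n d (\<lambda>i j. a i j \<omega>))) \<le>
     enn2ereal (\<integral>\<^sup>+\<omega>. e2ennreal (ln_ereal (kappa n d (\<lambda>i j. a i j \<omega>))) \<partial>M)"
    unfolding ereal_expectation_def by (intro ereal_diff_le_self) simp
  also have "\<dots> \<le> enn2ereal (ennreal (real K + C1 + A * (1 + real K)\<^sup>2 * exp (- real K) * C2))"
    using le by (simp only: less_eq_ennreal.rep_eq)
  also have "\<dots> = ereal (real K + C1 + A * (1 + real K)\<^sup>2 * exp (- real K) * C2)"
    using C A0 by (intro enn2ereal_ennreal add_nonneg_nonneg mult_nonneg_nonneg) auto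
  finally show ?thesis .
qed

theorem mainTheorem3:
  fixes d :: "nat \<Rightarrow> nat \<Rightarrow> nat"
    and M :: "nat \<Rightarrow> 'a measure"
    and a :: "nat \<Rightarrow> nat \<Rightarrow> (nat \<Rightarrow> nat) \<Rightarrow> 'a \<Rightarrow> real"
  assumes "\<And>n i. i < n \<Longrightarrow> d n i \<ge> 2"
    and "\<And>n. n \<ge> 1 \<Longrightarrow> shub_smale (M n) n (d n) (a n)"
    and "bdd_above ((\<lambda>n. Max (d n ` {..<n})) ` {1..})"
  shows "limsup (\<lambda>n. ereal_expectation (M n)
                        (\<lambda>\<omega>. ln_ereal (kappa n (d n) (\<lambda>i j. a n i j \<omega>)))
                      / ereal (ln (sqrt (real (\<Prod>i<n. d n i))))) \<le> 1"
proof -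
  obtain D where D: "\<And>n. n \<ge> 1 \<Longrightarrow> Max (d n ` {..<n}) \<le> D"
    using assms(3) by (auto simp: bdd_above_def)
  have dD: "2 \<le> d n i \<and> d n i \<le> D" if "i < n" for n i
  proof
    have "d n i \<le> Max (d n ` {..<n})" using that by (intro Max_ge) auto
    also have "\<dots> \<le> D" using that by (intro D) simp
    finally show "d n i \<le> D" .
  qed (rule assms(1)[OF that])
  define L where "L = (\<lambda>n. ln (sqrt (real (\<Prod>i<n. d n i))))"
  define E where "E = (\<lambda>n. ereal_expectation (M n) (\<lambda>\<omega>. ln_ereal (kappa n (d n) (\<lambda>i j. a n i j \<omega>))))"
  define c where "c = 1310720 * exp 9 * (real D)\<^sup>2 * (2 ^ D * (real D)\<^sup>2) * (real D + 3)\<^sup>2 * C2"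
  \<comment> \<open>The exponents of \<open>n + 1\<close>: \<open>8 + 2 + (D + 1) + 1\<close> from
    \<open>Kc\<close>, \<open>2 * D + 2\<close> from the truncation of the norm and 2 from
    \<open>(1 + K)\<^sup>2\<close>.\<close>
  define m where "m = 16 + 3 * D"
  define err where "err = (\<lambda>n. c * (real (Suc n) ^ m * exp (- sqrt (real n))))"
  have C2: "0 \<le> C2" unfolding C2_def by (intro suminf_nonneg summable_square_exp) simp
  have P0: "0 < real (\<Prod>i<n. d n i)" for n
    using dD[of _ n] by (simp only: of_nat_0_less_iff) (intro prod_pos, force)
  have Llow: "real n * (ln 2 / 2) \<le> L n" for n
  proof -
    have "real (2 ^ n) = real (\<Prod>i<n. 2)" by simp
    also have "\<dots> \<le> real (\<Prod>i<n. d n i)"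
      using dD[of _ n] by (simp only: of_nat_le_iff) (intro prod_mono, simp)
    finally have "ln (2 ^ n) \<le> ln (real (\<Prod>i<n. d n i))" using P0[of n] by simp
    then show ?thesis using P0[of n] by (simp add: L_def ln_sqrt ln_realpow)
  qed
  \<comment> \<open>An upper bound for \<open>L n\<close> keeps \<open>K\<close>, and hence the
    factor \<open>(1 + K)\<^sup>2\<close>, polynomial in \<open>n\<close>.\<close>
  have Lup: "L n \<le> real n * real D" for n
  proof (cases "n = 0")
    case False
    then have D0: "0 < real D" using dD[of 0 n] by simp
    have "real (\<Prod>i<n. d n i) \<le> real (\<Prod>i<n. D)"
      using dD[of _ n] by (simp only: of_nat_le_iff) (intro prod_mono, simp)
    then have "ln (real (\<Prod>i<n. d n i)) \<le> ln (real D ^ n)" using P0[of n] D0 by simp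
    also have "\<dots> = real n * ln (real D)" using D0 by (simp add: ln_realpow)
    also have "\<dots> \<le> real n * real D" using ln_bound[OF D0] by (intro mult_left_mono) auto
    finally have "2 * L n \<le> real n * real D" using P0[of n] by (simp add: L_def ln_sqrt)
    moreover have "0 \<le> real n * real D" by simp
    ultimately show ?thesis by linarith
  qed (simp add: L_def)
  have bound: "E n \<le> ereal (L n + sqrt (real n) + 1 + C1 + err n)" if n: "1 \<le> n" for n
  proof -
    \<comment> \<open>At this level \<open>exp (- K)\<close> cancels the root of the product of the
      degrees and still leaves \<open>exp (- sqrt n)\<close>, which beats every power of
      \<open>n\<close>.\<close>
    define K where "K = nat \<lceil>L n + sqrt (real n)\<rceil>"
    have "0 \<le> L n" using Llow[of n] by (rule order_trans[rotated]) simp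
    then have K: "L n + sqrt (real n) \<le> real K" "real K \<le> L n + sqrt (real n) + 1"
      unfolding K_def using real_sqrt_ge_zero[of "real n"] by linarith+
    let ?N = "real (Suc n)"
    have sn: "sqrt (real n) \<le> real n" using n by (intro real_le_lsqrt) (auto simp: self_le_power)
    have "1 + real K \<le> real n * real D + real n + 2" using K(2) Lup[of n] sn by linarith
    also have "\<dots> \<le> (real D + 3) * ?N" by (simp add: algebra_simps)
    finally have K1: "(1 + real K)\<^sup>2 \<le> ((real D + 3) * ?N)\<^sup>2" by (intro power_mono) auto
    have "sqrt (real (\<Prod>i<n. d n i)) * exp (- real K) = exp (L n - real K)"
      using P0[of n] by (simp add: L_def exp_diff exp_minus divide_inverse)
    also have "\<dots> \<le> exp (- sqrt (real n))" using K(1) by simp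
    finally have e: "sqrt (real (\<Prod>i<n. d n i)) * exp (- real K) \<le> exp (- sqrt (real n))" .
    have Kc: "Kc n D \<le> 1310720 * exp 9 * (real D)\<^sup>2 * ?N ^ 8 * ?N\<^sup>2 * (2 ^ D * (real D)\<^sup>2 * ?N ^ Suc D) * ?N"
    proof -
      have "sqrt (real n) \<le> ?N" using sn by simp
      moreover have "real n ^ 8 \<le> ?N ^ 8" by (intro power_mono) auto
      ultimately show ?thesis unfolding Kc_def lipc_def by (intro mult_mono) auto
    qed
    have "Kc n D * sqrt (real (\<Prod>i<n. d n i)) * (?N ^ Suc D)\<^sup>2 * (1 + real K)\<^sup>2 * exp (- real K) * C2
      = Kc n D * (?N ^ Suc D)\<^sup>2 * (1 + real K)\<^sup>2 * (sqrt (real (\<Prod>i<n. d n i)) * exp (- real K)) * C2"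
      by (simp only: mult_ac)
    also have "\<dots> \<le> (1310720 * exp 9 * (real D)\<^sup>2 * ?N ^ 8 * ?N\<^sup>2 * (2 ^ D * (real D)\<^sup>2 * ?N ^ Suc D) * ?N) *
        (?N ^ Suc D)\<^sup>2 * ((real D + 3) * ?N)\<^sup>2 * exp (- sqrt (real n)) * C2"
      by (intro mult_mono Kc K1 e C2 order.refl mult_nonneg_nonneg) (auto simp: prod_nonneg)
    also have "\<dots> = err n"
    proof -
      have "?N ^ m = ?N ^ 8 * ?N\<^sup>2 * ?N ^ Suc D * ?N * (?N ^ Suc D)\<^sup>2 * ?N\<^sup>2"
        unfolding m_def power_mult[symmetric] by (simp only: power_add[symmetric] power_Suc2[symmetric]) simp
      then show ?thesis unfolding err_def c_def by (simp only: power_mult_distrib mult_ac)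
    qed
    finally have le: "Kc n D * sqrt (real (\<Prod>i<n. d n i)) * (?N ^ Suc D)\<^sup>2 * (1 + real K)\<^sup>2 * exp (- real K) * C2 \<le> err n" .
    have "E n \<le> ereal (real K + C1 + Kc n D * sqrt (real (\<Prod>i<n. d n i)) * (?N ^ Suc D)\<^sup>2 * (1 + real K)\<^sup>2 * exp (- real K) * C2)"
      unfolding E_def by (rule expectation_ln_kappa_le[OF assms(2)[OF n] n dD])
    also have "\<dots> \<le> ereal (L n + sqrt (real n) + 1 + C1 + err n)" using le K(2) by simp
    finally show ?thesis .
  qed
  define g where "g = (\<lambda>n. 1 + ((sqrt (real n) + 1 + \<bar>C1\<bar>) / real n + err n / real n) / (ln 2 / 2))"
  have err0: "0 \<le> err n" for n unfolding err_def c_def using C2 by simp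
  have "E n / ereal (L n) \<le> ereal (g n)" if n: "1 \<le> n" for n
  proof -
    have l: "0 < real n * (ln 2 / 2)" using n by simp
    then have L0: "0 < L n" using Llow[of n] by linarith
    have "E n / ereal (L n) \<le> ereal (L n + sqrt (real n) + 1 + C1 + err n) / ereal (L n)"
      using L0 by (intro ereal_divide_right_mono bound n) simp
    also have "\<dots> = ereal (1 + (sqrt (real n) + 1 + C1 + err n) / L n)"
      using L0 by (simp add: field_simps)
    also have "(sqrt (real n) + 1 + C1 + err n) / L n \<le> (sqrt (real n) + 1 + \<bar>C1\<bar> + err n) / L n"
      using L0 by (intro divide_right_mono) auto
    also have "\<dots> \<le> (sqrt (real n) + 1 + \<bar>C1\<bar> + err n) / (real n * (ln 2 / 2))"
      using n l L0 Llow[of n] err0[of n] by (intro divide_left_mono mult_pos_pos) auto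
    also have "1 + \<dots> = g n"
      by (simp add: g_def add_divide_distrib)
    finally show ?thesis by simp
  qed
  then have "limsup (\<lambda>n. E n / ereal (L n)) \<le> limsup (\<lambda>n. ereal (g n))"
    by (intro Limsup_mono eventually_sequentiallyI)
  also have "\<dots> = 1"
  proof -
    have "(\<lambda>n. sqrt (real n) ^ (2 * m) / exp (sqrt (real n))) \<longlonglongrightarrow> 0"
      by (rule filterlim_compose[OF tendsto_power_div_exp_0]) real_asymp
    then have z: "(\<lambda>n. c * 2 ^ m * (sqrt (real n) ^ (2 * m) / exp (sqrt (real n)))) \<longlonglongrightarrow> 0"
      by (rule tendsto_mult_right_zero)
    have "err \<longlonglongrightarrow> 0"
    proof (rule tendsto_sandwich[OF _ _ tendsto_const z])
      show "\<forall>\<^sub>F n in sequentially. 0 \<le> err n" using err0 by simp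
      show "\<forall>\<^sub>F n in sequentially. err n \<le> c * 2 ^ m * (sqrt (real n) ^ (2 * m) / exp (sqrt (real n)))"
      proof (rule eventually_sequentiallyI)
        fix n :: nat assume n: "1 \<le> n"
        have "real (Suc n) ^ m \<le> (2 * (sqrt (real n))\<^sup>2) ^ m" using n by (intro power_mono) auto
        also have "\<dots> = 2 ^ m * sqrt (real n) ^ (2 * m)" by (simp only: power_mult_distrib power_mult)
        finally have "real (Suc n) ^ m * exp (- sqrt (real n)) \<le> 2 ^ m * sqrt (real n) ^ (2 * m) * exp (- sqrt (real n))"
          by (intro mult_right_mono) auto
        moreover have "0 \<le> c" unfolding c_def using C2 by simp
        ultimately show "err n \<le> c * 2 ^ m * (sqrt (real n) ^ (2 * m) / exp (sqrt (real n)))"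
          unfolding err_def by (simp only: exp_minus divide_inverse mult.assoc mult_left_mono)
      qed
    qed
    then have "(\<lambda>n. err n * (1 / real n)) \<longlonglongrightarrow> 0 * 0"
      by (rule tendsto_mult) real_asymp
    then have e: "(\<lambda>n. err n / real n) \<longlonglongrightarrow> 0" by simp
    have "(\<lambda>n. (sqrt (real n) + 1 + \<bar>C1\<bar>) / real n) \<longlonglongrightarrow> 0" by real_asymp
    then have "g \<longlonglongrightarrow> 1 + (0 + 0) / (ln 2 / 2)"
      unfolding g_def by (intro tendsto_intros e) auto
    then have "(\<lambda>n. ereal (g n)) \<longlonglongrightarrow> 1" by (simp add: one_ereal_def)
    then show ?thesis by (intro lim_imp_Limsup) auto
  qed
  finally show ?thesis unfolding E_def L_def .
qed

end
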